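(* Let $R$ be a commutative ring and $\mathcal{P}$ an operad over $R$. Then the opposite $\mathsf{KL}_{\mathcal{P}}^{op}$ of the Kleisli category of the monad $(\mathsf{S}(\mathcal{P},-),\gamma,\eta)$ on $\mathsf{MOD}_R$, with the differential combinator $\mathsf{D}[f]=\partial_V\circ f$, is a Cartesian differential category.
   Context: $R$ is a commutative ring. An operad $\mathcal{P}$ is a symmetric operad in $R$-modules: $R$-modules $\mathcal{P}(n)$, $n\ge0$, with right $\Sigma(n)$-actions, a unit $1_{\mathcal{P}}\in\mathcal{P}(1)$ and partial compositions with the usual axioms; $\mu(\nu_1,\dots,\nu_k)$ is the complete composition. Its monad on $\mathsf{MOD}_R$: $\mathsf{S}(\mathcal{P},V)=\bigoplus_{n\ge0}(\mathcal{P}(n)\otimes V^{\otimes n})_{\Sigma(n)}$, with $(\mu;v_1,\dots,v_n)$ the class of $\mu\otimes v_1\otimes\cdots\otimes v_n$; unit $\eta_V(v)=(1_{\mathcal{P}};v)$; multiplication $\gamma_V(\mu;(\nu_1;v_{1,1},\dots,v_{1,n_1}),\dots,(\nu_k;v_{k,1},\dots,v_{k,n_k}))=(\mu(\nu_1,\dots,\nu_k);v_{1,1},\dots,v_{k,n_k})$. Also $\partial_V:\mathsf{S}(\mathcal{P},V)\to\mathsf{S}(\mathcal{P},V\times V)$ is the $R$-linear map $\partial_V(\mu;v_1,\dots,v_n)=\sum_{i=1}^n(\mu;(v_1,0),\dots,(0,v_i),\dots,(v_n,0))$. Objects of $\mathsf{KL}_{\mathcal{P}}^{op}$ are $R$-modules;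 a map $V\to W$ in $\mathsf{KL}_{\mathcal{P}}^{op}$ is an $R$-linear map $f:W\to\mathsf{S}(\mathcal{P},V)$, with (opposite) Kleisli composition. Finite products are given by $V\times W$, and homsets have pointwise addition of $R$-linear maps. For $f:V\to W$ in $\mathsf{KL}_{\mathcal{P}}^{op}$, $\mathsf{D}[f]:V\times V\to W$ is the $R$-linear map $\partial_V\circ f:W\to\mathsf{S}(\mathcal{P},V\times V)$. A Cartesian left additive category is a category with finite products whose homsets are commutative monoids such that $(f+g)\circ h=f\circ h+g\circ h$, $0\circ h=0$, and projections satisfy $\pi_j\circ(f+g)=\pi_j\circ f+\pi_j\circ g$, $\pi_j\circ0=0$. A Cartesian differential category is a Cartesian left additive category with operators $\mathsf{D}:\mathbb{X}(A,B)\to\mathbb{X}(A\times A,B)$ such that: [CD.1] $\mathsf{D}[f+g]=\mathsf{D}[f]+\mathsf{D}[g]$, $\mathsf{D}[0]=0$; [CD.2] $\mathsf{D}[f]\circ\langle g,h+k\rangle=\mathsf{D}[f]\circ\langle g,h\rangle+\mathsf{D}[f]\circ\langle g,k\rangle$, $\mathsf{D}[f]\circ\langle g,0\rangle=0$; [CD.3] $\mathsf{D}[1_A]=\pi_2$, $\mathsf{D}[\pi_j]=\pi_j\circ\pi_2$; [CD.4] $\mathsf{D}[\langle f_1,\dots,f_n\rangle]=\langle\mathsf{D}[f_1],\dots,\mathsf{D}[f_n]\rangle$; [CD.5] $\mathsf{D}[g\circ f]=\mathsf{D}[g]\circ\langle f\circ\pi_1,\mathsf{D}[f]\rangle$; [CD.6]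 $\mathsf{D}[\mathsf{D}[f]]\circ\langle\langle g,0\rangle,\langle0,h\rangle\rangle=\mathsf{D}[f]\circ\langle g,h\rangle$; [CD.7] $\mathsf{D}[\mathsf{D}[f]]\circ\langle\langle g,h\rangle,\langle k,j\rangle\rangle=\mathsf{D}[\mathsf{D}[f]]\circ\langle\langle g,k\rangle,\langle h,j\rangle\rangle$. *)

theory Defs
  imports "HOL-Combinatorics.Permutations" "HOL-Algebra.AbelCoset" "HOL-Algebra.Module"
begin

section \<open>Modules\<close>

text \<open>
  The module records of HOL-Algebra extend ring records. Their fields \<open>mult\<close> and \<open>one\<close> play no role
  for modules and are left \<open>undefined\<close> in the constructions below. Linear maps are extensional
  functions, so that equality of maps is equality of functions.
\<close>

definition linear_maps ::
    "('r, 'c) ring_scheme \<Rightarrow> ('r, 'a) module \<Rightarrow> ('r, 'b) module \<Rightarrow> ('a \<Rightarrow> 'b) set" where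
  "linear_maps R M N =
    {f \<in> carrier M \<rightarrow>\<^sub>E carrier N.
       (\<forall>x\<in>carrier M. \<forall>y\<in>carrier M. f (x \<oplus>\<^bsub>M\<^esub> y) = f x \<oplus>\<^bsub>N\<^esub> f y) \<and>
       (\<forall>r\<in>carrier R. \<forall>x\<in>carrier M. f (r \<odot>\<^bsub>M\<^esub> x) = r \<odot>\<^bsub>N\<^esub> f x)}"

definition regular_module :: "('r, 'c) ring_scheme \<Rightarrow> ('r, 'r) module" where
  "regular_module R =
    \<lparr>carrier = carrier R, monoid.mult = undefined, one = undefined, zero = \<zero>\<^bsub>R\<^esub>,
     add = (\<lambda>x y. x \<oplus>\<^bsub>R\<^esub> y), smult = (\<lambda>r x. r \<otimes>\<^bsub>R\<^esub> x)\<rparr>"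

definition zero_module :: "('r, 'a) module" where
  "zero_module =
    \<lparr>carrier = {undefined}, monoid.mult = undefined, one = undefined, zero = undefined,
     add = (\<lambda>x y. undefined), smult = (\<lambda>r x. undefined)\<rparr>"

definition direct_sum :: "'i set \<Rightarrow> ('i \<Rightarrow> ('r, 'a) module) \<Rightarrow> ('r, 'i \<Rightarrow> 'a) module" where
  "direct_sum I M =
    \<lparr>carrier = {f \<in> (\<Pi>\<^sub>E i\<in>I. carrier (M i)). finite {i\<in>I. f i \<noteq> \<zero>\<^bsub>M i\<^esub>}},
     monoid.mult = undefined, one = undefined,
     zero = (\<lambda>i\<in>I. \<zero>\<^bsub>M i\<^esub>),
     add = (\<lambda>f g. \<lambda>i\<in>I. f i \<oplus>\<^bsub>M i\<^esub> g i),
     smult = (\<lambda>r f. \<lambda>i\<in>I. r \<odot>\<^bsub>M i\<^esub> f i)\<rparr>"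

definition direct_sum_incl :: "'i set \<Rightarrow> ('i \<Rightarrow> ('r, 'a) module) \<Rightarrow> 'i \<Rightarrow> 'a \<Rightarrow> 'i \<Rightarrow> 'a" where
  "direct_sum_incl I M i x = (\<lambda>k\<in>I. if k = i then x else \<zero>\<^bsub>M k\<^esub>)"

definition free_module :: "('r, 'c) ring_scheme \<Rightarrow> 'i set \<Rightarrow> ('r, 'i \<Rightarrow> 'r) module" where
  "free_module R I = direct_sum I (\<lambda>_. regular_module R)"

definition free_gen :: "('r, 'c) ring_scheme \<Rightarrow> 'i set \<Rightarrow> 'i \<Rightarrow> 'i \<Rightarrow> 'r" where
  "free_gen R I i = direct_sum_incl I (\<lambda>_. regular_module R) i \<one>\<^bsub>R\<^esub>"

definition generated_submodule ::
    "('r, 'c) ring_scheme \<Rightarrow> ('r, 'a) module \<Rightarrow> 'a set \<Rightarrow> 'a set" where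
  "generated_submodule R M A = \<Inter>{H. submodule H R M \<and> A \<subseteq> H}"

definition quotient_module :: "('r, 'a) module \<Rightarrow> 'a set \<Rightarrow> ('r, 'a set) module" where
  "quotient_module M N =
    \<lparr>carrier = a_rcosets\<^bsub>M\<^esub> N, monoid.mult = undefined, one = undefined, zero = N,
     add = (\<lambda>X Y. X <+>\<^bsub>M\<^esub> Y),
     smult = (\<lambda>r X. \<Union>x\<in>X. N +>\<^bsub>M\<^esub> (r \<odot>\<^bsub>M\<^esub> x))\<rparr>"

text \<open>
  So that a product has its elements in the same type as its factors, pairs are encoded by an injection \<open>pr\<close> of \<open>'u \<times> 'u\<close> into \<open>'u\<close>.
\<close>

definition prod_module ::
    "('u \<times> 'u \<Rightarrow> 'u) \<Rightarrow> ('r, 'u) module \<Rightarrow> ('r, 'u) module \<Rightarrow> ('r, 'u) module" where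
  "prod_module pr V W =
    \<lparr>carrier = pr ` (carrier V \<times> carrier W), monoid.mult = undefined, one = undefined,
     zero = pr (\<zero>\<^bsub>V\<^esub>, \<zero>\<^bsub>W\<^esub>),
     add = (\<lambda>x y. pr (fst (inv_into UNIV pr x) \<oplus>\<^bsub>V\<^esub> fst (inv_into UNIV pr y),
                       snd (inv_into UNIV pr x) \<oplus>\<^bsub>W\<^esub> snd (inv_into UNIV pr y))),
     smult = (\<lambda>r x. pr (r \<odot>\<^bsub>V\<^esub> fst (inv_into UNIV pr x), r \<odot>\<^bsub>W\<^esub> snd (inv_into UNIV pr x)))\<rparr>"


section \<open>Operads\<close>

text \<open>
  The modules \<open>Ops P n\<close> share one element type but need not be disjoint; hence the arities are
  explicit arguments: \<open>pcomp P m n i \<mu> \<nu>\<close> is the partial composition of \<open>\<mu>\<close> of arity \<open>m\<close> with \<open>\<nu>\<close> of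
  arity \<open>n\<close> at input \<open>i\<close>. Inputs are numbered from \<open>0\<close>, and \<open>\<Sigma>(n)\<close> is the group of permutations of
  \<open>{..<n}\<close>.
\<close>

record ('r, 'p) operad =
  Ops :: "nat \<Rightarrow> ('r, 'p) module"
  act :: "nat \<Rightarrow> 'p \<Rightarrow> (nat \<Rightarrow> nat) \<Rightarrow> 'p"
  ounit :: 'p
  pcomp :: "nat \<Rightarrow> nat \<Rightarrow> nat \<Rightarrow> 'p \<Rightarrow> 'p \<Rightarrow> 'p"

text \<open>
  Position, after an operation of arity \<open>n\<close> has been inserted at input \<open>i\<close>, of the former input \<open>k\<close>
  (where \<open>k \<noteq> i\<close>).
\<close>

definition shift_input :: "nat \<Rightarrow> nat \<Rightarrow> nat \<Rightarrow> nat" where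
  "shift_input i n k = (if k < i then k else k + n - 1)"

text \<open>
  The partial composition of permutations: \<open>\<tau> \<in> \<Sigma>(n)\<close> is inserted at position \<open>i\<close> of \<open>\<sigma> \<in> \<Sigma>(m)\<close>. The
  convention is that input \<open>j\<close> of \<open>\<mu>\<sigma>\<close> is input \<open>\<sigma> j\<close> of \<open>\<mu>\<close>, as in the endomorphism operad with
  \<open>(\<mu>\<sigma>)(v\<^sub>1,\<dots>,v\<^sub>n) = \<mu>(v\<^bsub>\<sigma>\<^sup>-\<^sup>1(1)\<^esub>,\<dots>,v\<^bsub>\<sigma>\<^sup>-\<^sup>1(n)\<^esub>)\<close>.
\<close>

definition perm_pcomp ::
    "nat \<Rightarrow> nat \<Rightarrow> nat \<Rightarrow> (nat \<Rightarrow> nat) \<Rightarrow> (nat \<Rightarrow> nat) \<Rightarrow> nat \<Rightarrow> nat" where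
  "perm_pcomp m n i \<sigma> \<tau> p =
    (if p < i then shift_input (\<sigma> i) n (\<sigma> p)
     else if p < i + n then \<sigma> i + \<tau> (p - i)
     else if p < m + n - 1 then shift_input (\<sigma> i) n (\<sigma> (p + 1 - n))
     else p)"

locale operad =
  fixes R :: "('r, 'c) ring_scheme" and P :: "('r, 'p) operad"
  assumes ops_module: "\<And>n. module R (Ops P n)"
    and act_linear: "\<And>n \<sigma>. \<sigma> permutes {..<n} \<Longrightarrow>
      (\<lambda>\<mu>\<in>carrier (Ops P n). act P n \<mu> \<sigma>) \<in> linear_maps R (Ops P n) (Ops P n)"
    and act_id: "\<And>n \<mu>. \<mu> \<in> carrier (Ops P n) \<Longrightarrow> act P n \<mu> id = \<mu>"
    and act_comp: "\<And>n \<mu> \<sigma> \<tau>.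
      \<lbrakk>\<mu> \<in> carrier (Ops P n); \<sigma> permutes {..<n}; \<tau> permutes {..<n}\<rbrakk> \<Longrightarrow>
      act P n (act P n \<mu> \<sigma>) \<tau> = act P n \<mu> (\<sigma> \<circ> \<tau>)"
    and pcomp_linear_left: "\<And>m n i \<nu>. \<lbrakk>i < m; \<nu> \<in> carrier (Ops P n)\<rbrakk> \<Longrightarrow>
      (\<lambda>\<mu>\<in>carrier (Ops P m). pcomp P m n i \<mu> \<nu>) \<in> linear_maps R (Ops P m) (Ops P (m + n - 1))"
    and pcomp_linear_right: "\<And>m n i \<mu>. \<lbrakk>i < m; \<mu> \<in> carrier (Ops P m)\<rbrakk> \<Longrightarrow>
      (\<lambda>\<nu>\<in>carrier (Ops P n). pcomp P m n i \<mu> \<nu>) \<in> linear_maps R (Ops P n) (Ops P (m + n - 1))"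
    and ounit_closed: "ounit P \<in> carrier (Ops P 1)"
    and ounit_left: "\<And>n \<nu>. \<nu> \<in> carrier (Ops P n) \<Longrightarrow> pcomp P 1 n 0 (ounit P) \<nu> = \<nu>"
    and ounit_right: "\<And>m i \<mu>. \<lbrakk>i < m; \<mu> \<in> carrier (Ops P m)\<rbrakk> \<Longrightarrow> pcomp P m 1 i \<mu> (ounit P) = \<mu>"
    and pcomp_sequential: "\<And>l m n i j \<kappa> \<mu> \<nu>.
      \<lbrakk>i < l; j < m; \<kappa> \<in> carrier (Ops P l); \<mu> \<in> carrier (Ops P m); \<nu> \<in> carrier (Ops P n)\<rbrakk> \<Longrightarrow>
      pcomp P (l + m - 1) n (i + j) (pcomp P l m i \<kappa> \<mu>) \<nu> =
      pcomp P l (m + n - 1) i \<kappa> (pcomp P m n j \<mu> \<nu>)"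
    and pcomp_parallel: "\<And>l m n i k \<kappa> \<mu> \<nu>.
      \<lbrakk>i < k; k < l; \<kappa> \<in> carrier (Ops P l); \<mu> \<in> carrier (Ops P m); \<nu> \<in> carrier (Ops P n)\<rbrakk> \<Longrightarrow>
      pcomp P (l + m - 1) n (k + m - 1) (pcomp P l m i \<kappa> \<mu>) \<nu> =
      pcomp P (l + n - 1) m i (pcomp P l n k \<kappa> \<nu>) \<mu>"
    and pcomp_equivariant: "\<And>m n i \<mu> \<nu> \<sigma> \<tau>.
      \<lbrakk>i < m; \<mu> \<in> carrier (Ops P m); \<nu> \<in> carrier (Ops P n);
       \<sigma> permutes {..<m}; \<tau> permutes {..<n}\<rbrakk> \<Longrightarrow>
      pcomp P m n i (act P m \<mu> \<sigma>) (act P n \<nu> \<tau>) =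
      act P (m + n - 1) (pcomp P m n (\<sigma> i) \<mu> \<nu>) (perm_pcomp m n i \<sigma> \<tau>)"

text \<open>
  Complete composition, obtained by inserting \<open>\<nu>\<^sub>1, \<dots>, \<nu>\<^sub>k\<close> from left to right. In the auxiliary
  function, \<open>a\<close> is the current arity and \<open>i\<close> the position of the next input to be filled.
\<close>

fun insert_from :: "('r, 'p) operad \<Rightarrow> nat \<Rightarrow> nat \<Rightarrow> 'p \<Rightarrow> (nat \<times> 'p) list \<Rightarrow> 'p" where
  "insert_from P a i \<mu> [] = \<mu>"
| "insert_from P a i \<mu> ((n, \<nu>) # \<nu>s) =
     insert_from P (a + n - 1) (i + n) (pcomp P a n i \<mu> \<nu>) \<nu>s"

definition full_comp :: "('r, 'p) operad \<Rightarrow> 'p \<Rightarrow> (nat \<times> 'p) list \<Rightarrow> 'p" where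
  "full_comp P \<mu> \<nu>s = insert_from P (length \<nu>s) 0 \<mu> \<nu>s"


section \<open>The monad of an operad\<close>

subsection \<open>The modules \<open>\<P>(n) \<otimes> V\<^sup>n\<close>\<close>

text \<open>The tensor product \<open>M \<otimes> V \<otimes> \<dots> \<otimes> V\<close> with \<open>n\<close> factors \<open>V\<close>: free module modulo multilinearity.\<close>

definition tensor_index :: "('r, 'p) module \<Rightarrow> ('r, 'v) module \<Rightarrow> nat \<Rightarrow> ('p \<times> 'v list) set" where
  "tensor_index M V n = carrier M \<times> {vs. length vs = n \<and> set vs \<subseteq> carrier V}"

definition tensor_relations ::
    "('r, 'c) ring_scheme \<Rightarrow> ('r, 'p) module \<Rightarrow> ('r, 'v) module \<Rightarrow> nat \<Rightarrow> ('p \<times> 'v list \<Rightarrow> 'r) set" where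
  "tensor_relations R M V n =
    (let I = tensor_index M V n; F = free_module R I; g = (\<lambda>\<mu> vs. free_gen R I (\<mu>, vs)) in
     {g (\<mu> \<oplus>\<^bsub>M\<^esub> \<mu>') vs \<ominus>\<^bsub>F\<^esub> (g \<mu> vs \<oplus>\<^bsub>F\<^esub> g \<mu>' vs) | \<mu> \<mu>' vs.
        (\<mu>, vs) \<in> I \<and> \<mu>' \<in> carrier M} \<union>
     {g (r \<odot>\<^bsub>M\<^esub> \<mu>) vs \<ominus>\<^bsub>F\<^esub> (r \<odot>\<^bsub>F\<^esub> g \<mu> vs) | r \<mu> vs.
        (\<mu>, vs) \<in> I \<and> r \<in> carrier R} \<union>
     {g \<mu> (vs[i := v \<oplus>\<^bsub>V\<^esub> w]) \<ominus>\<^bsub>F\<^esub> (g \<mu> (vs[i := v]) \<oplus>\<^bsub>F\<^esub> g \<mu> (vs[i := w])) | \<mu> vs i v w.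
        (\<mu>, vs) \<in> I \<and> i < n \<and> v \<in> carrier V \<and> w \<in> carrier V} \<union>
     {g \<mu> (vs[i := r \<odot>\<^bsub>V\<^esub> v]) \<ominus>\<^bsub>F\<^esub> (r \<odot>\<^bsub>F\<^esub> g \<mu> (vs[i := v])) | \<mu> vs i r v.
        (\<mu>, vs) \<in> I \<and> i < n \<and> r \<in> carrier R \<and> v \<in> carrier V})"

definition tensor_kernel ::
    "('r, 'c) ring_scheme \<Rightarrow> ('r, 'p) module \<Rightarrow> ('r, 'v) module \<Rightarrow> nat \<Rightarrow> ('p \<times> 'v list \<Rightarrow> 'r) set" where
  "tensor_kernel R M V n =
    generated_submodule R (free_module R (tensor_index M V n)) (tensor_relations R M V n)"

definition tensor ::
    "('r, 'c) ring_scheme \<Rightarrow> ('r, 'p) module \<Rightarrow> ('r, 'v) module \<Rightarrow> nat \<Rightarrow>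
     ('r, ('p \<times> 'v list \<Rightarrow> 'r) set) module" where
  "tensor R M V n = quotient_module (free_module R (tensor_index M V n)) (tensor_kernel R M V n)"

definition pure_tensor ::
    "('r, 'c) ring_scheme \<Rightarrow> ('r, 'p) module \<Rightarrow> ('r, 'v) module \<Rightarrow> nat \<Rightarrow> 'p \<Rightarrow> 'v list \<Rightarrow>
     ('p \<times> 'v list \<Rightarrow> 'r) set" where
  "pure_tensor R M V n \<mu> vs =
    tensor_kernel R M V n +>\<^bsub>free_module R (tensor_index M V n)\<^esub>
      free_gen R (tensor_index M V n) (\<mu>, vs)"

subsection \<open>Coinvariants and the Schur functor\<close>

text \<open>
  The symmetric group acts from the right on both factors:
  \<open>(\<mu> \<otimes> v\<^sub>1 \<otimes> \<dots> \<otimes> v\<^sub>n)\<sigma> = \<mu>\<sigma> \<otimes> v\<^bsub>\<sigma>(1)\<^esub> \<otimes> \<dots> \<otimes> v\<^bsub>\<sigma>(n)\<^esub>\<close>. The coinvariants are the quotient by the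
  submodule generated by the elements \<open>x\<sigma> - x\<close>, for which pure tensors \<open>x\<close> suffice.
\<close>

definition coinvariants_kernel ::
    "('r, 'c) ring_scheme \<Rightarrow> ('r, 'p) operad \<Rightarrow> ('r, 'v) module \<Rightarrow> nat \<Rightarrow>
     ('p \<times> 'v list \<Rightarrow> 'r) set set" where
  "coinvariants_kernel R P V n =
    (let T = tensor R (Ops P n) V n; t = pure_tensor R (Ops P n) V n in
     generated_submodule R T
       {t (act P n \<mu> \<sigma>) (permute_list \<sigma> vs) \<ominus>\<^bsub>T\<^esub> t \<mu> vs | \<mu> vs \<sigma>.
          (\<mu>, vs) \<in> tensor_index (Ops P n) V n \<and> \<sigma> permutes {..<n}})"

definition coinvariants ::
    "('r, 'c) ring_scheme \<Rightarrow> ('r, 'p) operad \<Rightarrow> ('r, 'v) module \<Rightarrow> nat \<Rightarrow>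
     ('r, ('p \<times> 'v list \<Rightarrow> 'r) set set) module" where
  "coinvariants R P V n =
    quotient_module (tensor R (Ops P n) V n) (coinvariants_kernel R P V n)"

type_synonym ('r, 'p, 'v) schur = "nat \<Rightarrow> ('p \<times> 'v list \<Rightarrow> 'r) set set"

definition Schur ::
    "('r, 'c) ring_scheme \<Rightarrow> ('r, 'p) operad \<Rightarrow> ('r, 'v) module \<Rightarrow>
     ('r, ('r, 'p, 'v) schur) module" where
  "Schur R P V = direct_sum UNIV (coinvariants R P V)"

text \<open>The class \<open>(\<mu>; v\<^sub>1, \<dots>, v\<^sub>n)\<close>, where \<open>n\<close> is the length of the list.\<close>

definition cls ::
    "('r, 'c) ring_scheme \<Rightarrow> ('r, 'p) operad \<Rightarrow> ('r, 'v) module \<Rightarrow> 'p \<Rightarrow> 'v list \<Rightarrow>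
     ('r, 'p, 'v) schur" where
  "cls R P V \<mu> vs =
    (let n = length vs in
     direct_sum_incl UNIV (coinvariants R P V) n
       (coinvariants_kernel R P V n +>\<^bsub>tensor R (Ops P n) V n\<^esub> pure_tensor R (Ops P n) V n \<mu> vs))"

subsection \<open>Functor, unit, multiplication, and the map \<open>\<partial>\<close>\<close>

text \<open>
  These are the unique linear maps with the stated values on classes. In \<open>Schur_mult\<close>, a list of
  entries \<open>(\<nu>, vs)\<close> represents the classes \<open>(\<nu>\<^sub>i; v\<^bsub>i,1\<^esub>, \<dots>, v\<^bsub>i,n\<^sub>i\<^esub>)\<close>.
\<close>

definition Schur_map ::
    "('r, 'c) ring_scheme \<Rightarrow> ('r, 'p) operad \<Rightarrow> ('r, 'v) module \<Rightarrow> ('r, 'w) module \<Rightarrow>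
     ('v \<Rightarrow> 'w) \<Rightarrow> ('r, 'p, 'v) schur \<Rightarrow> ('r, 'p, 'w) schur" where
  "Schur_map R P V W f =
    (THE h. h \<in> linear_maps R (Schur R P V) (Schur R P W) \<and>
      (\<forall>\<mu> vs. \<mu> \<in> carrier (Ops P (length vs)) \<longrightarrow> set vs \<subseteq> carrier V \<longrightarrow>
         h (cls R P V \<mu> vs) = cls R P W \<mu> (map f vs)))"

definition Schur_unit ::
    "('r, 'c) ring_scheme \<Rightarrow> ('r, 'p) operad \<Rightarrow> ('r, 'v) module \<Rightarrow> 'v \<Rightarrow> ('r, 'p, 'v) schur" where
  "Schur_unit R P V = (\<lambda>v\<in>carrier V. cls R P V (ounit P) [v])"

definition Schur_mult ::
    "('r, 'c) ring_scheme \<Rightarrow> ('r, 'p) operad \<Rightarrow> ('r, 'v) module \<Rightarrow>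
     ('r, 'p, ('r, 'p, 'v) schur) schur \<Rightarrow> ('r, 'p, 'v) schur" where
  "Schur_mult R P V =
    (THE h. h \<in> linear_maps R (Schur R P (Schur R P V)) (Schur R P V) \<and>
      (\<forall>\<mu> xs. \<mu> \<in> carrier (Ops P (length xs)) \<longrightarrow>
         (\<forall>(\<nu>, vs)\<in>set xs. \<nu> \<in> carrier (Ops P (length vs)) \<and> set vs \<subseteq> carrier V) \<longrightarrow>
         h (cls R P (Schur R P V) \<mu> (map (\<lambda>(\<nu>, vs). cls R P V \<nu> vs) xs)) =
         cls R P V (full_comp P \<mu> (map (\<lambda>(\<nu>, vs). (length vs, \<nu>)) xs)) (concat (map snd xs))))"

definition Schur_partial ::
    "('r, 'c) ring_scheme \<Rightarrow> ('r, 'p) operad \<Rightarrow> ('u \<times> 'u \<Rightarrow> 'u) \<Rightarrow> ('r, 'u) module \<Rightarrow>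
     ('r, 'p, 'u) schur \<Rightarrow> ('r, 'p, 'u) schur" where
  "Schur_partial R P pr V =
    (let S = Schur R P (prod_module pr V V) in
     THE h. h \<in> linear_maps R (Schur R P V) S \<and>
      (\<forall>\<mu> vs. \<mu> \<in> carrier (Ops P (length vs)) \<longrightarrow> set vs \<subseteq> carrier V \<longrightarrow>
         h (cls R P V \<mu> vs) =
         (\<Oplus>\<^bsub>S\<^esub> i\<in>{..<length vs}. cls R P (prod_module pr V V) \<mu>
            (map (\<lambda>j. if j = i then pr (\<zero>\<^bsub>V\<^esub>, vs ! j) else pr (vs ! j, \<zero>\<^bsub>V\<^esub>)) [0..<length vs]))))"


section \<open>Cartesian differential categories\<close>

text \<open>
  Homsets need not be disjoint, so operations on maps take the objects involved as arguments:
  \<open>Comp C X Y Z g f\<close> is \<open>g \<circ> f\<close> for \<open>f : X \<rightarrow> Y\<close> and \<open>g : Y \<rightarrow> Z\<close>, and \<open>Diff C X Y f : X \<times> X \<rightarrow> Y\<close> is \<open>D[f]\<close>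
  for \<open>f : X \<rightarrow> Y\<close>.
\<close>

record ('o, 'm) cat =
  Obj :: "'o set"
  Hom :: "'o \<Rightarrow> 'o \<Rightarrow> 'm set"
  Id :: "'o \<Rightarrow> 'm"
  Comp :: "'o \<Rightarrow> 'o \<Rightarrow> 'o \<Rightarrow> 'm \<Rightarrow> 'm \<Rightarrow> 'm"

record ('o, 'm) cdc = "('o, 'm) cat" +
  Term :: 'o
  Prod :: "'o \<Rightarrow> 'o \<Rightarrow> 'o"
  Fst :: "'o \<Rightarrow> 'o \<Rightarrow> 'm"
  Snd :: "'o \<Rightarrow> 'o \<Rightarrow> 'm"
  Plus :: "'o \<Rightarrow> 'o \<Rightarrow> 'm \<Rightarrow> 'm \<Rightarrow> 'm"
  Zero :: "'o \<Rightarrow> 'o \<Rightarrow> 'm"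
  Diff :: "'o \<Rightarrow> 'o \<Rightarrow> 'm \<Rightarrow> 'm"

locale category =
  fixes C :: "('o, 'm, 'z) cat_scheme"
  assumes Id_hom: "\<And>X. X \<in> Obj C \<Longrightarrow> Id C X \<in> Hom C X X"
    and Comp_hom: "\<And>X Y Z f g.
      \<lbrakk>X \<in> Obj C; Y \<in> Obj C; Z \<in> Obj C; f \<in> Hom C X Y; g \<in> Hom C Y Z\<rbrakk> \<Longrightarrow>
      Comp C X Y Z g f \<in> Hom C X Z"
    and Id_left: "\<And>X Y f. \<lbrakk>X \<in> Obj C; Y \<in> Obj C; f \<in> Hom C X Y\<rbrakk> \<Longrightarrow>
      Comp C X Y Y (Id C Y) f = f"
    and Id_right: "\<And>X Y f. \<lbrakk>X \<in> Obj C; Y \<in> Obj C; f \<in> Hom C X Y\<rbrakk> \<Longrightarrow>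
      Comp C X X Y f (Id C X) = f"
    and Comp_assoc: "\<And>W X Y Z f g h.
      \<lbrakk>W \<in> Obj C; X \<in> Obj C; Y \<in> Obj C; Z \<in> Obj C;
       f \<in> Hom C W X; g \<in> Hom C X Y; h \<in> Hom C Y Z\<rbrakk> \<Longrightarrow>
      Comp C W Y Z h (Comp C W X Y g f) = Comp C W X Z (Comp C X Y Z h g) f"

definition opposite :: "('o, 'm) cat \<Rightarrow> ('o, 'm) cat" where
  "opposite C =
    \<lparr>Obj = Obj C, Hom = (\<lambda>X Y. Hom C Y X), Id = Id C, Comp = (\<lambda>X Y Z g f. Comp C Z Y X f g)\<rparr>"

locale finite_products = category C for C :: "('o, 'm, 'z) cdc_scheme" +
  assumes Term_obj: "Term C \<in> Obj C"
    and terminal: "\<And>X. X \<in> Obj C \<Longrightarrow> \<exists>!f. f \<in> Hom C X (Term C)"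
    and Prod_obj: "\<And>A B. \<lbrakk>A \<in> Obj C; B \<in> Obj C\<rbrakk> \<Longrightarrow> Prod C A B \<in> Obj C"
    and Fst_hom: "\<And>A B. \<lbrakk>A \<in> Obj C; B \<in> Obj C\<rbrakk> \<Longrightarrow> Fst C A B \<in> Hom C (Prod C A B) A"
    and Snd_hom: "\<And>A B. \<lbrakk>A \<in> Obj C; B \<in> Obj C\<rbrakk> \<Longrightarrow> Snd C A B \<in> Hom C (Prod C A B) B"
    and product: "\<And>X A B f g.
      \<lbrakk>X \<in> Obj C; A \<in> Obj C; B \<in> Obj C; f \<in> Hom C X A; g \<in> Hom C X B\<rbrakk> \<Longrightarrow>
      \<exists>!h. h \<in> Hom C X (Prod C A B) \<and>
           Comp C X (Prod C A B) A (Fst C A B) h = f \<and>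
           Comp C X (Prod C A B) B (Snd C A B) h = g"

text \<open>
  The map \<open>\<langle>f, g\<rangle> : X \<rightarrow> A \<times> B\<close> for \<open>f : X \<rightarrow> A\<close> and \<open>g : X \<rightarrow> B\<close>, and the \<open>n\<close>-ary products
  \<open>A\<^sub>1 \<times> (A\<^sub>2 \<times> (\<dots> \<times> A\<^sub>n))\<close> with their projections (numbered from \<open>0\<close>) and tuples.
\<close>

definition pairing :: "('o, 'm, 'z) cdc_scheme \<Rightarrow> 'o \<Rightarrow> 'o \<Rightarrow> 'o \<Rightarrow> 'm \<Rightarrow> 'm \<Rightarrow> 'm" where
  "pairing C X A B f g =
    (THE h. h \<in> Hom C X (Prod C A B) \<and>
       Comp C X (Prod C A B) A (Fst C A B) h = f \<and>
       Comp C X (Prod C A B) B (Snd C A B) h = g)"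

fun nprod :: "('o, 'm, 'z) cdc_scheme \<Rightarrow> 'o list \<Rightarrow> 'o" where
  "nprod C [] = Term C"
| "nprod C [A] = A"
| "nprod C (A # B # As) = Prod C A (nprod C (B # As))"

fun nproj :: "('o, 'm, 'z) cdc_scheme \<Rightarrow> 'o list \<Rightarrow> nat \<Rightarrow> 'm" where
  "nproj C [] j = undefined"
| "nproj C [A] j = Id C A"
| "nproj C (A # B # As) 0 = Fst C A (nprod C (B # As))"
| "nproj C (A # B # As) (Suc j) =
     Comp C (nprod C (A # B # As)) (nprod C (B # As)) ((B # As) ! j)
       (nproj C (B # As) j) (Snd C A (nprod C (B # As)))"

fun ntuple :: "('o, 'm, 'z) cdc_scheme \<Rightarrow> 'o \<Rightarrow> ('o \<times> 'm) list \<Rightarrow> 'm" where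
  "ntuple C X [] = (THE f. f \<in> Hom C X (Term C))"
| "ntuple C X [(A, f)] = f"
| "ntuple C X ((A, f) # g # fs) =
     pairing C X A (nprod C (map fst (g # fs))) f (ntuple C X (g # fs))"

locale cartesian_left_additive_category = finite_products C for C :: "('o, 'm, 'z) cdc_scheme" +
  assumes hom_monoid: "\<And>X Y. \<lbrakk>X \<in> Obj C; Y \<in> Obj C\<rbrakk> \<Longrightarrow>
      comm_monoid \<lparr>carrier = Hom C X Y, monoid.mult = Plus C X Y, one = Zero C X Y\<rparr>"
    and Plus_Comp: "\<And>X Y Z f g h.
      \<lbrakk>X \<in> Obj C; Y \<in> Obj C; Z \<in> Obj C; h \<in> Hom C X Y; f \<in> Hom C Y Z; g \<in> Hom C Y Z\<rbrakk> \<Longrightarrow>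
      Comp C X Y Z (Plus C Y Z f g) h = Plus C X Z (Comp C X Y Z f h) (Comp C X Y Z g h)"
    and Zero_Comp: "\<And>X Y Z h.
      \<lbrakk>X \<in> Obj C; Y \<in> Obj C; Z \<in> Obj C; h \<in> Hom C X Y\<rbrakk> \<Longrightarrow>
      Comp C X Y Z (Zero C Y Z) h = Zero C X Z"
    and nproj_Plus: "\<And>X As j f g.
      \<lbrakk>X \<in> Obj C; set As \<subseteq> Obj C; j < length As;
       f \<in> Hom C X (nprod C As); g \<in> Hom C X (nprod C As)\<rbrakk> \<Longrightarrow>
      Comp C X (nprod C As) (As ! j) (nproj C As j) (Plus C X (nprod C As) f g) =
      Plus C X (As ! j) (Comp C X (nprod C As) (As ! j) (nproj C As j) f)
                        (Comp C X (nprod C As) (As ! j) (nproj C As j) g)"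
    and nproj_Zero: "\<And>X As j.
      \<lbrakk>X \<in> Obj C; set As \<subseteq> Obj C; j < length As\<rbrakk> \<Longrightarrow>
      Comp C X (nprod C As) (As ! j) (nproj C As j) (Zero C X (nprod C As)) = Zero C X (As ! j)"

locale cartesian_differential_category = cartesian_left_additive_category C
  for C :: "('o, 'm, 'z) cdc_scheme" +
  assumes Diff_hom: "\<And>A B f. \<lbrakk>A \<in> Obj C; B \<in> Obj C; f \<in> Hom C A B\<rbrakk> \<Longrightarrow>
      Diff C A B f \<in> Hom C (Prod C A A) B"
    and CD1_Plus: "\<And>A B f g. \<lbrakk>A \<in> Obj C; B \<in> Obj C; f \<in> Hom C A B; g \<in> Hom C A B\<rbrakk> \<Longrightarrow>
      Diff C A B (Plus C A B f g) = Plus C (Prod C A A) B (Diff C A B f) (Diff C A B g)"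
    and CD1_Zero: "\<And>A B. \<lbrakk>A \<in> Obj C; B \<in> Obj C\<rbrakk> \<Longrightarrow>
      Diff C A B (Zero C A B) = Zero C (Prod C A A) B"
    and CD2_Plus: "\<And>X A B f g h k.
      \<lbrakk>X \<in> Obj C; A \<in> Obj C; B \<in> Obj C; f \<in> Hom C A B;
       g \<in> Hom C X A; h \<in> Hom C X A; k \<in> Hom C X A\<rbrakk> \<Longrightarrow>
      Comp C X (Prod C A A) B (Diff C A B f) (pairing C X A A g (Plus C X A h k)) =
      Plus C X B (Comp C X (Prod C A A) B (Diff C A B f) (pairing C X A A g h))
                 (Comp C X (Prod C A A) B (Diff C A B f) (pairing C X A A g k))"
    and CD2_Zero: "\<And>X A B f g.
      \<lbrakk>X \<in> Obj C; A \<in> Obj C; B \<in> Obj C; f \<in> Hom C A B; g \<in> Hom C X A\<rbrakk> \<Longrightarrow>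
      Comp C X (Prod C A A) B (Diff C A B f) (pairing C X A A g (Zero C X A)) = Zero C X B"
    and CD3_Id: "\<And>A. A \<in> Obj C \<Longrightarrow> Diff C A A (Id C A) = Snd C A A"
    and CD3_nproj: "\<And>As j. \<lbrakk>set As \<subseteq> Obj C; j < length As\<rbrakk> \<Longrightarrow>
      Diff C (nprod C As) (As ! j) (nproj C As j) =
      Comp C (Prod C (nprod C As) (nprod C As)) (nprod C As) (As ! j)
        (nproj C As j) (Snd C (nprod C As) (nprod C As))"
    and CD4: "\<And>X fs.
      \<lbrakk>X \<in> Obj C; \<forall>(A, f)\<in>set fs. A \<in> Obj C \<and> f \<in> Hom C X A\<rbrakk> \<Longrightarrow>
      Diff C X (nprod C (map fst fs)) (ntuple C X fs) =
      ntuple C (Prod C X X) (map (\<lambda>(A, f). (A, Diff C X A f)) fs)"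
    and CD5: "\<And>X Y Z f g.
      \<lbrakk>X \<in> Obj C; Y \<in> Obj C; Z \<in> Obj C; f \<in> Hom C X Y; g \<in> Hom C Y Z\<rbrakk> \<Longrightarrow>
      Diff C X Z (Comp C X Y Z g f) =
      Comp C (Prod C X X) (Prod C Y Y) Z (Diff C Y Z g)
        (pairing C (Prod C X X) Y Y (Comp C (Prod C X X) X Y f (Fst C X X)) (Diff C X Y f))"
    and CD6: "\<And>X A B f g h.
      \<lbrakk>X \<in> Obj C; A \<in> Obj C; B \<in> Obj C; f \<in> Hom C A B; g \<in> Hom C X A; h \<in> Hom C X A\<rbrakk> \<Longrightarrow>
      Comp C X (Prod C (Prod C A A) (Prod C A A)) B
        (Diff C (Prod C A A) B (Diff C A B f))
        (pairing C X (Prod C A A) (Prod C A A)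
           (pairing C X A A g (Zero C X A)) (pairing C X A A (Zero C X A) h)) =
      Comp C X (Prod C A A) B (Diff C A B f) (pairing C X A A g h)"
    and CD7: "\<And>X A B f g h k j.
      \<lbrakk>X \<in> Obj C; A \<in> Obj C; B \<in> Obj C; f \<in> Hom C A B;
       g \<in> Hom C X A; h \<in> Hom C X A; k \<in> Hom C X A; j \<in> Hom C X A\<rbrakk> \<Longrightarrow>
      Comp C X (Prod C (Prod C A A) (Prod C A A)) B
        (Diff C (Prod C A A) B (Diff C A B f))
        (pairing C X (Prod C A A) (Prod C A A) (pairing C X A A g h) (pairing C X A A k j)) =
      Comp C X (Prod C (Prod C A A) (Prod C A A)) B
        (Diff C (Prod C A A) B (Diff C A B f))
        (pairing C X (Prod C A A) (Prod C A A) (pairing C X A A g k) (pairing C X A A h j))"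


section \<open>The Kleisli category\<close>

text \<open>
  The objects are all \<open>R\<close>-modules with elements in the type \<open>'u\<close>; a map from \<open>V\<close> to \<open>W\<close> is a linear map
  from \<open>V\<close> to \<open>Schur R P W\<close>.
\<close>

definition Kleisli ::
    "('r, 'c) ring_scheme \<Rightarrow> ('r, 'p) operad \<Rightarrow>
     (('r, 'u) module, 'u \<Rightarrow> ('r, 'p, 'u) schur) cat" where
  "Kleisli R P =
    \<lparr>Obj = {V. module R V},
     Hom = (\<lambda>V W. linear_maps R V (Schur R P W)),
     Id = Schur_unit R P,
     Comp = (\<lambda>U V W g f. \<lambda>u\<in>carrier U.
       Schur_mult R P W (Schur_map R P V (Schur R P W) g (f u)))\<rparr>"

text \<open>
  The projections of \<open>V \<times> W\<close> in the opposite category are \<open>v \<mapsto> (1; (v, 0))\<close> and \<open>w \<mapsto> (1; (0, w))\<close>.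
\<close>

definition KLop ::
    "('r, 'c) ring_scheme \<Rightarrow> ('r, 'p) operad \<Rightarrow> ('u \<times> 'u \<Rightarrow> 'u) \<Rightarrow>
     (('r, 'u) module, 'u \<Rightarrow> ('r, 'p, 'u) schur) cdc" where
  "KLop R P pr = cat.extend (opposite (Kleisli R P))
    \<lparr>Term = zero_module,
     Prod = prod_module pr,
     Fst = (\<lambda>V W. \<lambda>v\<in>carrier V. Schur_unit R P (prod_module pr V W) (pr (v, \<zero>\<^bsub>W\<^esub>))),
     Snd = (\<lambda>V W. \<lambda>w\<in>carrier W. Schur_unit R P (prod_module pr V W) (pr (\<zero>\<^bsub>V\<^esub>, w))),
     Plus = (\<lambda>V W f g. \<lambda>w\<in>carrier W. f w \<oplus>\<^bsub>Schur R P V\<^esub> g w),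
     Zero = (\<lambda>V W. \<lambda>w\<in>carrier W. \<zero>\<^bsub>Schur R P V\<^esub>),
     Diff = (\<lambda>V W f. \<lambda>w\<in>carrier W. Schur_partial R P pr V (f w))\<rparr>"

end

theory Submission
  imports Defs
begin

text \<open>
  The Schur functor \<open>S V\<close> is the free \<open>\<P>\<close>-algebra on \<open>V\<close>. The action \<open>app V \<mu> [x\<^sub>1, \<dots>, x\<^sub>n]\<close> of operations on
  it is determined by multilinearity, by its values on units \<open>(1; v)\<close>, and by the rule that an argument
  \<open>(\<nu>; u\<^sub>1, \<dots>, u\<^sub>k)\<close> may be replaced by the units of \<open>u\<^sub>1, \<dots>, u\<^sub>k\<close> once \<open>\<nu>\<close> is inserted into \<open>\<mu>\<close>. All
  identities for \<open>app\<close> are proved by reduction to units along this rule.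

  A Kleisli map \<open>f\<close> extends to an algebra homomorphism \<open>kext f\<close>, and composition with \<open>f\<close> is
  composition with \<open>kext f\<close>. Given \<open>f\<close> and \<open>g\<close> there is a unique derivation \<open>kder f g\<close> along \<open>kext f\<close> that
  extends \<open>g\<close>; in particular \<open>\<partial> = kder \<pi>\<^sub>1 \<pi>\<^sub>2\<close>. The Leibniz rule is the chain rule CD.5. The composite of \<open>\<partial>\<close>
  with \<open>kext \<langle>g, h\<rangle>\<close> is \<open>kder g h\<close>, which is additive in \<open>h\<close>: this is CD.2. A second derivative of a
  monomial is a sum over pairs of inputs; its symmetry is CD.7, and its diagonal part gives CD.6.
\<close>

section \<open>Modules and their universal constructions\<close>

text \<open>\<open>Schur_mult\<close> and \<open>Schur_partial\<close> are definite descriptions, so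
  each needs a linear map with the prescribed values. Such maps are built from families that are
  multilinear in the operation and the arguments and invariant under the symmetric groups. The
  obstacle for the multiplication is that its value must respect the coinvariants in the outer
  operation and in every argument at once; with complete compositions this leads to block
  permutations. Inserting the arguments of \<open>app\<close> one at a time keeps to
  \<open>perm_pcomp\<close> with one of its two permutations the identity. The two associativity
  axioms then have separate jobs: the parallel one lets insertions at different inputs commute
  (\<open>papp_insert\<close>), the sequential one makes the action associative
  (\<open>app_assoc\<close>). Complete composition is matched with \<open>app\<close> in
  \<open>app_map_cls\<close>. On the categorical side arrows are reversed: a map into a product is a
  linear map on the module of pairs, hence the sum of its two restrictions, and composing it with a
  projection evaluates it at pairs with one zero entry.\<close>

lemma linear_mapsD:
  assumes "f \<in> linear_maps R M N"
  shows "x \<in> carrier M \<Longrightarrow> f x \<in> carrier N"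
    and "\<lbrakk>x \<in> carrier M; y \<in> carrier M\<rbrakk> \<Longrightarrow> f (x \<oplus>\<^bsub>M\<^esub> y) = f x \<oplus>\<^bsub>N\<^esub> f y"
    and "\<lbrakk>r \<in> carrier R; x \<in> carrier M\<rbrakk> \<Longrightarrow> f (r \<odot>\<^bsub>M\<^esub> x) = r \<odot>\<^bsub>N\<^esub> f x"
    and "f \<in> extensional (carrier M)"
  using assms by (auto simp: linear_maps_def PiE_def)

lemma linear_mapsI:
  assumes "\<And>x. x \<in> carrier M \<Longrightarrow> f x \<in> carrier N"
    and "\<And>x y. \<lbrakk>x \<in> carrier M; y \<in> carrier M\<rbrakk> \<Longrightarrow> f (x \<oplus>\<^bsub>M\<^esub> y) = f x \<oplus>\<^bsub>N\<^esub> f y"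
    and "\<And>r x. \<lbrakk>r \<in> carrier R; x \<in> carrier M\<rbrakk> \<Longrightarrow> f (r \<odot>\<^bsub>M\<^esub> x) = r \<odot>\<^bsub>N\<^esub> f x"
    and "f \<in> extensional (carrier M)"
  shows "f \<in> linear_maps R M N"
  using assms by (auto simp: linear_maps_def PiE_def)

lemma restrict_linear_maps:
  assumes "module R M"
    and "\<And>x. x \<in> carrier M \<Longrightarrow> f x \<in> carrier N"
    and "\<And>x y. \<lbrakk>x \<in> carrier M; y \<in> carrier M\<rbrakk> \<Longrightarrow> f (x \<oplus>\<^bsub>M\<^esub> y) = f x \<oplus>\<^bsub>N\<^esub> f y"
    and "\<And>r x. \<lbrakk>r \<in> carrier R; x \<in> carrier M\<rbrakk> \<Longrightarrow> f (r \<odot>\<^bsub>M\<^esub> x) = r \<odot>\<^bsub>N\<^esub> f x"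
  shows "(\<lambda>x\<in>carrier M. f x) \<in> linear_maps R M N"
proof -
  interpret M: module R M by fact
  show ?thesis by (rule linear_mapsI) (auto simp: assms)
qed

lemma linear_maps_eqI:
  assumes "f \<in> linear_maps R M N" "g \<in> linear_maps R M N'"
    and "\<And>x. x \<in> carrier M \<Longrightarrow> f x = g x"
  shows "f = g"
  using assms by (blast intro: extensionalityI linear_mapsD)

lemma linear_maps_zero:
  assumes "f \<in> linear_maps R M N" "module R M" "module R N"
  shows "f \<zero>\<^bsub>M\<^esub> = \<zero>\<^bsub>N\<^esub>"
proof -
  interpret M: module R M by fact
  interpret N: module R N by fact
  have "f (\<zero>\<^bsub>R\<^esub> \<odot>\<^bsub>M\<^esub> \<zero>\<^bsub>M\<^esub>) = \<zero>\<^bsub>R\<^esub> \<odot>\<^bsub>N\<^esub> f \<zero>\<^bsub>M\<^esub>"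
    by (rule linear_mapsD(3)[OF assms(1)]) auto
  then show ?thesis using linear_mapsD(1)[OF assms(1)] by simp
qed

lemma linear_maps_a_inv:
  assumes "f \<in> linear_maps R M N" "module R M" "module R N" "x \<in> carrier M"
  shows "f (\<ominus>\<^bsub>M\<^esub> x) = \<ominus>\<^bsub>N\<^esub> f x"
proof -
  interpret M: module R M by fact
  interpret N: module R N by fact
  have "f (\<ominus>\<^bsub>M\<^esub> x) \<oplus>\<^bsub>N\<^esub> f x = f (\<ominus>\<^bsub>M\<^esub> x \<oplus>\<^bsub>M\<^esub> x)"
    using assms(4) by (simp add: linear_mapsD[OF assms(1)])
  also have "\<dots> = \<zero>\<^bsub>N\<^esub>"
    using assms(4) by (simp add: M.l_neg linear_maps_zero[OF assms(1-3)])
  finally show ?thesis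
    using assms(4) linear_mapsD(1)[OF assms(1)] N.minus_equality[of "f (\<ominus>\<^bsub>M\<^esub> x)" "f x"] by simp
qed

lemma linear_maps_minus:
  assumes "f \<in> linear_maps R M N" "module R M" "module R N" "x \<in> carrier M" "y \<in> carrier M"
  shows "f (x \<ominus>\<^bsub>M\<^esub> y) = f x \<ominus>\<^bsub>N\<^esub> f y"
proof -
  interpret M: module R M by fact
  show ?thesis using assms
    by (simp add: a_minus_def linear_mapsD(2)[OF assms(1)] linear_maps_a_inv[OF assms(1-3)])
qed

lemma linear_maps_finsum:
  assumes "f \<in> linear_maps R M N" "module R M" "module R N"
    and "finite A" "g \<in> A \<rightarrow> carrier M"
  shows "f (\<Oplus>\<^bsub>M\<^esub> i\<in>A. g i) = (\<Oplus>\<^bsub>N\<^esub> i\<in>A. f (g i))"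
proof -
  interpret M: module R M by fact
  interpret N: module R N by fact
  from assms(4,5) show ?thesis
  proof (induction A rule: finite_induct)
    case empty
    then show ?case by (simp add: linear_maps_zero[OF assms(1-3)])
  next
    case (insert a A)
    then have "g \<in> A \<rightarrow> carrier M" "g a \<in> carrier M" "(\<lambda>i. f (g i)) \<in> A \<rightarrow> carrier N" "f (g a) \<in> carrier N"
      using linear_mapsD(1)[OF assms(1)] by auto
    then show ?case
      using insert by (simp add: linear_mapsD(2)[OF assms(1)])
  qed
qed

lemma linear_maps_compose:
  assumes "f \<in> linear_maps R M N" "g \<in> linear_maps R N Q" "module R M"
  shows "(\<lambda>x\<in>carrier M. g (f x)) \<in> linear_maps R M Q"
  by (rule restrict_linear_maps[OF assms(3)])
    (simp_all add: linear_mapsD[OF assms(1)] linear_mapsD[OF assms(2)])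

text \<open>For CD.7: interchanging the sums exchanges the inputs hit by the two
  derivatives.\<close>

lemma finsum_swap:
  assumes "module R N" "finite A" "finite B" "\<And>i j. i \<in> A \<Longrightarrow> j \<in> B \<Longrightarrow> f i j \<in> carrier N"
  shows "(\<Oplus>\<^bsub>N\<^esub> i\<in>A. \<Oplus>\<^bsub>N\<^esub> j\<in>B. f i j) = (\<Oplus>\<^bsub>N\<^esub> j\<in>B. \<Oplus>\<^bsub>N\<^esub> i\<in>A. f i j)"
proof -
  interpret N: module R N by fact
  from assms(2,4) show ?thesis
  proof (induction A rule: finite_induct)
    case empty
    then show ?case by simp
  next
    case (insert a A)
    then have "(\<Oplus>\<^bsub>N\<^esub> i\<in>insert a A. \<Oplus>\<^bsub>N\<^esub> j\<in>B. f i j) =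
        (\<Oplus>\<^bsub>N\<^esub> j\<in>B. f a j) \<oplus>\<^bsub>N\<^esub> (\<Oplus>\<^bsub>N\<^esub> j\<in>B. \<Oplus>\<^bsub>N\<^esub> i\<in>A. f i j)"
      by (subst N.finsum_insert) (auto intro!: N.finsum_closed)
    also have "\<dots> = (\<Oplus>\<^bsub>N\<^esub> j\<in>B. f a j \<oplus>\<^bsub>N\<^esub> (\<Oplus>\<^bsub>N\<^esub> i\<in>A. f i j))"
      using insert by (subst N.finsum_addf) (auto intro!: N.finsum_closed)
    also have "\<dots> = (\<Oplus>\<^bsub>N\<^esub> j\<in>B. \<Oplus>\<^bsub>N\<^esub> i\<in>insert a A. f i j)"
      using insert by (intro N.finsum_cong') (auto intro!: N.finsum_closed)
    finally show ?case .
  qed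
qed

subsection \<open>Quotients\<close>

lemma generated_submodule_incl: "A \<subseteq> generated_submodule R M A"
  by (auto simp: generated_submodule_def)

text \<open>The intersection is over a nonempty family because \<open>carrier M\<close> belongs to
  it; this is where \<open>A \<subseteq> carrier M\<close> enters.\<close>

lemma submodule_generated_submodule:
  assumes "module R M" "A \<subseteq> carrier M"
  shows "submodule (generated_submodule R M A) R M"
proof -
  interpret M: module R M by fact
  have c: "carrier M \<in> {H. submodule H R M \<and> A \<subseteq> H}"
    using M.carrier_is_submodule assms by simp
  show ?thesis
  proof (rule M.submoduleI)
    show "generated_submodule R M A \<subseteq> carrier M"
      using c by (auto simp: generated_submodule_def)
    show "\<zero>\<^bsub>M\<^esub> \<in> generated_submodule R M A"
      using subgroup.one_closed[of _ "add_monoid M"]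
      by (auto simp: generated_submodule_def submodule_def)
  qed (auto simp: generated_submodule_def dest: M.submoduleE)
qed

text \<open>The kernel of \<open>f\<close> is one of the submodules over which
  \<open>generated_submodule\<close> intersects.\<close>

lemma linear_maps_vanish_generated:
  assumes "module R M" "module R N" "f \<in> linear_maps R M N" "A \<subseteq> carrier M"
    and "\<And>a. a \<in> A \<Longrightarrow> f a = \<zero>\<^bsub>N\<^esub>" "x \<in> generated_submodule R M A"
  shows "f x = \<zero>\<^bsub>N\<^esub>"
proof -
  interpret M: module R M by fact
  interpret N: module R N by fact
  have "submodule {x \<in> carrier M. f x = \<zero>\<^bsub>N\<^esub>} R M"
    by (rule M.submoduleI)
      (auto simp: linear_mapsD[OF assms(3)] linear_maps_zero[OF assms(3,1,2)]
        linear_maps_a_inv[OF assms(3,1,2)])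
  moreover have "A \<subseteq> {x \<in> carrier M. f x = \<zero>\<^bsub>N\<^esub>}" using assms by auto
  ultimately show ?thesis using assms(6) by (auto simp: generated_submodule_def)
qed

context
  fixes R :: "('r, 'c) ring_scheme" and M :: "('r, 'a) module" and H
  assumes M: "module R M" and H: "submodule H R M"
begin

interpretation M: module R M by (rule M)
interpretation H: abelian_subgroup H M
  by (rule abelian_subgroupI3)
    (simp_all add: additive_subgroup_def submodule.axioms(1)[OF H] M.abelian_group_axioms)

lemma coset_eq_iff:
  assumes "x \<in> carrier M" "y \<in> carrier M"
  shows "H +>\<^bsub>M\<^esub> x = H +>\<^bsub>M\<^esub> y \<longleftrightarrow> x \<ominus>\<^bsub>M\<^esub> y \<in> H"
  unfolding a_minus_def
  using H.a_rcos_module[OF assms(2,1)] H.a_repr_independence'[OF _ assms(2), of x]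
    H.a_repr_independenceD[OF assms(1), of y] by auto

lemma quotient_carrier: "carrier (quotient_module M H) = (\<lambda>x. H +>\<^bsub>M\<^esub> x) ` carrier M"
  by (auto simp: quotient_module_def A_RCOSETS_def' a_r_coset_def')

lemma quotient_add:
  assumes "x \<in> carrier M" "y \<in> carrier M"
  shows "(H +>\<^bsub>M\<^esub> x) \<oplus>\<^bsub>quotient_module M H\<^esub> (H +>\<^bsub>M\<^esub> y) = H +>\<^bsub>M\<^esub> (x \<oplus>\<^bsub>M\<^esub> y)"
  using H.a_rcos_sum[OF assms] by (simp add: quotient_module_def)

text \<open>The union in \<open>quotient_module\<close> runs over all representatives of the coset.
  Their multiples lie in one and the same coset, so the union collapses to it.\<close>

lemma quotient_smult:
  assumes r: "r \<in> carrier R" and x: "x \<in> carrier M"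
  shows "r \<odot>\<^bsub>quotient_module M H\<^esub> (H +>\<^bsub>M\<^esub> x) = H +>\<^bsub>M\<^esub> (r \<odot>\<^bsub>M\<^esub> x)"
proof -
  have "H +>\<^bsub>M\<^esub> (r \<odot>\<^bsub>M\<^esub> y) = H +>\<^bsub>M\<^esub> (r \<odot>\<^bsub>M\<^esub> x)" if y: "y \<in> H +>\<^bsub>M\<^esub> x" for y
  proof -
    have y': "y \<in> carrier M" using H.a_elemrcos_carrier[OF x y] .
    have "y \<ominus>\<^bsub>M\<^esub> x \<in> H"
      using H.a_repr_independence'[OF y x] coset_eq_iff[OF y' x] by simp
    then have "r \<odot>\<^bsub>M\<^esub> (y \<ominus>\<^bsub>M\<^esub> x) \<in> H" by (rule submodule.smult_closed[OF H r])
    then have "r \<odot>\<^bsub>M\<^esub> y \<ominus>\<^bsub>M\<^esub> r \<odot>\<^bsub>M\<^esub> x \<in> H"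
      using r x y' by (simp add: a_minus_def M.smult_r_distr M.smult_r_minus)
    then show ?thesis using coset_eq_iff r x y' by simp
  qed
  then have "(\<Union>y\<in>H +>\<^bsub>M\<^esub> x. H +>\<^bsub>M\<^esub> (r \<odot>\<^bsub>M\<^esub> y)) = (\<Union>y\<in>H +>\<^bsub>M\<^esub> x. H +>\<^bsub>M\<^esub> (r \<odot>\<^bsub>M\<^esub> x))"
    by (rule SUP_cong[OF refl])
  also have "\<dots> = H +>\<^bsub>M\<^esub> (r \<odot>\<^bsub>M\<^esub> x)"
    using H.a_rcos_self[OF x] by blast
  finally show ?thesis by (simp add: quotient_module_def)
qed

lemma quotient_zero: "\<zero>\<^bsub>quotient_module M H\<^esub> = H +>\<^bsub>M\<^esub> \<zero>\<^bsub>M\<^esub>"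
  using M.a_coset_add_zero[OF H.a_subset] by (simp add: quotient_module_def)

lemma quotient_module: "module R (quotient_module M H)"
proof (rule moduleI)
  show "abelian_group (quotient_module M H)"
  proof (rule abelian_groupI)
    show "\<exists>y\<in>carrier (quotient_module M H). y \<oplus>\<^bsub>quotient_module M H\<^esub> X = \<zero>\<^bsub>quotient_module M H\<^esub>"
      if "X \<in> carrier (quotient_module M H)" for X
    proof -
      obtain x where x: "x \<in> carrier M" "X = H +>\<^bsub>M\<^esub> x"
        using \<open>X \<in> _\<close> by (auto simp: quotient_carrier)
      then have "(H +>\<^bsub>M\<^esub> (\<ominus>\<^bsub>M\<^esub> x)) \<oplus>\<^bsub>quotient_module M H\<^esub> X = \<zero>\<^bsub>quotient_module M H\<^esub>"
        by (simp add: quotient_add quotient_zero M.l_neg)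
      then show ?thesis using x by (auto simp: quotient_carrier)
    qed
  qed (auto simp: quotient_carrier quotient_add quotient_zero M.a_assoc, auto simp: M.a_comm)
qed (auto simp: quotient_carrier quotient_add quotient_smult M.is_cring
    M.smult_l_distr M.smult_r_distr M.smult_assoc1)

text \<open>The value at a coset is \<open>f\<close> at a chosen representative; two representatives
  differ by an element of \<open>H\<close>, where \<open>f\<close> vanishes.\<close>

lemma quotient_lift:
  assumes N: "module R N" and f: "f \<in> linear_maps R M N"
    and van: "\<And>x. x \<in> H \<Longrightarrow> f x = \<zero>\<^bsub>N\<^esub>"
  obtains h where "h \<in> linear_maps R (quotient_module M H) N"
    and "\<And>x. x \<in> carrier M \<Longrightarrow> h (H +>\<^bsub>M\<^esub> x) = f x"
proof
  interpret N: module R N by (rule N)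
  define h where "h = (\<lambda>X\<in>carrier (quotient_module M H). f (SOME x. x \<in> carrier M \<and> H +>\<^bsub>M\<^esub> x = X))"
  show eq: "h (H +>\<^bsub>M\<^esub> x) = f x" if x: "x \<in> carrier M" for x
  proof -
    define y where "y = (SOME y. y \<in> carrier M \<and> H +>\<^bsub>M\<^esub> y = H +>\<^bsub>M\<^esub> x)"
    have y: "y \<in> carrier M" "H +>\<^bsub>M\<^esub> y = H +>\<^bsub>M\<^esub> x"
      using someI[of "\<lambda>y. y \<in> carrier M \<and> H +>\<^bsub>M\<^esub> y = H +>\<^bsub>M\<^esub> x" x] x by (auto simp: y_def)
    then have "f (y \<ominus>\<^bsub>M\<^esub> x) = \<zero>\<^bsub>N\<^esub>" using coset_eq_iff x van by simp
    moreover have "y = (y \<ominus>\<^bsub>M\<^esub> x) \<oplus>\<^bsub>M\<^esub> x"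
      using x y by (simp add: a_minus_def M.a_assoc M.l_neg)
    ultimately have "f y = f x"
      using linear_mapsD[OF f] x y by (metis M.minus_closed N.l_zero)
    then show ?thesis using x by (simp add: h_def y_def quotient_carrier)
  qed
  show "h \<in> linear_maps R (quotient_module M H) N"
    by (rule linear_mapsI)
     (auto simp: quotient_carrier quotient_add quotient_smult eq linear_mapsD[OF f], simp add: h_def quotient_carrier)
qed

end

subsection \<open>Direct sums\<close>

context
  fixes R :: "('r, 'c) ring_scheme" and I :: "'i set" and M :: "'i \<Rightarrow> ('r, 'a) module"
  assumes R: "cring R" and M: "\<And>i. i \<in> I \<Longrightarrow> module R (M i)"
begin

lemma direct_sum_component: "f \<in> carrier (direct_sum I M) \<Longrightarrow> i \<in> I \<Longrightarrow> f i \<in> carrier (M i)"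
  by (auto simp: direct_sum_def)

private lemma M_simps:
  assumes "i \<in> I"
  shows "\<zero>\<^bsub>M i\<^esub> \<in> carrier (M i)"
    "x \<in> carrier (M i) \<Longrightarrow> \<zero>\<^bsub>M i\<^esub> \<oplus>\<^bsub>M i\<^esub> x = x"
    "x \<in> carrier (M i) \<Longrightarrow> x \<oplus>\<^bsub>M i\<^esub> \<zero>\<^bsub>M i\<^esub> = x"
    "x \<in> carrier (M i) \<Longrightarrow> y \<in> carrier (M i) \<Longrightarrow> x \<oplus>\<^bsub>M i\<^esub> y \<in> carrier (M i)"
    "r \<in> carrier R \<Longrightarrow> x \<in> carrier (M i) \<Longrightarrow> r \<odot>\<^bsub>M i\<^esub> x \<in> carrier (M i)"
    "r \<in> carrier R \<Longrightarrow> r \<odot>\<^bsub>M i\<^esub> \<zero>\<^bsub>M i\<^esub> = \<zero>\<^bsub>M i\<^esub>"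
    "x \<in> carrier (M i) \<Longrightarrow> \<ominus>\<^bsub>M i\<^esub> x \<in> carrier (M i)"
    "x \<in> carrier (M i) \<Longrightarrow> \<ominus>\<^bsub>M i\<^esub> x \<oplus>\<^bsub>M i\<^esub> x = \<zero>\<^bsub>M i\<^esub>"
    "\<ominus>\<^bsub>M i\<^esub> \<zero>\<^bsub>M i\<^esub> = \<zero>\<^bsub>M i\<^esub>"
proof -
  interpret N: module R "M i" by (rule M[OF assms])
  show "\<zero>\<^bsub>M i\<^esub> \<in> carrier (M i)"
    "x \<in> carrier (M i) \<Longrightarrow> \<zero>\<^bsub>M i\<^esub> \<oplus>\<^bsub>M i\<^esub> x = x"
    "x \<in> carrier (M i) \<Longrightarrow> x \<oplus>\<^bsub>M i\<^esub> \<zero>\<^bsub>M i\<^esub> = x"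
    "x \<in> carrier (M i) \<Longrightarrow> y \<in> carrier (M i) \<Longrightarrow> x \<oplus>\<^bsub>M i\<^esub> y \<in> carrier (M i)"
    "r \<in> carrier R \<Longrightarrow> x \<in> carrier (M i) \<Longrightarrow> r \<odot>\<^bsub>M i\<^esub> x \<in> carrier (M i)"
    "r \<in> carrier R \<Longrightarrow> r \<odot>\<^bsub>M i\<^esub> \<zero>\<^bsub>M i\<^esub> = \<zero>\<^bsub>M i\<^esub>"
    "x \<in> carrier (M i) \<Longrightarrow> \<ominus>\<^bsub>M i\<^esub> x \<in> carrier (M i)"
    "x \<in> carrier (M i) \<Longrightarrow> \<ominus>\<^bsub>M i\<^esub> x \<oplus>\<^bsub>M i\<^esub> x = \<zero>\<^bsub>M i\<^esub>"
    "\<ominus>\<^bsub>M i\<^esub> \<zero>\<^bsub>M i\<^esub> = \<zero>\<^bsub>M i\<^esub>"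
    by (simp_all add: N.l_neg N.M.minus_equality)
qed

lemma direct_sum_support: "f \<in> carrier (direct_sum I M) \<Longrightarrow> finite {i \<in> I. f i \<noteq> \<zero>\<^bsub>M i\<^esub>}"
  by (simp add: direct_sum_def)

lemma direct_sum_carrierI:
  assumes "\<And>i. i \<in> I \<Longrightarrow> f i \<in> carrier (M i)" "f \<in> extensional I" "finite {i \<in> I. f i \<noteq> \<zero>\<^bsub>M i\<^esub>}"
  shows "f \<in> carrier (direct_sum I M)"
  using assms by (simp add: direct_sum_def PiE_iff)

lemma direct_sum_simps:
  "i \<in> I \<Longrightarrow> (f \<oplus>\<^bsub>direct_sum I M\<^esub> g) i = f i \<oplus>\<^bsub>M i\<^esub> g i"
  "i \<in> I \<Longrightarrow> (r \<odot>\<^bsub>direct_sum I M\<^esub> f) i = r \<odot>\<^bsub>M i\<^esub> f i"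
  "i \<in> I \<Longrightarrow> \<zero>\<^bsub>direct_sum I M\<^esub> i = \<zero>\<^bsub>M i\<^esub>"
  by (simp_all add: direct_sum_def)

lemma direct_sum_add_closed:
  assumes "f \<in> carrier (direct_sum I M)" "g \<in> carrier (direct_sum I M)"
  shows "f \<oplus>\<^bsub>direct_sum I M\<^esub> g \<in> carrier (direct_sum I M)"
proof (rule direct_sum_carrierI)
  show "finite {i \<in> I. (f \<oplus>\<^bsub>direct_sum I M\<^esub> g) i \<noteq> \<zero>\<^bsub>M i\<^esub>}"
    by (rule finite_subset[OF _ finite_UnI[OF direct_sum_support[OF assms(1)] direct_sum_support[OF assms(2)]]])
      (auto simp: direct_sum_simps M_simps)
qed (auto simp: direct_sum_simps M_simps direct_sum_component assms, simp add: direct_sum_def)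

lemma direct_sum_smult_closed:
  assumes "r \<in> carrier R" "f \<in> carrier (direct_sum I M)"
  shows "r \<odot>\<^bsub>direct_sum I M\<^esub> f \<in> carrier (direct_sum I M)"
proof (rule direct_sum_carrierI)
  show "finite {i \<in> I. (r \<odot>\<^bsub>direct_sum I M\<^esub> f) i \<noteq> \<zero>\<^bsub>M i\<^esub>}"
    by (rule finite_subset[OF _ direct_sum_support[OF assms(2)]])
      (use assms in \<open>auto simp: direct_sum_simps M_simps\<close>)
qed (auto simp: direct_sum_simps M_simps direct_sum_component assms, simp add: direct_sum_def)

lemma direct_sum_eqI:
  assumes "f \<in> carrier (direct_sum I M)" "g \<in> carrier (direct_sum I M)" "\<And>i. i \<in> I \<Longrightarrow> f i = g i"
  shows "f = g"
  using assms by (intro extensionalityI[of f I]) (auto simp: direct_sum_def PiE_def)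

lemma direct_sum_zero_closed: "\<zero>\<^bsub>direct_sum I M\<^esub> \<in> carrier (direct_sum I M)"
  by (rule direct_sum_carrierI) (auto simp: direct_sum_simps M_simps cong: conj_cong, simp add: direct_sum_def)

lemma direct_sum_abelian_group: "abelian_group (direct_sum I M)"
proof (rule abelian_groupI)
  let ?D = "direct_sum I M"
  fix f g h assume f: "f \<in> carrier ?D" and g: "g \<in> carrier ?D" and h: "h \<in> carrier ?D"
  note c = direct_sum_add_closed direct_sum_zero_closed direct_sum_component f g h
  show "f \<oplus>\<^bsub>?D\<^esub> g \<oplus>\<^bsub>?D\<^esub> h = f \<oplus>\<^bsub>?D\<^esub> (g \<oplus>\<^bsub>?D\<^esub> h)"
  proof (rule direct_sum_eqI)
    fix i assume i: "i \<in> I"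
    interpret N: module R "M i" by (rule M[OF i])
    show "(f \<oplus>\<^bsub>?D\<^esub> g \<oplus>\<^bsub>?D\<^esub> h) i = (f \<oplus>\<^bsub>?D\<^esub> (g \<oplus>\<^bsub>?D\<^esub> h)) i"
      using i by (simp add: direct_sum_simps c N.a_assoc)
  qed (simp_all add: c)
  show "f \<oplus>\<^bsub>?D\<^esub> g = g \<oplus>\<^bsub>?D\<^esub> f"
  proof (rule direct_sum_eqI)
    fix i assume i: "i \<in> I"
    interpret N: module R "M i" by (rule M[OF i])
    show "(f \<oplus>\<^bsub>?D\<^esub> g) i = (g \<oplus>\<^bsub>?D\<^esub> f) i"
      using i by (simp add: direct_sum_simps c N.a_comm)
  qed (simp_all add: c)
  show "\<exists>g\<in>carrier ?D. g \<oplus>\<^bsub>?D\<^esub> f = \<zero>\<^bsub>?D\<^esub>"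
  proof
    show g: "(\<lambda>i\<in>I. \<ominus>\<^bsub>M i\<^esub> f i) \<in> carrier ?D"
    proof (rule direct_sum_carrierI)
      show "finite {i \<in> I. (\<lambda>i\<in>I. \<ominus>\<^bsub>M i\<^esub> f i) i \<noteq> \<zero>\<^bsub>M i\<^esub>}"
        by (rule finite_subset[OF _ direct_sum_support[OF f]]) (auto simp: M_simps)
    qed (auto simp: M_simps c)
    show "(\<lambda>i\<in>I. \<ominus>\<^bsub>M i\<^esub> f i) \<oplus>\<^bsub>?D\<^esub> f = \<zero>\<^bsub>?D\<^esub>"
      by (rule direct_sum_eqI) (simp_all add: c g direct_sum_simps M_simps)
  qed
  show "\<zero>\<^bsub>?D\<^esub> \<oplus>\<^bsub>?D\<^esub> f = f"
    by (rule direct_sum_eqI) (simp_all add: c direct_sum_simps M_simps)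
qed (simp_all add: direct_sum_add_closed direct_sum_zero_closed)

lemma direct_sum_module: "module R (direct_sum I M)"
proof (rule moduleI[OF R direct_sum_abelian_group])
  let ?D = "direct_sum I M"
  interpret R: cring R by (rule R)
  fix a b x y
  assume a: "a \<in> carrier R" and b: "b \<in> carrier R" and x: "x \<in> carrier ?D" and y: "y \<in> carrier ?D"
  note c = direct_sum_add_closed direct_sum_smult_closed direct_sum_component a b x y
    direct_sum_simps R.one_closed
  show "(a \<oplus>\<^bsub>R\<^esub> b) \<odot>\<^bsub>?D\<^esub> x = a \<odot>\<^bsub>?D\<^esub> x \<oplus>\<^bsub>?D\<^esub> b \<odot>\<^bsub>?D\<^esub> x"
    by (rule direct_sum_eqI) (simp_all add: c module.smult_l_distr[OF M])
  show "a \<odot>\<^bsub>?D\<^esub> (x \<oplus>\<^bsub>?D\<^esub> y) = a \<odot>\<^bsub>?D\<^esub> x \<oplus>\<^bsub>?D\<^esub> a \<odot>\<^bsub>?D\<^esub> y"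
    by (rule direct_sum_eqI) (simp_all add: c module.smult_r_distr[OF M])
  show "(a \<otimes>\<^bsub>R\<^esub> b) \<odot>\<^bsub>?D\<^esub> x = a \<odot>\<^bsub>?D\<^esub> (b \<odot>\<^bsub>?D\<^esub> x)"
    by (rule direct_sum_eqI) (simp_all add: c module.smult_assoc1[OF M])
next
  let ?D = "direct_sum I M"
  interpret R: cring R by (rule R)
  fix x assume x: "x \<in> carrier ?D"
  show "\<one>\<^bsub>R\<^esub> \<odot>\<^bsub>?D\<^esub> x = x"
    by (rule direct_sum_eqI)
      (simp_all add: x direct_sum_smult_closed direct_sum_component direct_sum_simps module.smult_one[OF M])
qed (simp add: direct_sum_smult_closed)

lemma direct_sum_incl_simps: "k \<in> I \<Longrightarrow> direct_sum_incl I M i x k = (if k = i then x else \<zero>\<^bsub>M k\<^esub>)"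
  by (simp add: direct_sum_incl_def)

lemma direct_sum_incl_closed:
  assumes "i \<in> I" "x \<in> carrier (M i)"
  shows "direct_sum_incl I M i x \<in> carrier (direct_sum I M)"
proof (rule direct_sum_carrierI)
  show "finite {k \<in> I. direct_sum_incl I M i x k \<noteq> \<zero>\<^bsub>M k\<^esub>}"
    by (rule finite_subset[of _ "{i}"]) (auto simp: direct_sum_incl_simps split: if_splits)
qed (use assms in \<open>auto simp: direct_sum_incl_simps M_simps\<close>, simp add: direct_sum_incl_def)

lemma direct_sum_incl_add:
  assumes "i \<in> I" "x \<in> carrier (M i)" "y \<in> carrier (M i)"
  shows "direct_sum_incl I M i (x \<oplus>\<^bsub>M i\<^esub> y) =
    direct_sum_incl I M i x \<oplus>\<^bsub>direct_sum I M\<^esub> direct_sum_incl I M i y"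
  by (rule direct_sum_eqI)
    (use assms in \<open>simp_all add: direct_sum_incl_closed direct_sum_add_closed direct_sum_incl_simps
       direct_sum_simps M_simps\<close>)

lemma direct_sum_incl_smult:
  assumes "i \<in> I" "r \<in> carrier R" "x \<in> carrier (M i)"
  shows "direct_sum_incl I M i (r \<odot>\<^bsub>M i\<^esub> x) = r \<odot>\<^bsub>direct_sum I M\<^esub> direct_sum_incl I M i x"
  by (rule direct_sum_eqI)
    (use assms in \<open>simp_all add: direct_sum_incl_closed direct_sum_smult_closed direct_sum_incl_simps
       direct_sum_simps M_simps\<close>)

text \<open>Induction on the size of the support: one nonzero coordinate is split off as an included
  element.\<close>

lemma direct_sum_induct:
  assumes f: "f \<in> carrier (direct_sum I M)"
    and zero: "Q \<zero>\<^bsub>direct_sum I M\<^esub>"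
    and incl: "\<And>i x. \<lbrakk>i \<in> I; x \<in> carrier (M i)\<rbrakk> \<Longrightarrow> Q (direct_sum_incl I M i x)"
    and add: "\<And>f g. \<lbrakk>f \<in> carrier (direct_sum I M); g \<in> carrier (direct_sum I M); Q f; Q g\<rbrakk> \<Longrightarrow>
      Q (f \<oplus>\<^bsub>direct_sum I M\<^esub> g)"
  shows "Q f"
  using f
proof (induction "card {i \<in> I. f i \<noteq> \<zero>\<^bsub>M i\<^esub>}" arbitrary: f)
  case 0
  then have "f = \<zero>\<^bsub>direct_sum I M\<^esub>"
    using direct_sum_support[OF 0(2)]
    by (intro direct_sum_eqI) (auto simp: direct_sum_zero_closed direct_sum_simps)
  then show ?case using zero by simp
next
  case (Suc n)
  then obtain i where i: "i \<in> I" "f i \<noteq> \<zero>\<^bsub>M i\<^esub>"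
    by (metis (mono_tags, lifting) card.empty empty_Collect_eq nat.distinct(1))
  define g where "g = (\<lambda>k\<in>I. if k = i then \<zero>\<^bsub>M k\<^esub> else f k)"
  have s: "{k \<in> I. g k \<noteq> \<zero>\<^bsub>M k\<^esub>} = {i \<in> I. f i \<noteq> \<zero>\<^bsub>M i\<^esub>} - {i}"
    by (auto simp: g_def)
  have g: "g \<in> carrier (direct_sum I M)"
    by (rule direct_sum_carrierI)
      (use direct_sum_support[OF Suc(3)] in \<open>auto simp: s M_simps direct_sum_component Suc\<close>,
       auto simp: g_def M_simps direct_sum_component Suc)
  have "n = card {k \<in> I. g k \<noteq> \<zero>\<^bsub>M k\<^esub>}"
    unfolding s using Suc(2) i direct_sum_support[OF Suc(3)] by (subst card_Diff_singleton) auto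
  then have Qg: "Q g" using Suc(1) g by simp
  have fi: "f i \<in> carrier (M i)" using i Suc direct_sum_component by auto
  have "f = direct_sum_incl I M i (f i) \<oplus>\<^bsub>direct_sum I M\<^esub> g"
    using i fi
    by (intro direct_sum_eqI)
      (auto simp: Suc g direct_sum_add_closed direct_sum_incl_closed direct_sum_simps
         direct_sum_incl_simps M_simps direct_sum_component, auto simp: g_def M_simps Suc direct_sum_component)
  then show ?case using add[OF direct_sum_incl_closed[OF i(1) fi] g incl[OF i(1) fi] Qg] by simp
qed

lemma direct_sum_lift:
  assumes N: "module R N" and h: "\<And>i. i \<in> I \<Longrightarrow> h i \<in> linear_maps R (M i) N"
  obtains k where "k \<in> linear_maps R (direct_sum I M) N"
    and "\<And>i x. \<lbrakk>i \<in> I; x \<in> carrier (M i)\<rbrakk> \<Longrightarrow> k (direct_sum_incl I M i x) = h i x"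
proof
  let ?D = "direct_sum I M"
  let ?s = "\<lambda>f. {i \<in> I. f i \<noteq> \<zero>\<^bsub>M i\<^esub>}"
  interpret N: module R N by (rule N)
  interpret D: module R ?D by (rule direct_sum_module)
  have h0: "h i \<zero>\<^bsub>M i\<^esub> = \<zero>\<^bsub>N\<^esub>" if "i \<in> I" for i
    by (rule linear_maps_zero[OF h M N]) (fact that)+
  define k where "k = (\<lambda>f\<in>carrier ?D. \<Oplus>\<^bsub>N\<^esub> i\<in>?s f. h i (f i))"
  have hc: "h i (f i) \<in> carrier N" if "i \<in> I" "f \<in> carrier ?D" for f i
    using that by (intro linear_mapsD(1)[OF h] direct_sum_component)
  \<comment> \<open>The support may be enlarged to any finite set, since \<open>h i\<close> kills
    zero. Additivity needs this: \<open>f\<close>, \<open>g\<close> and their sum have different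
    supports and must be compared over a common one.\<close>
  have k_eq: "k f = (\<Oplus>\<^bsub>N\<^esub> i\<in>A. h i (f i))" if "f \<in> carrier ?D" "finite A" "A \<subseteq> I" "?s f \<subseteq> A" for f A
    using that unfolding k_def
    by (auto intro!: N.add.finprod_mono_neutral_cong_left hc simp: h0)
  show "k \<in> linear_maps R ?D N"
  proof (rule linear_mapsI)
    fix f assume f: "f \<in> carrier ?D"
    show "k f \<in> carrier N" using f by (auto simp: k_def intro!: N.finsum_closed hc)
    {
      fix g assume g: "g \<in> carrier ?D"
      let ?A = "?s f \<union> ?s g \<union> ?s (f \<oplus>\<^bsub>?D\<^esub> g)"
      have A: "finite ?A" "?A \<subseteq> I"
        using direct_sum_support f g direct_sum_add_closed by auto
      have "k (f \<oplus>\<^bsub>?D\<^esub> g) = (\<Oplus>\<^bsub>N\<^esub> i\<in>?A. h i ((f \<oplus>\<^bsub>?D\<^esub> g) i))"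
        by (rule k_eq) (use A f g direct_sum_add_closed in auto)
      also have "\<dots> = (\<Oplus>\<^bsub>N\<^esub> i\<in>?A. h i (f i) \<oplus>\<^bsub>N\<^esub> h i (g i))"
        using A(2) f g
        by (intro N.finsum_cong')
          (auto simp: direct_sum_simps linear_mapsD(2)[OF h] direct_sum_component intro!: hc)
      also have "\<dots> = (\<Oplus>\<^bsub>N\<^esub> i\<in>?A. h i (f i)) \<oplus>\<^bsub>N\<^esub> (\<Oplus>\<^bsub>N\<^esub> i\<in>?A. h i (g i))"
        using A(2) f g by (intro N.finsum_addf) (auto intro!: hc)
      also have "(\<Oplus>\<^bsub>N\<^esub> i\<in>?A. h i (f i)) = k f"
        by (rule k_eq[OF f A, symmetric]) auto
      also have "(\<Oplus>\<^bsub>N\<^esub> i\<in>?A. h i (g i)) = k g"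
        by (rule k_eq[OF g A, symmetric]) auto
      finally show "k (f \<oplus>\<^bsub>?D\<^esub> g) = k f \<oplus>\<^bsub>N\<^esub> k g" .
    }
    {
      fix r assume r: "r \<in> carrier R"
      have A: "finite (?s f)" "?s f \<subseteq> I" using direct_sum_support f by auto
      have "k (r \<odot>\<^bsub>?D\<^esub> f) = (\<Oplus>\<^bsub>N\<^esub> i\<in>?s f. h i ((r \<odot>\<^bsub>?D\<^esub> f) i))"
        by (rule k_eq) (use A f r direct_sum_smult_closed in \<open>auto simp: direct_sum_simps M_simps\<close>)
      also have "\<dots> = (\<Oplus>\<^bsub>N\<^esub> i\<in>?s f. r \<odot>\<^bsub>N\<^esub> h i (f i))"
        using f r
        by (intro N.finsum_cong')
          (auto simp: direct_sum_simps linear_mapsD(3)[OF h] direct_sum_component intro!: hc N.smult_closed)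
      also have "\<dots> = r \<odot>\<^bsub>N\<^esub> k f"
        unfolding k_eq[OF f A subset_refl] using A f r
        by (intro N.finsum_smult_ldistr[symmetric]) (auto intro!: hc)
      finally show "k (r \<odot>\<^bsub>?D\<^esub> f) = r \<odot>\<^bsub>N\<^esub> k f" .
    }
  qed (simp add: k_def)
  show "k (direct_sum_incl I M i x) = h i x" if i: "i \<in> I" and x: "x \<in> carrier (M i)" for i x
  proof -
    have "k (direct_sum_incl I M i x) = (\<Oplus>\<^bsub>N\<^esub> j\<in>{i}. h j (direct_sum_incl I M i x j))"
      by (rule k_eq) (use i x direct_sum_incl_closed in \<open>auto simp: direct_sum_incl_simps split: if_splits\<close>)
    also have "\<dots> = h i x"
      using i x linear_mapsD(1)[OF h] by (simp add: direct_sum_incl_simps)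
    finally show ?thesis .
  qed
qed

end

subsection \<open>Free modules\<close>

context
  fixes R :: "('r, 'c) ring_scheme" and I :: "'i set"
  assumes R: "cring R"
begin

interpretation R: cring R by (rule R)

lemma regular_module: "module R (regular_module R)"
proof -
  have "abelian_group (regular_module R)"
    by (rule abelian_groupI)
      (use R.add.inv_closed R.l_neg in \<open>force simp: regular_module_def R.a_ac\<close>)+
  then show ?thesis
    by (intro moduleI[OF R]) (auto simp: regular_module_def R.l_distr R.r_distr R.m_assoc)
qed

lemma free_module: "module R (free_module R I)"
  unfolding free_module_def by (rule direct_sum_module[OF R]) (rule regular_module)

lemma free_gen_closed: "i \<in> I \<Longrightarrow> free_gen R I i \<in> carrier (free_module R I)"
  unfolding free_module_def free_gen_def
  by (rule direct_sum_incl_closed[OF R regular_module]) (auto simp: regular_module_def)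

lemma smult_free_gen:
  assumes "i \<in> I" "r \<in> carrier R"
  shows "direct_sum_incl I (\<lambda>_. regular_module R) i r = r \<odot>\<^bsub>free_module R I\<^esub> free_gen R I i"
  unfolding free_module_def free_gen_def
  using direct_sum_incl_smult[OF R regular_module, of i I r "\<one>\<^bsub>R\<^esub>"] assms
  by (simp add: regular_module_def)

lemma free_module_induct:
  assumes "f \<in> carrier (free_module R I)"
    and "Q \<zero>\<^bsub>free_module R I\<^esub>"
    and "\<And>i r. \<lbrakk>i \<in> I; r \<in> carrier R\<rbrakk> \<Longrightarrow> Q (r \<odot>\<^bsub>free_module R I\<^esub> free_gen R I i)"
    and "\<And>f g. \<lbrakk>f \<in> carrier (free_module R I); g \<in> carrier (free_module R I); Q f; Q g\<rbrakk> \<Longrightarrow>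
      Q (f \<oplus>\<^bsub>free_module R I\<^esub> g)"
  shows "Q f"
proof (rule direct_sum_induct[OF R regular_module assms(1)[unfolded free_module_def]])
  show "Q (direct_sum_incl I (\<lambda>_. regular_module R) i x)"
    if "i \<in> I" "x \<in> carrier (regular_module R)" for i x
    using that assms(3)[of i x] smult_free_gen[of i x] by (simp add: regular_module_def)
qed (use assms(2,4) in \<open>auto simp: free_module_def\<close>)

lemma free_module_lift:
  assumes N: "module R N" and h: "\<And>i. i \<in> I \<Longrightarrow> h i \<in> carrier N"
  obtains k where "k \<in> linear_maps R (free_module R I) N"
    and "\<And>i. i \<in> I \<Longrightarrow> k (free_gen R I i) = h i"
proof -
  interpret N: module R N by (rule N)
  define g where "g i = (\<lambda>r\<in>carrier (regular_module R). r \<odot>\<^bsub>N\<^esub> h i)" for i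
  have "g i \<in> linear_maps R (regular_module R) N" if "i \<in> I" for i
    unfolding g_def using h[OF that]
    by (intro restrict_linear_maps[OF regular_module])
      (auto simp: regular_module_def N.smult_l_distr N.smult_assoc1)
  then obtain k where k: "k \<in> linear_maps R (free_module R I) N"
    "\<And>i x. \<lbrakk>i \<in> I; x \<in> carrier (regular_module R)\<rbrakk> \<Longrightarrow>
       k (direct_sum_incl I (\<lambda>_. regular_module R) i x) = g i x"
    using direct_sum_lift[OF R regular_module N, where h = g and I = I] unfolding free_module_def by blast
  have "k (free_gen R I i) = h i" if "i \<in> I" for i
    using k(2)[OF that, of "\<one>\<^bsub>R\<^esub>"] h[OF that] by (simp add: free_gen_def g_def regular_module_def)
  with k(1) show thesis by (rule that)
qed

end

section \<open>The Schur functor\<close>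

text \<open>A slot is singled out by a splitting \<open>us @ v # ws\<close> instead of the update
  \<open>vs[i := v]\<close> of \<open>tensor_relations\<close>, because argument lists are later
  built and expanded by concatenation.\<close>

locale multilinear =
  fixes R :: "('r, 'c) ring_scheme" and M :: "('r, 'p) module" and V :: "('r, 'v) module"
    and n :: nat and N :: "('r, 'n) module" and \<phi> :: "'p \<Rightarrow> 'v list \<Rightarrow> 'n"
  assumes closed: "\<And>\<mu> vs. \<lbrakk>\<mu> \<in> carrier M; length vs = n; set vs \<subseteq> carrier V\<rbrakk> \<Longrightarrow> \<phi> \<mu> vs \<in> carrier N"
    and add_left: "\<And>\<mu> \<mu>' vs. \<lbrakk>\<mu> \<in> carrier M; \<mu>' \<in> carrier M; length vs = n; set vs \<subseteq> carrier V\<rbrakk> \<Longrightarrow>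
      \<phi> (\<mu> \<oplus>\<^bsub>M\<^esub> \<mu>') vs = \<phi> \<mu> vs \<oplus>\<^bsub>N\<^esub> \<phi> \<mu>' vs"
    and smult_left: "\<And>r \<mu> vs. \<lbrakk>r \<in> carrier R; \<mu> \<in> carrier M; length vs = n; set vs \<subseteq> carrier V\<rbrakk> \<Longrightarrow>
      \<phi> (r \<odot>\<^bsub>M\<^esub> \<mu>) vs = r \<odot>\<^bsub>N\<^esub> \<phi> \<mu> vs"
    and add_slot: "\<And>\<mu> us v w ws. \<lbrakk>\<mu> \<in> carrier M; length us + length ws + 1 = n; set us \<subseteq> carrier V;
      set ws \<subseteq> carrier V; v \<in> carrier V; w \<in> carrier V\<rbrakk> \<Longrightarrow>
      \<phi> \<mu> (us @ (v \<oplus>\<^bsub>V\<^esub> w) # ws) = \<phi> \<mu> (us @ v # ws) \<oplus>\<^bsub>N\<^esub> \<phi> \<mu> (us @ w # ws)"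
    and smult_slot: "\<And>r \<mu> us v ws. \<lbrakk>r \<in> carrier R; \<mu> \<in> carrier M; length us + length ws + 1 = n;
      set us \<subseteq> carrier V; set ws \<subseteq> carrier V; v \<in> carrier V\<rbrakk> \<Longrightarrow>
      \<phi> \<mu> (us @ (r \<odot>\<^bsub>V\<^esub> v) # ws) = r \<odot>\<^bsub>N\<^esub> \<phi> \<mu> (us @ v # ws)"

lemma multilinear_compose:
  assumes \<phi>: "multilinear R M V n N \<phi>" and f: "f \<in> linear_maps R N N'"
    and M: "module R M" and V: "module R V"
    and eq: "\<And>\<mu> vs. \<lbrakk>\<mu> \<in> carrier M; length vs = n; set vs \<subseteq> carrier V\<rbrakk> \<Longrightarrow> \<psi> \<mu> vs = f (\<phi> \<mu> vs)"
  shows "multilinear R M V n N' \<psi>"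
proof -
  interpret M: module R M by fact
  interpret V: module R V by fact
  show ?thesis
    by unfold_locales
      (simp_all add: eq multilinear.closed[OF \<phi>] multilinear.add_left[OF \<phi>] multilinear.smult_left[OF \<phi>]
        multilinear.add_slot[OF \<phi>] multilinear.smult_slot[OF \<phi>] linear_mapsD[OF f])
qed

lemma quotient_proj_linear:
  assumes "module R M" "submodule H R M"
  shows "(\<lambda>x\<in>carrier M. H +>\<^bsub>M\<^esub> x) \<in> linear_maps R M (quotient_module M H)"
  using assms by (intro restrict_linear_maps) (auto simp: quotient_carrier quotient_add quotient_smult)

subsection \<open>Tensor products\<close>

context
  fixes R :: "('r, 'c) ring_scheme" and M :: "('r, 'p) module" and V :: "('r, 'v) module" and n :: nat
  assumes M: "module R M" and V: "module R V"
begin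

interpretation M: module R M by (rule M)
interpretation V: module R V by (rule V)

private abbreviation (input) "I \<equiv> tensor_index M V n"
private abbreviation (input) "F \<equiv> free_module R I"
private abbreviation (input) "g \<mu> vs \<equiv> free_gen R I (\<mu>, vs)"

private lemma F_module: "module R F"
  by (rule free_module[OF M.is_cring])

lemma tensor_index_iff: "(\<mu>, vs) \<in> I \<longleftrightarrow> \<mu> \<in> carrier M \<and> length vs = n \<and> set vs \<subseteq> carrier V"
  by (auto simp: tensor_index_def)

private lemma gen_closed: "\<lbrakk>\<mu> \<in> carrier M; length vs = n; set vs \<subseteq> carrier V\<rbrakk> \<Longrightarrow> g \<mu> vs \<in> carrier F"
  by (rule free_gen_closed[OF M.is_cring]) (simp add: tensor_index_iff)

text \<open>Translates the updates in the definition into concatenations, by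
  \<open>vs[i := v] = take i vs @ v # drop (Suc i) vs\<close>.\<close>

lemma tensor_relations_cases:
  assumes "x \<in> tensor_relations R M V n"
  obtains (add_left) \<mu> \<mu>' vs where "\<mu> \<in> carrier M" "\<mu>' \<in> carrier M" "length vs = n" "set vs \<subseteq> carrier V"
      "x = g (\<mu> \<oplus>\<^bsub>M\<^esub> \<mu>') vs \<ominus>\<^bsub>F\<^esub> (g \<mu> vs \<oplus>\<^bsub>F\<^esub> g \<mu>' vs)"
  | (smult_left) r \<mu> vs where "r \<in> carrier R" "\<mu> \<in> carrier M" "length vs = n" "set vs \<subseteq> carrier V"
      "x = g (r \<odot>\<^bsub>M\<^esub> \<mu>) vs \<ominus>\<^bsub>F\<^esub> (r \<odot>\<^bsub>F\<^esub> g \<mu> vs)"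
  | (add_slot) \<mu> us v w ws where "\<mu> \<in> carrier M" "length us + length ws + 1 = n" "set us \<subseteq> carrier V"
      "set ws \<subseteq> carrier V" "v \<in> carrier V" "w \<in> carrier V"
      "x = g \<mu> (us @ (v \<oplus>\<^bsub>V\<^esub> w) # ws) \<ominus>\<^bsub>F\<^esub> (g \<mu> (us @ v # ws) \<oplus>\<^bsub>F\<^esub> g \<mu> (us @ w # ws))"
  | (smult_slot) r \<mu> us v ws where "r \<in> carrier R" "\<mu> \<in> carrier M" "length us + length ws + 1 = n"
      "set us \<subseteq> carrier V" "set ws \<subseteq> carrier V" "v \<in> carrier V"
      "x = g \<mu> (us @ (r \<odot>\<^bsub>V\<^esub> v) # ws) \<ominus>\<^bsub>F\<^esub> (r \<odot>\<^bsub>F\<^esub> g \<mu> (us @ v # ws))"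
proof -
  have upd: "length (take i vs) + length (drop (Suc i) vs) + 1 = n" "set (take i vs) \<subseteq> carrier V"
    "set (drop (Suc i) vs) \<subseteq> carrier V" "\<And>v. vs[i := v] = take i vs @ v # drop (Suc i) vs"
    if "length vs = n" "i < n" "set vs \<subseteq> carrier V" for vs :: "'v list" and i
    using that set_take_subset[of i vs] set_drop_subset[of "Suc i" vs]
    by (auto simp: upd_conv_take_nth_drop)
  from assms[unfolded tensor_relations_def Let_def Un_iff mem_Collect_eq] show thesis
  proof (elim disjE exE conjE, goal_cases)
    case (1 \<mu> \<mu>' vs)
    then show ?case using add_left[of \<mu> \<mu>' vs] by (simp add: tensor_index_iff)
  next
    case (2 r \<mu> vs)
    then show ?case using smult_left[of r \<mu> vs] by (simp add: tensor_index_iff)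
  next
    case (3 \<mu> vs i v w)
    then show ?case
      using add_slot[of \<mu> "take i vs" "drop (Suc i) vs" v w] upd[of vs i] by (simp add: tensor_index_iff)
  next
    case (4 \<mu> vs i r v)
    then show ?case
      using smult_slot[of r \<mu> "take i vs" "drop (Suc i) vs" v] upd[of vs i] by (simp add: tensor_index_iff)
  qed
qed

lemma tensor_relationsI:
  "\<lbrakk>\<mu> \<in> carrier M; \<mu>' \<in> carrier M; length vs = n; set vs \<subseteq> carrier V\<rbrakk> \<Longrightarrow>
    g (\<mu> \<oplus>\<^bsub>M\<^esub> \<mu>') vs \<ominus>\<^bsub>F\<^esub> (g \<mu> vs \<oplus>\<^bsub>F\<^esub> g \<mu>' vs) \<in> tensor_relations R M V n"
  "\<lbrakk>r \<in> carrier R; \<mu> \<in> carrier M; length vs = n; set vs \<subseteq> carrier V\<rbrakk> \<Longrightarrow>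
    g (r \<odot>\<^bsub>M\<^esub> \<mu>) vs \<ominus>\<^bsub>F\<^esub> (r \<odot>\<^bsub>F\<^esub> g \<mu> vs) \<in> tensor_relations R M V n"
  "\<lbrakk>\<mu> \<in> carrier M; length us + length ws + 1 = n; set us \<subseteq> carrier V;
    set ws \<subseteq> carrier V; v \<in> carrier V; w \<in> carrier V\<rbrakk> \<Longrightarrow>
    g \<mu> (us @ (v \<oplus>\<^bsub>V\<^esub> w) # ws) \<ominus>\<^bsub>F\<^esub> (g \<mu> (us @ v # ws) \<oplus>\<^bsub>F\<^esub> g \<mu> (us @ w # ws)) \<in> tensor_relations R M V n"
  "\<lbrakk>r \<in> carrier R; \<mu> \<in> carrier M; length us + length ws + 1 = n; set us \<subseteq> carrier V;
    set ws \<subseteq> carrier V; v \<in> carrier V\<rbrakk> \<Longrightarrow>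
    g \<mu> (us @ (r \<odot>\<^bsub>V\<^esub> v) # ws) \<ominus>\<^bsub>F\<^esub> (r \<odot>\<^bsub>F\<^esub> g \<mu> (us @ v # ws)) \<in> tensor_relations R M V n"
proof goal_cases
  case 1
  then have "(\<mu>, vs) \<in> I" by (simp add: tensor_index_iff)
  with 1 show ?case unfolding tensor_relations_def Let_def Un_iff mem_Collect_eq by blast
next
  case 2
  then have "(\<mu>, vs) \<in> I" by (simp add: tensor_index_iff)
  with 2 show ?case unfolding tensor_relations_def Let_def Un_iff mem_Collect_eq by blast
next
  case 3
  then have "(\<mu>, us @ v # ws) \<in> I" "length us < n" by (auto simp: tensor_index_iff)
  \<comment> \<open>Back to the update form: the list is \<open>us @ v # ws\<close> itself and the
    position is \<open>length us\<close>.\<close>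
  with 3 have "\<exists>\<mu>' vs i v' w'. g \<mu> (us @ (v \<oplus>\<^bsub>V\<^esub> w) # ws) \<ominus>\<^bsub>F\<^esub> (g \<mu> (us @ v # ws) \<oplus>\<^bsub>F\<^esub> g \<mu> (us @ w # ws)) =
      g \<mu>' (vs[i := v' \<oplus>\<^bsub>V\<^esub> w']) \<ominus>\<^bsub>F\<^esub> (g \<mu>' (vs[i := v']) \<oplus>\<^bsub>F\<^esub> g \<mu>' (vs[i := w'])) \<and>
      (\<mu>', vs) \<in> I \<and> i < n \<and> v' \<in> carrier V \<and> w' \<in> carrier V"
    by (intro exI[of _ \<mu>] exI[of _ "us @ v # ws"] exI[of _ "length us"] exI[of _ v] exI[of _ w]) simp
  then show ?case unfolding tensor_relations_def Let_def Un_iff mem_Collect_eq by blast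
next
  case 4
  then have "(\<mu>, us @ v # ws) \<in> I" "length us < n" by (auto simp: tensor_index_iff)
  with 4 have "\<exists>\<mu>' vs i r' v'. g \<mu> (us @ (r \<odot>\<^bsub>V\<^esub> v) # ws) \<ominus>\<^bsub>F\<^esub> (r \<odot>\<^bsub>F\<^esub> g \<mu> (us @ v # ws)) =
      g \<mu>' (vs[i := r' \<odot>\<^bsub>V\<^esub> v']) \<ominus>\<^bsub>F\<^esub> (r' \<odot>\<^bsub>F\<^esub> g \<mu>' (vs[i := v'])) \<and>
      (\<mu>', vs) \<in> I \<and> i < n \<and> r' \<in> carrier R \<and> v' \<in> carrier V"
    by (intro exI[of _ \<mu>] exI[of _ "us @ v # ws"] exI[of _ "length us"] exI[of _ r] exI[of _ v]) simp
  then show ?case unfolding tensor_relations_def Let_def Un_iff mem_Collect_eq by blast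
qed

lemma tensor_relations_closed: "tensor_relations R M V n \<subseteq> carrier F"
proof
  interpret F: module R F by (rule F_module)
  fix x assume "x \<in> tensor_relations R M V n"
  then show "x \<in> carrier F"
    by (cases rule: tensor_relations_cases) (simp_all add: gen_closed)
qed

lemma tensor_kernel_submodule: "submodule (tensor_kernel R M V n) R F"
  unfolding tensor_kernel_def
  by (rule submodule_generated_submodule[OF F_module tensor_relations_closed])

lemma tensor_module: "module R (tensor R M V n)"
  unfolding tensor_def by (rule quotient_module[OF F_module tensor_kernel_submodule])

lemma pure_tensor_multilinear: "multilinear R M V n (tensor R M V n) (pure_tensor R M V n)"
proof -
  interpret F: module R F by (rule F_module)
  let ?K = "tensor_kernel R M V n"
  have rel: "?K +>\<^bsub>F\<^esub> a = ?K +>\<^bsub>F\<^esub> b"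
    if "a \<ominus>\<^bsub>F\<^esub> b \<in> tensor_relations R M V n" "a \<in> carrier F" "b \<in> carrier F" for a b
    using that generated_submodule_incl[THEN subsetD]
    by (subst coset_eq_iff[OF F_module tensor_kernel_submodule]) (auto simp: tensor_kernel_def)
  note qa = quotient_add[OF F_module tensor_kernel_submodule]
  note qs = quotient_smult[OF F_module tensor_kernel_submodule]
  show ?thesis
    by unfold_locales
      (simp_all add: pure_tensor_def tensor_def quotient_carrier[OF F_module tensor_kernel_submodule]
        gen_closed qa qs rel tensor_relationsI)
qed

text \<open>A multiple of a pure tensor is again pure, the scalar being absorbed by
  \<open>\<mu>\<close>; so sums of pure tensors exhaust the tensor product.\<close>

lemma tensor_induct:
  assumes x: "x \<in> carrier (tensor R M V n)"
    and pure: "\<And>\<mu> vs. \<lbrakk>\<mu> \<in> carrier M; length vs = n; set vs \<subseteq> carrier V\<rbrakk> \<Longrightarrow> Q (pure_tensor R M V n \<mu> vs)"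
    and zero: "Q \<zero>\<^bsub>tensor R M V n\<^esub>"
    and add: "\<And>x y. \<lbrakk>x \<in> carrier (tensor R M V n); y \<in> carrier (tensor R M V n); Q x; Q y\<rbrakk> \<Longrightarrow>
      Q (x \<oplus>\<^bsub>tensor R M V n\<^esub> y)"
  shows "Q x"
proof -
  let ?K = "tensor_kernel R M V n"
  interpret F: module R F by (rule F_module)
  note q = quotient_carrier[OF F_module tensor_kernel_submodule]
    quotient_add[OF F_module tensor_kernel_submodule]
    quotient_smult[OF F_module tensor_kernel_submodule]
    quotient_zero[OF F_module tensor_kernel_submodule]
  obtain y where y: "y \<in> carrier F" "x = ?K +>\<^bsub>F\<^esub> y"
    using x by (auto simp: tensor_def q)
  have "Q (?K +>\<^bsub>F\<^esub> y)" using y(1)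
  proof (rule free_module_induct[OF M.is_cring])
    show "Q (?K +>\<^bsub>F\<^esub> \<zero>\<^bsub>F\<^esub>)" using zero by (simp add: tensor_def q)
    show "Q (?K +>\<^bsub>F\<^esub> (r \<odot>\<^bsub>F\<^esub> free_gen R I i))" if "i \<in> I" "r \<in> carrier R" for i r
    proof -
      obtain \<mu> vs where i: "i = (\<mu>, vs)" by (cases i)
      have "pure_tensor R M V n (r \<odot>\<^bsub>M\<^esub> \<mu>) vs = ?K +>\<^bsub>F\<^esub> (r \<odot>\<^bsub>F\<^esub> free_gen R I i)"
        using that
        by (simp add: i tensor_index_iff multilinear.smult_left[OF pure_tensor_multilinear])
          (simp add: tensor_def pure_tensor_def q gen_closed)
      then show ?thesis using that pure[of "r \<odot>\<^bsub>M\<^esub> \<mu>" vs] by (simp add: i tensor_index_iff)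
    qed
    show "Q (?K +>\<^bsub>F\<^esub> (a \<oplus>\<^bsub>F\<^esub> b))"
      if "a \<in> carrier F" "b \<in> carrier F" "Q (?K +>\<^bsub>F\<^esub> a)" "Q (?K +>\<^bsub>F\<^esub> b)" for a b
      using add[of "?K +>\<^bsub>F\<^esub> a" "?K +>\<^bsub>F\<^esub> b"] that by (simp add: tensor_def q)
  qed
  then show ?thesis using y by simp
qed

lemma tensor_lift:
  assumes N: "module R N" and \<phi>: "multilinear R M V n N \<phi>"
  obtains h where "h \<in> linear_maps R (tensor R M V n) N"
    and "\<And>\<mu> vs. \<lbrakk>\<mu> \<in> carrier M; length vs = n; set vs \<subseteq> carrier V\<rbrakk> \<Longrightarrow> h (pure_tensor R M V n \<mu> vs) = \<phi> \<mu> vs"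
proof -
  interpret F: module R F by (rule F_module)
  interpret N: module R N by (rule N)
  obtain k where k: "k \<in> linear_maps R F N" "\<And>i. i \<in> I \<Longrightarrow> k (free_gen R I i) = case_prod \<phi> i"
    using multilinear.closed[OF \<phi>]
    by (auto intro: free_module_lift[OF M.is_cring N, of I "case_prod \<phi>"] simp: tensor_index_iff)
  have kg: "k (g \<mu> vs) = \<phi> \<mu> vs" if "\<mu> \<in> carrier M" "length vs = n" "set vs \<subseteq> carrier V" for \<mu> vs
    using k(2)[of "(\<mu>, vs)"] that by (simp add: tensor_index_iff)
  have minus_self: "a \<ominus>\<^bsub>N\<^esub> a = \<zero>\<^bsub>N\<^esub>" if "a \<in> carrier N" for a
    using that by (simp add: a_minus_def N.M.r_neg)
  have van: "k x = \<zero>\<^bsub>N\<^esub>" if "x \<in> tensor_relations R M V n" for x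
    using that
    by (cases rule: tensor_relations_cases)
      (simp_all add: linear_maps_minus[OF k(1) F_module N] linear_mapsD[OF k(1)] gen_closed kg
        multilinear.closed[OF \<phi>] multilinear.add_left[OF \<phi>] multilinear.smult_left[OF \<phi>]
        multilinear.add_slot[OF \<phi>] multilinear.smult_slot[OF \<phi>] minus_self)
  have "k x = \<zero>\<^bsub>N\<^esub>" if "x \<in> tensor_kernel R M V n" for x
    using linear_maps_vanish_generated[OF F_module N k(1) tensor_relations_closed van] that
    by (simp add: tensor_kernel_def)
  then obtain h where "h \<in> linear_maps R (tensor R M V n) N"
    "\<And>x. x \<in> carrier F \<Longrightarrow> h (tensor_kernel R M V n +>\<^bsub>F\<^esub> x) = k x"
    using quotient_lift[OF F_module tensor_kernel_submodule N k(1)] unfolding tensor_def by blast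
  then show thesis by (intro that[of h]) (simp_all add: pure_tensor_def gen_closed kg)
qed

end

subsection \<open>Coinvariants and the universal property\<close>

text \<open>The data that extend uniquely to a linear map on \<open>Schur R P V\<close>. One
  function serves all arities because the arity is the length of the list.\<close>

locale symmetric_family =
  fixes R :: "('r, 'c) ring_scheme" and P :: "('r, 'p) operad" and V :: "('r, 'v) module"
    and N :: "('r, 'n) module" and \<phi> :: "'p \<Rightarrow> 'v list \<Rightarrow> 'n"
  assumes multilinear: "\<And>n. multilinear R (Ops P n) V n N \<phi>"
    and sym: "\<And>n \<mu> vs \<sigma>. \<lbrakk>\<mu> \<in> carrier (Ops P n); length vs = n; set vs \<subseteq> carrier V; \<sigma> permutes {..<n}\<rbrakk> \<Longrightarrow>
      \<phi> (act P n \<mu> \<sigma>) (permute_list \<sigma> vs) = \<phi> \<mu> vs"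

text \<open>The shape of \<open>Schur_map\<close> and \<open>Schur_partial\<close> with an arbitrary
  family in place of theirs, so that both become instances by unfolding.\<close>

definition Schur_lift ::
    "('r, 'c) ring_scheme \<Rightarrow> ('r, 'p) operad \<Rightarrow> ('r, 'v) module \<Rightarrow> ('r, 'n) module \<Rightarrow>
     ('p \<Rightarrow> 'v list \<Rightarrow> 'n) \<Rightarrow> ('r, 'p, 'v) schur \<Rightarrow> 'n" where
  "Schur_lift R P V N \<phi> =
    (THE h. h \<in> linear_maps R (Schur R P V) N \<and>
      (\<forall>\<mu> vs. \<mu> \<in> carrier (Ops P (length vs)) \<longrightarrow> set vs \<subseteq> carrier V \<longrightarrow> h (cls R P V \<mu> vs) = \<phi> \<mu> vs))"

context operad
begin

abbreviation (input) S :: "('r, 'v) module \<Rightarrow> ('r, ('r, 'p, 'v) schur) module" where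
  "S \<equiv> Schur R P"

lemma cring: "cring R"
  using ops_module module_def by blast

lemma act_closed: "\<lbrakk>\<mu> \<in> carrier (Ops P n); \<sigma> permutes {..<n}\<rbrakk> \<Longrightarrow> act P n \<mu> \<sigma> \<in> carrier (Ops P n)"
  using linear_mapsD(1)[OF act_linear, of \<sigma> n \<mu>] by simp


context
  fixes V :: "('r, 'v) module" and n :: nat
  assumes V: "module R V"
begin

lemma coinvariants_relations_closed:
  "{pure_tensor R (Ops P n) V n (act P n \<mu> \<sigma>) (permute_list \<sigma> vs)
      \<ominus>\<^bsub>tensor R (Ops P n) V n\<^esub> pure_tensor R (Ops P n) V n \<mu> vs | \<mu> vs \<sigma>.
     (\<mu>, vs) \<in> tensor_index (Ops P n) V n \<and> \<sigma> permutes {..<n}} \<subseteq> carrier (tensor R (Ops P n) V n)"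
  (is "?A \<subseteq> _")
proof
  interpret T: module R "tensor R (Ops P n) V n" by (rule tensor_module[OF ops_module V])
  fix x assume "x \<in> ?A"
  then obtain \<mu> vs \<sigma> where x: "x = pure_tensor R (Ops P n) V n (act P n \<mu> \<sigma>) (permute_list \<sigma> vs)
      \<ominus>\<^bsub>tensor R (Ops P n) V n\<^esub> pure_tensor R (Ops P n) V n \<mu> vs"
    "(\<mu>, vs) \<in> tensor_index (Ops P n) V n" "\<sigma> permutes {..<n}"
    by blast
  then show "x \<in> carrier (tensor R (Ops P n) V n)"
    by (simp add: tensor_index_iff[OF ops_module V] act_closed
        multilinear.closed[OF pure_tensor_multilinear[OF ops_module V]])
qed

lemma coinvariants_kernel_submodule:
  "submodule (coinvariants_kernel R P V n) R (tensor R (Ops P n) V n)"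
  unfolding coinvariants_kernel_def Let_def
  by (rule submodule_generated_submodule[OF tensor_module[OF ops_module V] coinvariants_relations_closed])

lemma coinvariants_module: "module R (coinvariants R P V n)"
  unfolding coinvariants_def
  by (rule quotient_module[OF tensor_module[OF ops_module V] coinvariants_kernel_submodule])

definition coinvariants_class :: "'p \<Rightarrow> 'v list \<Rightarrow> ('p \<times> 'v list \<Rightarrow> 'r) set set" where
  "coinvariants_class \<mu> vs =
    coinvariants_kernel R P V n +>\<^bsub>tensor R (Ops P n) V n\<^esub> pure_tensor R (Ops P n) V n \<mu> vs"

lemma coinvariants_class_multilinear:
  "multilinear R (Ops P n) V n (coinvariants R P V n) coinvariants_class"
  unfolding coinvariants_def
  by (rule multilinear_compose[OF pure_tensor_multilinear[OF ops_module V]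
        quotient_proj_linear[OF tensor_module[OF ops_module V] coinvariants_kernel_submodule] ops_module V])
    (simp add: coinvariants_class_def multilinear.closed[OF pure_tensor_multilinear[OF ops_module V]])

lemma coinvariants_class_sym:
  assumes "\<mu> \<in> carrier (Ops P n)" "length vs = n" "set vs \<subseteq> carrier V" "\<sigma> permutes {..<n}"
  shows "coinvariants_class (act P n \<mu> \<sigma>) (permute_list \<sigma> vs) = coinvariants_class \<mu> vs"
proof -
  let ?t = "pure_tensor R (Ops P n) V n"
  have "?t (act P n \<mu> \<sigma>) (permute_list \<sigma> vs) \<ominus>\<^bsub>tensor R (Ops P n) V n\<^esub> ?t \<mu> vs \<in> coinvariants_kernel R P V n"
    unfolding coinvariants_kernel_def Let_def
    by (rule subsetD[OF generated_submodule_incl]) (use assms in \<open>auto simp: tensor_index_def\<close>)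
  then show ?thesis
    using assms unfolding coinvariants_class_def
    by (subst coset_eq_iff[OF tensor_module[OF ops_module V] coinvariants_kernel_submodule])
      (auto simp: act_closed intro!: multilinear.closed[OF pure_tensor_multilinear[OF ops_module V]])
qed

lemma coinvariants_induct:
  assumes x: "x \<in> carrier (coinvariants R P V n)"
    and cls: "\<And>\<mu> vs. \<lbrakk>\<mu> \<in> carrier (Ops P n); length vs = n; set vs \<subseteq> carrier V\<rbrakk> \<Longrightarrow> Q (coinvariants_class \<mu> vs)"
    and zero: "Q \<zero>\<^bsub>coinvariants R P V n\<^esub>"
    and add: "\<And>x y. \<lbrakk>x \<in> carrier (coinvariants R P V n); y \<in> carrier (coinvariants R P V n); Q x; Q y\<rbrakk> \<Longrightarrow>
      Q (x \<oplus>\<^bsub>coinvariants R P V n\<^esub> y)"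
  shows "Q x"
proof -
  let ?T = "tensor R (Ops P n) V n" and ?K = "coinvariants_kernel R P V n"
  note q = quotient_carrier[OF tensor_module[OF ops_module V] coinvariants_kernel_submodule]
    quotient_add[OF tensor_module[OF ops_module V] coinvariants_kernel_submodule]
    quotient_zero[OF tensor_module[OF ops_module V] coinvariants_kernel_submodule]
  obtain y where y: "y \<in> carrier ?T" "x = ?K +>\<^bsub>?T\<^esub> y"
    using x by (auto simp: coinvariants_def q)
  have "Q (?K +>\<^bsub>?T\<^esub> y)" using ops_module V y(1)
  proof (rule tensor_induct)
    show "Q (?K +>\<^bsub>?T\<^esub> (a \<oplus>\<^bsub>?T\<^esub> b))"
      if "a \<in> carrier ?T" "b \<in> carrier ?T" "Q (?K +>\<^bsub>?T\<^esub> a)" "Q (?K +>\<^bsub>?T\<^esub> b)" for a b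
      using add[of "?K +>\<^bsub>?T\<^esub> a" "?K +>\<^bsub>?T\<^esub> b"] that by (simp add: coinvariants_def q)
  qed (use cls zero in \<open>simp_all add: coinvariants_class_def coinvariants_def q\<close>)
  then show ?thesis using y by simp
qed

lemma coinvariants_lift:
  assumes N: "module R N" and \<phi>: "symmetric_family R P V N \<phi>"
  obtains h where "h \<in> linear_maps R (coinvariants R P V n) N"
    and "\<And>\<mu> vs. \<lbrakk>\<mu> \<in> carrier (Ops P n); length vs = n; set vs \<subseteq> carrier V\<rbrakk> \<Longrightarrow>
      h (coinvariants_class \<mu> vs) = \<phi> \<mu> vs"
proof -
  let ?T = "tensor R (Ops P n) V n"
  note T = tensor_module[OF ops_module V]
  note pc = multilinear.closed[OF pure_tensor_multilinear[OF ops_module V]]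
  interpret N: module R N by (rule N)
  obtain k where k: "k \<in> linear_maps R ?T N"
    "\<And>\<mu> vs. \<lbrakk>\<mu> \<in> carrier (Ops P n); length vs = n; set vs \<subseteq> carrier V\<rbrakk> \<Longrightarrow>
      k (pure_tensor R (Ops P n) V n \<mu> vs) = \<phi> \<mu> vs"
    using tensor_lift[OF ops_module V N symmetric_family.multilinear[OF \<phi>]] by blast
  have minus_self: "a \<ominus>\<^bsub>N\<^esub> a = \<zero>\<^bsub>N\<^esub>" if "a \<in> carrier N" for a
    using that by (simp add: a_minus_def N.M.r_neg)
  have "k x = \<zero>\<^bsub>N\<^esub>" if "x \<in> coinvariants_kernel R P V n" for x
    using T N k(1) coinvariants_relations_closed _ that[unfolded coinvariants_kernel_def Let_def]
  proof (rule linear_maps_vanish_generated)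
    fix a
    assume "a \<in> {pure_tensor R (Ops P n) V n (act P n \<mu> \<sigma>) (permute_list \<sigma> vs)
        \<ominus>\<^bsub>?T\<^esub> pure_tensor R (Ops P n) V n \<mu> vs | \<mu> vs \<sigma>.
        (\<mu>, vs) \<in> tensor_index (Ops P n) V n \<and> \<sigma> permutes {..<n}}"
    then obtain \<mu> vs \<sigma> where "a = pure_tensor R (Ops P n) V n (act P n \<mu> \<sigma>) (permute_list \<sigma> vs)
        \<ominus>\<^bsub>?T\<^esub> pure_tensor R (Ops P n) V n \<mu> vs"
      "(\<mu>, vs) \<in> tensor_index (Ops P n) V n" "\<sigma> permutes {..<n}"
      by blast
    then show "k a = \<zero>\<^bsub>N\<^esub>"
      by (simp add: tensor_index_iff[OF ops_module V] linear_maps_minus[OF k(1) T N] pc k(2) act_closed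
        symmetric_family.sym[OF \<phi>] multilinear.closed[OF symmetric_family.multilinear[OF \<phi>, of n]]
        minus_self)
  qed
  then show thesis
    using quotient_lift[OF T coinvariants_kernel_submodule N k(1)] that k(2) pc
    unfolding coinvariants_class_def coinvariants_def by metis
qed

end

context
  fixes V :: "('r, 'v) module"
  assumes V: "module R V"
begin

lemma cls_eq: "cls R P V \<mu> vs =
    direct_sum_incl UNIV (coinvariants R P V) (length vs) (coinvariants_class V (length vs) \<mu> vs)"
  by (simp add: cls_def coinvariants_class_def[OF V] Let_def)

lemma Schur_module: "module R (S V)"
  unfolding Schur_def by (rule direct_sum_module[OF cring]) (rule coinvariants_module[OF V])

lemma cls_symmetric_family: "symmetric_family R P V (S V) (cls R P V)"
proof (rule symmetric_family.intro)
  fix n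
  have lin: "(\<lambda>x\<in>carrier (coinvariants R P V n). direct_sum_incl UNIV (coinvariants R P V) n x)
      \<in> linear_maps R (coinvariants R P V n) (S V)"
    unfolding Schur_def using cring coinvariants_module[OF V]
    by (intro restrict_linear_maps coinvariants_module[OF V])
      (simp_all add: direct_sum_incl_closed direct_sum_incl_add direct_sum_incl_smult)
  show "multilinear R (Ops P n) V n (S V) (cls R P V)"
    by (rule multilinear_compose[OF coinvariants_class_multilinear[OF V] lin ops_module V])
      (auto simp: cls_eq multilinear.closed[OF coinvariants_class_multilinear[OF V]])
qed (simp add: cls_eq coinvariants_class_sym[OF V])

lemmas cls_closed = multilinear.closed[OF symmetric_family.multilinear[OF cls_symmetric_family] _ refl]

text \<open>Zero is itself a class, of arity zero; this supplies the zero case in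
  \<open>Schur_spanned\<close>.\<close>

lemma cls_zero: "cls R P V \<zero>\<^bsub>Ops P 0\<^esub> [] = \<zero>\<^bsub>S V\<^esub>"
proof -
  interpret O: module R "Ops P 0" by (rule ops_module)
  interpret S: module R "S V" by (rule Schur_module)
  have "cls R P V (\<zero>\<^bsub>R\<^esub> \<odot>\<^bsub>Ops P 0\<^esub> \<zero>\<^bsub>Ops P 0\<^esub>) [] = \<zero>\<^bsub>R\<^esub> \<odot>\<^bsub>S V\<^esub> cls R P V \<zero>\<^bsub>Ops P 0\<^esub> []"
    by (rule multilinear.smult_left[OF symmetric_family.multilinear[OF cls_symmetric_family]]) auto
  then show ?thesis using cls_closed[of "\<zero>\<^bsub>Ops P 0\<^esub>" "[]"] by simp
qed

text \<open>Every element is a finite sum of classes, since scalars are absorbed by the operation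
  and zero is a class. Later identities of linear maps on \<open>S V\<close> are checked on classes
  by this rule.\<close>

lemma Schur_spanned:
  assumes x: "x \<in> carrier (S V)"
    and cls: "\<And>\<mu> vs. \<lbrakk>\<mu> \<in> carrier (Ops P (length vs)); set vs \<subseteq> carrier V\<rbrakk> \<Longrightarrow> Q (cls R P V \<mu> vs)"
    and add: "\<And>x y. \<lbrakk>x \<in> carrier (S V); y \<in> carrier (S V); Q x; Q y\<rbrakk> \<Longrightarrow>
      Q (x \<oplus>\<^bsub>S V\<^esub> y)"
  shows "Q x"
proof -
  have zero: "Q \<zero>\<^bsub>S V\<^esub>"
    using cls[of "\<zero>\<^bsub>Ops P 0\<^esub>" "[]"] cls_zero
      abelian_group.axioms(1)[OF module.axioms(2)[OF ops_module[of 0]]]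
    by (simp add: abelian_monoid.zero_closed)
  let ?i = "direct_sum_incl UNIV (coinvariants R P V)"
  show ?thesis
  proof (rule direct_sum_induct[OF cring coinvariants_module[OF V] x[unfolded Schur_def]])
    show "Q (?i n c)" if "c \<in> carrier (coinvariants R P V n)" for n c
      using V that
    proof (rule coinvariants_induct)
      show "Q (?i n (coinvariants_class V n \<mu> vs))"
        if "\<mu> \<in> carrier (Ops P n)" "length vs = n" "set vs \<subseteq> carrier V" for \<mu> vs
        using cls[of \<mu> vs] that by (auto simp: cls_eq)
      have "?i n \<zero>\<^bsub>coinvariants R P V n\<^esub> = \<zero>\<^bsub>S V\<^esub>"
        by (simp add: direct_sum_incl_def Schur_def direct_sum_def fun_eq_iff)
      then show "Q (?i n \<zero>\<^bsub>coinvariants R P V n\<^esub>)" using zero by simp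
      show "Q (?i n (a \<oplus>\<^bsub>coinvariants R P V n\<^esub> b))"
        if "a \<in> carrier (coinvariants R P V n)" "b \<in> carrier (coinvariants R P V n)" "Q (?i n a)" "Q (?i n b)" for a b
        using add[of "?i n a" "?i n b"] that cring coinvariants_module[OF V]
        by (simp add: direct_sum_incl_add direct_sum_incl_closed Schur_def)
    qed
  qed (use zero add in \<open>auto simp: Schur_def\<close>)
qed

lemma Schur_linear_maps_eqI:
  assumes "h \<in> linear_maps R (S V) N" "k \<in> linear_maps R (S V) N"
    and "\<And>\<mu> vs. \<lbrakk>\<mu> \<in> carrier (Ops P (length vs)); set vs \<subseteq> carrier V\<rbrakk> \<Longrightarrow> h (cls R P V \<mu> vs) = k (cls R P V \<mu> vs)"
  shows "h = k"
proof (rule linear_maps_eqI[OF assms(1,2)])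
  fix x assume "x \<in> carrier (S V)"
  then show "h x = k x"
    by (rule Schur_spanned) (simp_all add: assms linear_mapsD(2)[OF assms(1)] linear_mapsD(2)[OF assms(2)])
qed

lemma Schur_lift_exists:
  assumes N: "module R N" and \<phi>: "symmetric_family R P V N \<phi>"
  obtains h where "h \<in> linear_maps R (S V) N"
    and "\<And>\<mu> vs. \<lbrakk>\<mu> \<in> carrier (Ops P (length vs)); set vs \<subseteq> carrier V\<rbrakk> \<Longrightarrow> h (cls R P V \<mu> vs) = \<phi> \<mu> vs"
proof -
  have "\<exists>h. h \<in> linear_maps R (coinvariants R P V n) N \<and> (\<forall>\<mu> vs. \<mu> \<in> carrier (Ops P n) \<longrightarrow>
      length vs = n \<longrightarrow> set vs \<subseteq> carrier V \<longrightarrow> h (coinvariants_class V n \<mu> vs) = \<phi> \<mu> vs)" for n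
    using coinvariants_lift[OF V N \<phi>, of n] by metis
  then obtain h where h: "\<And>n. h n \<in> linear_maps R (coinvariants R P V n) N"
    "\<And>n \<mu> vs. \<lbrakk>\<mu> \<in> carrier (Ops P n); length vs = n; set vs \<subseteq> carrier V\<rbrakk> \<Longrightarrow>
       h n (coinvariants_class V n \<mu> vs) = \<phi> \<mu> vs"
    by metis
  show thesis
  proof (rule direct_sum_lift[of R UNIV "coinvariants R P V" N h, OF cring coinvariants_module[OF V] N h(1)])
    fix k
    assume k: "k \<in> linear_maps R (direct_sum UNIV (coinvariants R P V)) N"
      "\<And>n x. \<lbrakk>n \<in> UNIV; x \<in> carrier (coinvariants R P V n)\<rbrakk> \<Longrightarrow>
        k (direct_sum_incl UNIV (coinvariants R P V) n x) = h n x"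
    show thesis
      by (rule that[of k])
        (simp_all add: k cls_eq h(2) Schur_def multilinear.closed[OF coinvariants_class_multilinear[OF V]])
  qed
qed

text \<open>Existence is \<open>Schur_lift_exists\<close>; uniqueness holds because classes span.
  Together they show that the description in \<open>Schur_lift\<close> denotes.\<close>

lemma
  assumes N: "module R N" and \<phi>: "symmetric_family R P V N \<phi>"
  shows Schur_lift_linear: "Schur_lift R P V N \<phi> \<in> linear_maps R (S V) N"
    and Schur_lift_cls: "\<lbrakk>\<mu> \<in> carrier (Ops P (length vs)); set vs \<subseteq> carrier V\<rbrakk> \<Longrightarrow>
      Schur_lift R P V N \<phi> (cls R P V \<mu> vs) = \<phi> \<mu> vs"
proof -
  obtain h where h: "h \<in> linear_maps R (S V) N"
    "\<And>\<mu> vs. \<lbrakk>\<mu> \<in> carrier (Ops P (length vs)); set vs \<subseteq> carrier V\<rbrakk> \<Longrightarrow> h (cls R P V \<mu> vs) = \<phi> \<mu> vs"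
    using Schur_lift_exists[OF N \<phi>] by blast
  have "Schur_lift R P V N \<phi> = h"
    unfolding Schur_lift_def
    by (rule the_equality) (simp_all add: h, auto intro: Schur_linear_maps_eqI[OF _ h(1)] simp: h)
  then show "Schur_lift R P V N \<phi> \<in> linear_maps R (S V) N"
    "\<lbrakk>\<mu> \<in> carrier (Ops P (length vs)); set vs \<subseteq> carrier V\<rbrakk> \<Longrightarrow>
      Schur_lift R P V N \<phi> (cls R P V \<mu> vs) = \<phi> \<mu> vs"
    using h by simp_all
qed

end

lemmas Schur_induct = Schur_spanned [consumes 2, case_names cls add]

end

section \<open>Permutations of inputs\<close>

text \<open>\<open>shift_input s n\<close> opens a gap of width \<open>n\<close> at position
  \<open>s\<close>. This and the next two facts say that off \<open>s\<close> it is injective,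
  avoids the gap, and stays below the new arity; they make \<open>perm_pcomp\<close> a
  permutation.\<close>

lemma shift_input_inj: "\<lbrakk>shift_input s n k = shift_input s n l; k \<noteq> s; l \<noteq> s\<rbrakk> \<Longrightarrow> k = l"
  by (auto simp: shift_input_def split: if_splits)

lemma shift_input_outside: "k \<noteq> s \<Longrightarrow> shift_input s n k < s \<or> s + n \<le> shift_input s n k"
  by (auto simp: shift_input_def)

lemma shift_input_less: "\<lbrakk>k < m; s < m; k \<noteq> s\<rbrakk> \<Longrightarrow> shift_input s n k < m + n - 1"
  by (auto simp: shift_input_def)

text \<open>An injective self-map of a finite set is a bijection. The inserted block goes into the
  gap at \<open>\<sigma> i\<close>, the remaining positions go around it, and the map is injective
  on each of the two kinds.\<close>

lemma perm_pcomp_permutes: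
  assumes \<sigma>: "\<sigma> permutes {..<m}" and \<tau>: "\<tau> permutes {..<n}" and i: "i < m"
  shows "perm_pcomp m n i \<sigma> \<tau> permutes {..<m + n - 1}"
proof (rule inj_imp_permutes)
  let ?f = "perm_pcomp m n i \<sigma> \<tau>"
  \<comment> \<open>For a position outside the inserted block, the input it was before the
    insertion.\<close>
  define old where "old p = (if p < i then p else p + 1 - n)" for p
  have \<sigma>i: "\<sigma> i < m" using permutes_in_image[OF \<sigma>, of i] i by simp
  have old: "?f p = shift_input (\<sigma> i) n (\<sigma> (old p))" "\<sigma> (old p) \<noteq> \<sigma> i" "\<sigma> (old p) < m"
    if "p < m + n - 1" "\<not> (i \<le> p \<and> p < i + n)" for p
  proof -
    have *: "old p < m" "old p \<noteq> i" using that i by (auto simp: old_def split: if_splits)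
    show "?f p = shift_input (\<sigma> i) n (\<sigma> (old p))" using that by (auto simp: perm_pcomp_def old_def)
    show "\<sigma> (old p) \<noteq> \<sigma> i" using * permutes_inj[OF \<sigma>] by (auto dest: injD)
    show "\<sigma> (old p) < m" using * permutes_in_image[OF \<sigma>, of "old p"] by simp
  qed
  have mid: "?f p = \<sigma> i + \<tau> (p - i)" "\<tau> (p - i) < n" if "i \<le> p" "p < i + n" for p
    using that permutes_in_image[OF \<tau>, of "p - i"] by (auto simp: perm_pcomp_def)
  show "inj_on ?f {..<m + n - 1}"
  proof (rule inj_onI)
    fix p q assume p: "p \<in> {..<m + n - 1}" and q: "q \<in> {..<m + n - 1}" and eq: "?f p = ?f q"
    consider "\<not> (i \<le> p \<and> p < i + n)" "\<not> (i \<le> q \<and> q < i + n)" | "i \<le> p \<and> p < i + n" "i \<le> q \<and> q < i + n"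
      | "i \<le> p \<and> p < i + n" "\<not> (i \<le> q \<and> q < i + n)" | "\<not> (i \<le> p \<and> p < i + n)" "i \<le> q \<and> q < i + n" by blast
    then show "p = q"
    proof cases
      case 1
      then have "\<sigma> (old p) = \<sigma> (old q)"
        using shift_input_inj[of "\<sigma> i" n "\<sigma> (old p)" "\<sigma> (old q)"] old[of p] old[of q] p q eq by simp
      then have "old p = old q" using permutes_inj[OF \<sigma>] by (auto dest: injD)
      then show ?thesis using 1 by (auto simp: old_def split: if_splits)
    next
      case 2
      then have "\<tau> (p - i) = \<tau> (q - i)" using mid[of p] mid[of q] eq by simp
      then have "p - i = q - i" using permutes_inj[OF \<tau>] by (auto dest: injD)
      then show ?thesis using 2 by arith
    next
      case 3
      then show ?thesis
        using mid[of p] old[of q] q eq shift_input_outside[of "\<sigma> (old q)" "\<sigma> i" n] by simp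
    next
      case 4
      then show ?thesis
        using mid[of q] old[of p] p eq shift_input_outside[of "\<sigma> (old p)" "\<sigma> i" n] by simp
    qed
  qed
  show "?f p \<in> {..<m + n - 1}" if "p \<in> {..<m + n - 1}" for p
  proof (cases "i \<le> p \<and> p < i + n")
    case True
    then show ?thesis using mid[of p] \<sigma>i by simp
  next
    case False
    then show ?thesis using old[of p] that shift_input_less[OF _ \<sigma>i, of "\<sigma> (old p)" n] by simp
  qed
qed (use i in \<open>auto simp: perm_pcomp_def\<close>)

text \<open>\<open>\<sigma>\<close> moves only inputs before \<open>i\<close>, so the block at
  \<open>i\<close> and everything after it stay put. In \<open>papp\<close> this is a permutation of
  the elements of \<open>V\<close>, all of which precede the slot being filled.\<close>

lemma perm_pcomp_id_right:
  assumes "\<sigma> permutes {..<i}"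
  shows "perm_pcomp m n i \<sigma> id = \<sigma>"
proof
  fix p
  have \<sigma>: "\<sigma> k = k" if "i \<le> k" for k using permutes_not_in[OF assms] that by simp
  show "perm_pcomp m n i \<sigma> id p = \<sigma> p"
    using permutes_in_image[OF assms, of p]
    by (auto simp: perm_pcomp_def shift_input_def \<sigma>)
qed

lemma permute_list_append_left:
  assumes "\<sigma> permutes {..<length xs}"
  shows "permute_list \<sigma> (xs @ ys) = permute_list \<sigma> xs @ ys"
proof (rule nth_equalityI)
  fix p assume "p < length (permute_list \<sigma> (xs @ ys))"
  then show "permute_list \<sigma> (xs @ ys) ! p = (permute_list \<sigma> xs @ ys) ! p"
    using permutes_in_image[OF assms, of p] permutes_not_in[OF assms, of p]
    by (auto simp: permute_list_def nth_append)
qed simp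

text \<open>Only the inserted block is moved. The support \<open>{..<i + n}\<close>, smaller than
  the full arity, is what the symmetry of \<open>papp\<close> in its elements of \<open>V\<close>
  asks for.\<close>

lemma perm_pcomp_id_left:
  assumes i: "i < m" and \<tau>: "\<tau> permutes {..<n}"
  shows "perm_pcomp m n i id \<tau> permutes {..<i + n}"
proof (rule permutes_superset[OF perm_pcomp_permutes[OF permutes_id \<tau> i]])
  show "perm_pcomp m n i id \<tau> p = p" if "p \<in> {..<m + n - 1} - {..<i + n}" for p
    using that by (auto simp: perm_pcomp_def shift_input_def)
qed

lemma permute_list_perm_pcomp_id_left:
  assumes "length xs < m" and \<tau>: "\<tau> permutes {..<length ys}"
  shows "permute_list (perm_pcomp m (length ys) (length xs) id \<tau>) (xs @ ys) = xs @ permute_list \<tau> ys"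
proof (rule nth_equalityI)
  fix p assume p: "p < length (permute_list (perm_pcomp m (length ys) (length xs) id \<tau>) (xs @ ys))"
  then show "permute_list (perm_pcomp m (length ys) (length xs) id \<tau>) (xs @ ys) ! p = (xs @ permute_list \<tau> ys) ! p"
    by (auto simp: permute_list_def nth_append perm_pcomp_def shift_input_def)
qed simp

text \<open>
  Replacing an entry of the list by a list \<open>us\<close> turns the permutation into its partial composition
  with the identity.
\<close>

lemma permute_list_split:
  fixes xs ys :: "'a list"
  assumes \<sigma>: "\<sigma> permutes {..<Suc (length xs + length ys)}"
  obtains as bs where "\<sigma> (length as) = length xs" "length as + length bs = length xs + length ys"
    "set as \<subseteq> set xs \<union> set ys" "set bs \<subseteq> set xs \<union> set ys"
    "\<And>z. permute_list \<sigma> (xs @ z # ys) = as @ z # bs"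
    "\<And>us. permute_list (perm_pcomp (Suc (length xs + length ys)) (length us) (length as) \<sigma> id) (xs @ us @ ys)
       = as @ us @ bs"
proof -
  let ?m = "Suc (length xs + length ys)"
  \<comment> \<open>The position at which the distinguished entry reappears: entry \<open>p\<close>
    of \<open>permute_list \<sigma> l\<close> is entry \<open>\<sigma> p\<close> of
    \<open>l\<close>.\<close>
  define i where "i = inv_into UNIV \<sigma> (length xs)"
  have \<sigma>i: "\<sigma> i = length xs" using permutes_inverses(1)[OF \<sigma>] by (simp add: i_def)
  then have i: "i < ?m" using permutes_in_image[OF \<sigma>, of i] by simp
  \<comment> \<open>Reads off the entries other than the distinguished one, so it depends neither on
    \<open>z\<close> nor on \<open>us\<close>; hence the same \<open>as\<close> and
    \<open>bs\<close> serve both conclusions.\<close>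
  define e where "e k = (if k < length xs then xs ! k else ys ! (k - Suc (length xs)))" for k
  define as where "as = map (\<lambda>p. e (\<sigma> p)) [0..<i]"
  define bs where "bs = map (\<lambda>p. e (\<sigma> p)) [Suc i..<?m]"
  have ne: "\<sigma> p \<noteq> length xs" if "p \<noteq> i" for p
    using that \<sigma>i permutes_inj[OF \<sigma>] by (metis injD)
  have less: "\<sigma> p < ?m" if "p < ?m" for p
    using that permutes_in_image[OF \<sigma>, of p] by simp
  have e_in: "e (\<sigma> p) \<in> set xs \<union> set ys" if "p < ?m" "p \<noteq> i" for p
    using less[OF that(1)] ne[OF that(2)] by (auto simp: e_def)
  have e1: "(xs @ z # ys) ! \<sigma> p = e (\<sigma> p)" if "p \<noteq> i" for p z
    using ne[OF that] by (auto simp: e_def nth_append nth_Cons')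
  have e2: "(xs @ us @ ys) ! shift_input (length xs) (length us) (\<sigma> p) = e (\<sigma> p)" if "p \<noteq> i" for p us
    using ne[OF that] by (auto simp: e_def nth_append shift_input_def)
  have len: "length as = i" "length as + length bs = length xs + length ys"
    using i by (auto simp: as_def bs_def)
  show thesis
  proof (rule that)
    show "set as \<subseteq> set xs \<union> set ys" "set bs \<subseteq> set xs \<union> set ys"
      unfolding as_def bs_def set_map by (intro image_subsetI e_in; use i in auto)+
    show "permute_list \<sigma> (xs @ z # ys) = as @ z # bs" for z
    proof (rule nth_equalityI)
      fix p assume p: "p < length (permute_list \<sigma> (xs @ z # ys))"
      then have L: "permute_list \<sigma> (xs @ z # ys) ! p = (xs @ z # ys) ! \<sigma> p"
        using \<sigma> by (intro permute_list_nth) auto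
      show "permute_list \<sigma> (xs @ z # ys) ! p = (as @ z # bs) ! p"
      proof (cases p i rule: linorder_cases)
        case less
        then show ?thesis unfolding L using e1[of p z] by (simp add: nth_append len(1)) (simp add: as_def)
      next
        case equal
        then show ?thesis unfolding L using \<sigma>i by (simp add: nth_append len(1))
      next
        case greater
        have "Suc i + (p - Suc i) = p" "p - Suc i < ?m - Suc i"
          using greater p by auto
        then have "bs ! (p - Suc i) = e (\<sigma> p)" by (simp add: bs_def del: upt_Suc)
        then have "(as @ z # bs) ! p = e (\<sigma> p)"
          using greater by (simp add: nth_append nth_Cons' len(1))
        then show ?thesis unfolding L using e1[of p z] greater by simp
      qed
    qed (use len in simp)
    show "permute_list (perm_pcomp ?m (length us) (length as) \<sigma> id) (xs @ us @ ys) = as @ us @ bs" for us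
    proof (rule nth_equalityI)
      fix p assume p: "p < length (permute_list (perm_pcomp ?m (length us) (length as) \<sigma> id) (xs @ us @ ys))"
      consider "p < i" | "i \<le> p" "p < i + length us" | "i + length us \<le> p" by linarith
      then show "permute_list (perm_pcomp ?m (length us) (length as) \<sigma> id) (xs @ us @ ys) ! p = (as @ us @ bs) ! p"
      proof cases
        case 1
        then show ?thesis
          using p e2[of p us] \<sigma>i
          by (simp add: permute_list_def perm_pcomp_def len(1)) (simp add: as_def nth_append)
      next
        case 2
        then have *: "\<not> p < i" "p - i < length us" by auto
        then have "perm_pcomp ?m (length us) i \<sigma> id p = length xs + (p - i)"
          using 2 by (simp add: perm_pcomp_def \<sigma>i)
        moreover have "(xs @ us @ ys) ! (length xs + (p - i)) = us ! (p - i)"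
          unfolding nth_append_length_plus using * by (simp add: nth_append)
        moreover have "permute_list (perm_pcomp ?m (length us) i \<sigma> id) (xs @ us @ ys) ! p =
            (xs @ us @ ys) ! perm_pcomp ?m (length us) i \<sigma> id p"
          using p by (simp add: permute_list_def)
        ultimately show ?thesis using * by (simp add: nth_append len(1))
      next
        case 3
        have p': "p < length xs + length us + length ys" using p by simp
        have ne: "\<not> p < i" "\<not> p < i + length us" "p < ?m + length us - 1" "p + 1 - length us \<noteq> i"
          "\<not> p - i < length us"
          using 3 p' by auto
        have eq: "Suc i + (p - i - length us) = p + 1 - length us" and lt: "p - i - length us < ?m - Suc i"
          using 3 p' by auto
        have "bs ! q = e (\<sigma> (Suc i + q))" if "q < ?m - Suc i" for q
          using that by (simp add: bs_def del: upt_Suc)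
        from this[OF lt] have "bs ! (p - i - length us) = e (\<sigma> (p + 1 - length us))"
          by (simp only: eq)
        then have "(as @ us @ bs) ! p = e (\<sigma> (p + 1 - length us))"
          using ne by (simp add: nth_append len(1))
        moreover have "perm_pcomp ?m (length us) i \<sigma> id p = shift_input (length xs) (length us) (\<sigma> (p + 1 - length us))"
          using ne by (simp add: perm_pcomp_def \<sigma>i)
        ultimately show ?thesis
          using e2[OF ne(4), of us] p' by (simp add: permute_list_def len(1))
      qed
    qed (use len in simp)
  qed (use len \<sigma>i in simp_all)
qed


section \<open>Schur functors as free algebras\<close>

context operad
begin

section \<open>Linearity of partial composition, and of lifts in the family\<close>

lemma pcomp_closed:
  "\<lbrakk>\<mu> \<in> carrier (Ops P m); \<nu> \<in> carrier (Ops P n); i < m; k = m + n - 1\<rbrakk> \<Longrightarrow>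
    pcomp P m n i \<mu> \<nu> \<in> carrier (Ops P k)"
  using linear_mapsD(1)[OF pcomp_linear_left, of i m \<nu> n \<mu>] by simp

lemma pcomp_add_left:
  assumes "\<mu> \<in> carrier (Ops P m)" "\<mu>' \<in> carrier (Ops P m)" "\<nu> \<in> carrier (Ops P n)" "i < m" "k = m + n - 1"
  shows "pcomp P m n i (\<mu> \<oplus>\<^bsub>Ops P m\<^esub> \<mu>') \<nu> = pcomp P m n i \<mu> \<nu> \<oplus>\<^bsub>Ops P k\<^esub> pcomp P m n i \<mu>' \<nu>"
proof -
  interpret O: module R "Ops P m" by (rule ops_module)
  show ?thesis using linear_mapsD(2)[OF pcomp_linear_left, of i m \<nu> n \<mu> \<mu>'] assms by simp
qed

lemma pcomp_smult_left:
  assumes "\<mu> \<in> carrier (Ops P m)" "r \<in> carrier R" "\<nu> \<in> carrier (Ops P n)" "i < m" "k = m + n - 1"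
  shows "pcomp P m n i (r \<odot>\<^bsub>Ops P m\<^esub> \<mu>) \<nu> = r \<odot>\<^bsub>Ops P k\<^esub> pcomp P m n i \<mu> \<nu>"
proof -
  interpret O: module R "Ops P m" by (rule ops_module)
  show ?thesis using linear_mapsD(3)[OF pcomp_linear_left, of i m \<nu> n r \<mu>] assms by simp
qed

lemma pcomp_add_right:
  assumes "\<mu> \<in> carrier (Ops P m)" "\<nu> \<in> carrier (Ops P n)" "\<nu>' \<in> carrier (Ops P n)" "i < m" "k = m + n - 1"
  shows "pcomp P m n i \<mu> (\<nu> \<oplus>\<^bsub>Ops P n\<^esub> \<nu>') = pcomp P m n i \<mu> \<nu> \<oplus>\<^bsub>Ops P k\<^esub> pcomp P m n i \<mu> \<nu>'"
proof -
  interpret O: module R "Ops P n" by (rule ops_module)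
  show ?thesis using linear_mapsD(2)[OF pcomp_linear_right, of i m \<mu> \<nu> n \<nu>'] assms by simp
qed

lemma pcomp_smult_right:
  assumes "\<mu> \<in> carrier (Ops P m)" "r \<in> carrier R" "\<nu> \<in> carrier (Ops P n)" "i < m" "k = m + n - 1"
  shows "pcomp P m n i \<mu> (r \<odot>\<^bsub>Ops P n\<^esub> \<nu>) = r \<odot>\<^bsub>Ops P k\<^esub> pcomp P m n i \<mu> \<nu>"
proof -
  interpret O: module R "Ops P n" by (rule ops_module)
  show ?thesis using linear_mapsD(3)[OF pcomp_linear_right, of i m \<mu> r \<nu> n] assms by simp
qed

lemma Schur_lift_cong:
  assumes "\<And>\<mu> vs. \<lbrakk>\<mu> \<in> carrier (Ops P (length vs)); set vs \<subseteq> carrier V\<rbrakk> \<Longrightarrow> \<phi> \<mu> vs = \<psi> \<mu> vs"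
  shows "Schur_lift R P V N \<phi> = Schur_lift R P V N \<psi>"
  unfolding Schur_lift_def using assms by (intro arg_cong[where f = The] ext) auto

text \<open>Additivity in the family rather than in the argument. It carries multilinearity of
  \<open>papp V xs\<close> in the operation and the elements of \<open>V\<close> over to
  \<open>papp V (x # xs)\<close>.\<close>

lemma Schur_lift_add:
  assumes V: "module R V" and N: "module R N"
    and fam: "symmetric_family R P V N \<phi>" "symmetric_family R P V N \<psi>" "symmetric_family R P V N \<chi>"
    and eq: "\<And>\<mu> vs. \<lbrakk>\<mu> \<in> carrier (Ops P (length vs)); set vs \<subseteq> carrier V\<rbrakk> \<Longrightarrow> \<phi> \<mu> vs = \<psi> \<mu> vs \<oplus>\<^bsub>N\<^esub> \<chi> \<mu> vs"
    and x: "x \<in> carrier (S V)"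
  shows "Schur_lift R P V N \<phi> x = Schur_lift R P V N \<psi> x \<oplus>\<^bsub>N\<^esub> Schur_lift R P V N \<chi> x"
proof -
  interpret N: module R N by (rule N)
  note lin = Schur_lift_linear[OF V N]
  show ?thesis
    using V x
  proof (induction rule: Schur_induct)
    case (cls \<mu> vs)
    then show ?case by (simp add: Schur_lift_cls[OF V N] fam eq)
  next
    case (add x y)
    then show ?case
      using linear_mapsD(1)[OF lin[OF fam(2)]] linear_mapsD(1)[OF lin[OF fam(3)]]
      by (simp add: linear_mapsD(2)[OF lin[OF fam(1)]] linear_mapsD(2)[OF lin[OF fam(2)]]
        linear_mapsD(2)[OF lin[OF fam(3)]] N.M.a_ac)
  qed
qed

lemma Schur_lift_smult:
  assumes V: "module R V" and N: "module R N"
    and fam: "symmetric_family R P V N \<phi>" "symmetric_family R P V N \<psi>"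
    and eq: "\<And>\<mu> vs. \<lbrakk>\<mu> \<in> carrier (Ops P (length vs)); set vs \<subseteq> carrier V\<rbrakk> \<Longrightarrow> \<phi> \<mu> vs = r \<odot>\<^bsub>N\<^esub> \<psi> \<mu> vs"
    and x: "x \<in> carrier (S V)" and r: "r \<in> carrier R"
  shows "Schur_lift R P V N \<phi> x = r \<odot>\<^bsub>N\<^esub> Schur_lift R P V N \<psi> x"
proof -
  interpret N: module R N by (rule N)
  note lin = Schur_lift_linear[OF V N]
  show ?thesis
    using V x
  proof (induction rule: Schur_induct)
    case (cls \<mu> vs)
    then show ?case by (simp add: Schur_lift_cls[OF V N] fam eq)
  next
    case (add x y)
    then show ?case
      using linear_mapsD(1)[OF lin[OF fam(2)]] r
      by (simp add: linear_mapsD(2)[OF lin[OF fam(1)]] linear_mapsD(2)[OF lin[OF fam(2)]] N.smult_r_distr)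
  qed
qed

text \<open>
  \<open>papp V xs \<mu> vs\<close> is \<open>\<mu>\<close> applied to the elements \<open>vs\<close> of \<open>V\<close>, followed by the elements \<open>xs\<close> of the free
  algebra on \<open>V\<close>. The latter are inserted one at a time, by the universal property of the Schur functor.
\<close>

primrec papp :: "('r, 'v) module \<Rightarrow> ('r, 'p, 'v) schur list \<Rightarrow> 'p \<Rightarrow> 'v list \<Rightarrow> ('r, 'p, 'v) schur" where
  "papp V [] = cls R P V"
| "papp V (x # xs) = (\<lambda>\<mu> vs. Schur_lift R P V (S V)
     (\<lambda>\<nu> us. papp V xs (pcomp P (Suc (length vs + length xs)) (length us) (length vs) \<mu> \<nu>) (vs @ us)) x)"

definition app :: "('r, 'v) module \<Rightarrow> 'p \<Rightarrow> ('r, 'p, 'v) schur list \<Rightarrow> ('r, 'p, 'v) schur" where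
  "app V \<mu> xs = papp V xs \<mu> []"

section \<open>Multilinearity and symmetry of the action in its elements of \<open>V\<close>\<close>

context
  fixes V :: "('r, 'v) module"
  assumes V: "module R V"
begin

interpretation V: module R V by (rule V)
interpretation S: module R "S V" by (rule Schur_module[OF V])

text \<open>The \<open>Cons\<close> clause of \<open>papp\<close> lifts a symmetric family. By
  equivariance of partial composition a permutation of \<open>us\<close> becomes a permutation of
  \<open>vs @ us\<close> that fixes the part \<open>vs\<close>, so the symmetry assumed for
  \<open>papp V xs\<close> applies.\<close>

lemma papp_family_step:
  assumes ml: "\<And>n. multilinear R (Ops P (n + length xs)) V n (S V) (papp V xs)"
    and sym: "\<And>vs \<mu> \<sigma>. \<lbrakk>\<mu> \<in> carrier (Ops P (length vs + length xs)); set vs \<subseteq> carrier V;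
      \<sigma> permutes {..<length vs}\<rbrakk> \<Longrightarrow>
      papp V xs (act P (length vs + length xs) \<mu> \<sigma>) (permute_list \<sigma> vs) = papp V xs \<mu> vs"
    and \<mu>: "\<mu> \<in> carrier (Ops P (Suc (length vs + length xs)))" and vs: "set vs \<subseteq> carrier V"
  shows "symmetric_family R P V (S V)
    (\<lambda>\<nu> us. papp V xs (pcomp P (Suc (length vs + length xs)) (length us) (length vs) \<mu> \<nu>) (vs @ us))"
proof (rule symmetric_family.intro)
  fix n
  let ?m = "Suc (length vs + length xs)"
  note ml' = ml[of "length vs + n"]
  have pc: "pcomp P ?m n (length vs) \<mu> \<nu> \<in> carrier (Ops P (length vs + n + length xs))"
    if "\<nu> \<in> carrier (Ops P n)" for \<nu>
    using that by (intro pcomp_closed[OF \<mu>]) auto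
  have pa: "pcomp P ?m n (length vs) \<mu> (\<nu> \<oplus>\<^bsub>Ops P n\<^esub> \<nu>') =
      pcomp P ?m n (length vs) \<mu> \<nu> \<oplus>\<^bsub>Ops P (length vs + n + length xs)\<^esub> pcomp P ?m n (length vs) \<mu> \<nu>'"
    if "\<nu> \<in> carrier (Ops P n)" "\<nu>' \<in> carrier (Ops P n)" for \<nu> \<nu>'
    using that by (intro pcomp_add_right[OF \<mu>]) auto
  have ps: "pcomp P ?m n (length vs) \<mu> (r \<odot>\<^bsub>Ops P n\<^esub> \<nu>) =
      r \<odot>\<^bsub>Ops P (length vs + n + length xs)\<^esub> pcomp P ?m n (length vs) \<mu> \<nu>"
    if "r \<in> carrier R" "\<nu> \<in> carrier (Ops P n)" for r \<nu>
    using that by (intro pcomp_smult_right[OF \<mu>]) auto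
  show "multilinear R (Ops P n) V n (S V) (\<lambda>\<nu> us. papp V xs (pcomp P ?m (length us) (length vs) \<mu> \<nu>) (vs @ us))"
  proof (rule multilinear.intro)
    fix \<nu> us v w ws
    assume "\<nu> \<in> carrier (Ops P n)" "length us + length ws + 1 = n" "set us \<subseteq> carrier V" "set ws \<subseteq> carrier V"
      "v \<in> carrier V" "w \<in> carrier V"
    then show "papp V xs (pcomp P ?m (length (us @ (v \<oplus>\<^bsub>V\<^esub> w) # ws)) (length vs) \<mu> \<nu>) (vs @ us @ (v \<oplus>\<^bsub>V\<^esub> w) # ws) =
        papp V xs (pcomp P ?m (length (us @ v # ws)) (length vs) \<mu> \<nu>) (vs @ us @ v # ws) \<oplus>\<^bsub>S V\<^esub>
        papp V xs (pcomp P ?m (length (us @ w # ws)) (length vs) \<mu> \<nu>) (vs @ us @ w # ws)"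
      using multilinear.add_slot[OF ml' pc, of \<nu> "vs @ us" ws v w] vs by auto
  next
    fix r \<nu> us v ws
    assume "r \<in> carrier R" "\<nu> \<in> carrier (Ops P n)" "length us + length ws + 1 = n" "set us \<subseteq> carrier V"
      "set ws \<subseteq> carrier V" "v \<in> carrier V"
    then show "papp V xs (pcomp P ?m (length (us @ (r \<odot>\<^bsub>V\<^esub> v) # ws)) (length vs) \<mu> \<nu>) (vs @ us @ (r \<odot>\<^bsub>V\<^esub> v) # ws) =
        r \<odot>\<^bsub>S V\<^esub> papp V xs (pcomp P ?m (length (us @ v # ws)) (length vs) \<mu> \<nu>) (vs @ us @ v # ws)"
      using multilinear.smult_slot[OF ml' _ pc, of r \<nu> "vs @ us" ws v] vs by auto
  qed (use vs in \<open>simp_all add: pa ps pc multilinear.closed[OF ml'] multilinear.add_left[OF ml']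
        multilinear.smult_left[OF ml']\<close>)
  fix \<nu> us \<tau>
  assume \<nu>: "\<nu> \<in> carrier (Ops P n)" and us: "length us = n" "set us \<subseteq> carrier V" and \<tau>: "\<tau> permutes {..<n}"
  let ?\<tau> = "perm_pcomp ?m n (length vs) id \<tau>"
  have \<tau>': "?\<tau> permutes {..<length (vs @ us)}"
    using perm_pcomp_id_left[OF _ \<tau>, of "length vs" ?m] us by simp
  have pc': "pcomp P ?m n (length vs) \<mu> \<nu> \<in> carrier (Ops P (length (vs @ us) + length xs))"
    using pc[OF \<nu>] us by simp
  have ar: "?m + n - 1 = length (vs @ us) + length xs" using us by simp
  have "pcomp P ?m n (length vs) \<mu> (act P n \<nu> \<tau>) =
      act P (length (vs @ us) + length xs) (pcomp P ?m n (length vs) \<mu> \<nu>) ?\<tau>"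
    using pcomp_equivariant[of "length vs" ?m \<mu> \<nu> n id \<tau>] \<mu> \<nu> \<tau>
    unfolding ar by (simp add: act_id permutes_id)
  moreover have "vs @ permute_list \<tau> us = permute_list ?\<tau> (vs @ us)"
    using permute_list_perm_pcomp_id_left[of vs ?m \<tau> us] \<tau> us by simp
  ultimately show "papp V xs (pcomp P ?m (length (permute_list \<tau> us)) (length vs) \<mu> (act P n \<nu> \<tau>)) (vs @ permute_list \<tau> us)
      = papp V xs (pcomp P ?m (length us) (length vs) \<mu> \<nu>) (vs @ us)"
    using sym[OF pc' _ \<tau>'] vs us by simp
qed

text \<open>The two properties need a joint induction: the lift defining
  \<open>papp V (x # xs)\<close> is known to have its intended values only for a symmetric family,
  and this uses both properties of \<open>papp V xs\<close>.\<close>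

lemma papp_multilinear_sym:
  assumes "set xs \<subseteq> carrier (S V)"
  shows "(\<forall>n. multilinear R (Ops P (n + length xs)) V n (S V) (papp V xs)) \<and>
    (\<forall>\<mu> vs \<sigma>. \<mu> \<in> carrier (Ops P (length vs + length xs)) \<longrightarrow> set vs \<subseteq> carrier V \<longrightarrow>
      \<sigma> permutes {..<length vs} \<longrightarrow>
      papp V xs (act P (length vs + length xs) \<mu> \<sigma>) (permute_list \<sigma> vs) = papp V xs \<mu> vs)"
  using assms
proof (induction xs)
  case Nil
  show ?case
    using symmetric_family.multilinear[OF cls_symmetric_family[OF V]]
      symmetric_family.sym[OF cls_symmetric_family[OF V]] by simp
next
  case (Cons x xs)
  have x: "x \<in> carrier (S V)" and xs: "set xs \<subseteq> carrier (S V)"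
    using Cons.prems by auto
  have ml: "multilinear R (Ops P (n + length xs)) V n (S V) (papp V xs)" for n
    using Cons.IH[OF xs] by blast
  have sym: "papp V xs (act P (length vs + length xs) \<mu> \<sigma>) (permute_list \<sigma> vs) = papp V xs \<mu> vs"
    if "\<mu> \<in> carrier (Ops P (length vs + length xs))" "set vs \<subseteq> carrier V" "\<sigma> permutes {..<length vs}"
    for \<mu> vs \<sigma>
    using Cons.IH[OF xs] that by blast
  let ?S = "S V"
  define F where "F \<mu> vs = (\<lambda>\<nu> us. papp V xs (pcomp P (Suc (length vs + length xs)) (length us) (length vs) \<mu> \<nu>) (vs @ us))"
    for \<mu> vs
  have fam: "symmetric_family R P V ?S (F \<mu> vs)"
    if "\<mu> \<in> carrier (Ops P (Suc (length vs + length xs)))" "set vs \<subseteq> carrier V" for \<mu> vs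
    unfolding F_def using ml sym that by (rule papp_family_step)
  have papp_eq: "papp V (x # xs) \<mu> vs = Schur_lift R P V ?S (F \<mu> vs) x" for \<mu> vs
    by (simp add: F_def)
  show ?case
  proof (intro conjI allI impI, goal_cases)
    case (1 n)
    let ?k = "n + length (x # xs)"
    interpret O: module R "Ops P ?k" by (rule ops_module)
    have fam': "symmetric_family R P V ?S (F \<mu> vs)"
      if "\<mu> \<in> carrier (Ops P ?k)" "set vs \<subseteq> carrier V" "length vs = n" for \<mu> vs
      using that by (intro fam) auto
    have pc: "pcomp P ?k l n \<mu> \<nu> \<in> carrier (Ops P (n + l + length xs))"
      if "\<mu> \<in> carrier (Ops P ?k)" "\<nu> \<in> carrier (Ops P l)" for \<mu> \<nu> l
      using that by (intro pcomp_closed) auto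
    show ?case
    proof (rule multilinear.intro)
      fix \<mu> vs assume \<mu>: "\<mu> \<in> carrier (Ops P ?k)" and vs: "length vs = n" "set vs \<subseteq> carrier V"
      show "papp V (x # xs) \<mu> vs \<in> carrier ?S"
        unfolding papp_eq using \<mu> vs by (intro linear_mapsD(1)[OF Schur_lift_linear[OF V S.module_axioms fam'] x])
      show "papp V (x # xs) (\<mu> \<oplus>\<^bsub>Ops P ?k\<^esub> \<mu>') vs = papp V (x # xs) \<mu> vs \<oplus>\<^bsub>?S\<^esub> papp V (x # xs) \<mu>' vs"
        if \<mu>': "\<mu>' \<in> carrier (Ops P ?k)" for \<mu>'
        unfolding papp_eq
      proof (rule Schur_lift_add[OF V S.module_axioms fam' fam' fam' _ x])
        fix \<nu> us assume \<nu>: "\<nu> \<in> carrier (Ops P (length us))" and us: "set us \<subseteq> carrier V"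
        have "pcomp P ?k (length us) n (\<mu> \<oplus>\<^bsub>Ops P ?k\<^esub> \<mu>') \<nu> =
            pcomp P ?k (length us) n \<mu> \<nu> \<oplus>\<^bsub>Ops P (n + length us + length xs)\<^esub> pcomp P ?k (length us) n \<mu>' \<nu>"
          by (rule pcomp_add_left[OF \<mu> \<mu>' \<nu>]) auto
        then show "F (\<mu> \<oplus>\<^bsub>Ops P ?k\<^esub> \<mu>') vs \<nu> us = F \<mu> vs \<nu> us \<oplus>\<^bsub>?S\<^esub> F \<mu>' vs \<nu> us"
          using multilinear.add_left[OF ml[of "n + length us"] pc[OF \<mu> \<nu>] pc[OF \<mu>' \<nu>], of "vs @ us"] vs us
          by (simp add: F_def)
      qed (rule O.M.a_closed[OF \<mu> \<mu>'] \<mu> \<mu>' vs)+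
      show "papp V (x # xs) (r \<odot>\<^bsub>Ops P ?k\<^esub> \<mu>) vs = r \<odot>\<^bsub>?S\<^esub> papp V (x # xs) \<mu> vs" if r: "r \<in> carrier R" for r
        unfolding papp_eq
      proof (rule Schur_lift_smult[OF V S.module_axioms fam' fam' _ x r])
        fix \<nu> us assume \<nu>: "\<nu> \<in> carrier (Ops P (length us))" and us: "set us \<subseteq> carrier V"
        have "pcomp P ?k (length us) n (r \<odot>\<^bsub>Ops P ?k\<^esub> \<mu>) \<nu> =
            r \<odot>\<^bsub>Ops P (n + length us + length xs)\<^esub> pcomp P ?k (length us) n \<mu> \<nu>"
          by (rule pcomp_smult_left[OF \<mu> r \<nu>]) auto
        then show "F (r \<odot>\<^bsub>Ops P ?k\<^esub> \<mu>) vs \<nu> us = r \<odot>\<^bsub>?S\<^esub> F \<mu> vs \<nu> us"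
          using multilinear.smult_left[OF ml[of "n + length us"] r pc[OF \<mu> \<nu>], of "vs @ us"] vs us
          by (simp add: F_def)
      qed (rule O.smult_closed[OF r \<mu>] \<mu> vs)+
    next
      fix \<mu> us v w ws
      assume \<mu>: "\<mu> \<in> carrier (Ops P ?k)" and l: "length us + length ws + 1 = n"
        and uw: "set us \<subseteq> carrier V" "set ws \<subseteq> carrier V" and v: "v \<in> carrier V" and w: "w \<in> carrier V"
      show "papp V (x # xs) \<mu> (us @ (v \<oplus>\<^bsub>V\<^esub> w) # ws) =
          papp V (x # xs) \<mu> (us @ v # ws) \<oplus>\<^bsub>?S\<^esub> papp V (x # xs) \<mu> (us @ w # ws)"
        unfolding papp_eq
      proof (rule Schur_lift_add[OF V S.module_axioms fam' fam' fam' _ x])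
        fix \<nu> ts assume \<nu>: "\<nu> \<in> carrier (Ops P (length ts))" and ts: "set ts \<subseteq> carrier V"
        have k: "Suc (Suc (length us + length ws + length xs)) = ?k" using l by simp
        show "F \<mu> (us @ (v \<oplus>\<^bsub>V\<^esub> w) # ws) \<nu> ts = F \<mu> (us @ v # ws) \<nu> ts \<oplus>\<^bsub>?S\<^esub> F \<mu> (us @ w # ws) \<nu> ts"
          using multilinear.add_slot[OF ml[of "n + length ts"] pc[OF \<mu> \<nu>], of us "ws @ ts" v w] l uw ts v w
          by (auto simp: F_def k)
      qed (use \<mu> l uw v w in auto)
    next
      fix r \<mu> us v ws
      assume r: "r \<in> carrier R" and \<mu>: "\<mu> \<in> carrier (Ops P ?k)" and l: "length us + length ws + 1 = n"
        and uw: "set us \<subseteq> carrier V" "set ws \<subseteq> carrier V" and v: "v \<in> carrier V"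
      show "papp V (x # xs) \<mu> (us @ (r \<odot>\<^bsub>V\<^esub> v) # ws) = r \<odot>\<^bsub>?S\<^esub> papp V (x # xs) \<mu> (us @ v # ws)"
        unfolding papp_eq
      proof (rule Schur_lift_smult[OF V S.module_axioms fam' fam' _ x r])
        fix \<nu> ts assume \<nu>: "\<nu> \<in> carrier (Ops P (length ts))" and ts: "set ts \<subseteq> carrier V"
        have k: "Suc (Suc (length us + length ws + length xs)) = ?k" using l by simp
        show "F \<mu> (us @ (r \<odot>\<^bsub>V\<^esub> v) # ws) \<nu> ts = r \<odot>\<^bsub>?S\<^esub> F \<mu> (us @ v # ws) \<nu> ts"
          using multilinear.smult_slot[OF ml[of "n + length ts"] r pc[OF \<mu> \<nu>], of us "ws @ ts" v] l uw ts v
          by (auto simp: F_def k)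
      qed (use \<mu> l uw v r in auto)
    qed
  next
    case (2 \<mu> vs \<sigma>)
    let ?k = "length vs + length (x # xs)"
    have k: "Suc (length vs + length xs) = ?k" by simp
    have \<sigma>: "\<sigma> permutes {..<?k}" using 2(3) by (rule permutes_subset) simp
    \<comment> \<open>The slot to be filled is fixed by \<open>\<sigma>\<close>, so equivariance
      leaves the insertion point where it is.\<close>
    have \<sigma>v: "\<sigma> (length vs) = length vs" using permutes_not_in[OF 2(3)] by simp
    show ?case
      unfolding papp_eq
    proof (rule arg_cong[where f = "\<lambda>h. h x"], rule Schur_lift_cong)
      fix \<nu> us assume \<nu>: "\<nu> \<in> carrier (Ops P (length us))" and us: "set us \<subseteq> carrier V"
      have pc: "pcomp P ?k (length us) (length vs) \<mu> \<nu> \<in> carrier (Ops P (length (vs @ us) + length xs))"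
        by (rule pcomp_closed[OF 2(1) \<nu>]) auto
      have ar: "?k + length us - 1 = length (vs @ us) + length xs" by simp
      have "pcomp P ?k (length us) (length vs) (act P ?k \<mu> \<sigma>) \<nu> =
          act P (length (vs @ us) + length xs) (pcomp P ?k (length us) (length vs) \<mu> \<nu>) \<sigma>"
        using pcomp_equivariant[of "length vs" ?k \<mu> \<nu> "length us" \<sigma> id] 2(1) \<nu> \<sigma>
        unfolding ar by (simp add: act_id permutes_id perm_pcomp_id_right[OF 2(3)] \<sigma>v)
      moreover have "permute_list \<sigma> vs @ us = permute_list \<sigma> (vs @ us)"
        using permute_list_append_left[OF 2(3)] by simp
      moreover have "\<sigma> permutes {..<length (vs @ us)}"
        using 2(3) by (rule permutes_subset) simp
      ultimately show "F (act P ?k \<mu> \<sigma>) (permute_list \<sigma> vs) \<nu> us = F \<mu> vs \<nu> us"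
        using sym[OF pc] 2(2) us unfolding F_def length_permute_list k by simp
    qed
  qed
qed

end

end

context operad
begin

abbreviation (input) eta :: "('r, 'v) module \<Rightarrow> 'v \<Rightarrow> ('r, 'p, 'v) schur" where
  "eta V v \<equiv> cls R P V (ounit P) [v]"

lemma linear_eta:
  assumes V: "module R V"
  shows "Schur_unit R P V \<in> linear_maps R V (S V)"
proof -
  interpret V: module R V by (rule V)
  note ml = symmetric_family.multilinear[OF cls_symmetric_family[OF V], of 1]
  show ?thesis
    unfolding Schur_unit_def
    using multilinear.closed[OF ml ounit_closed] multilinear.add_slot[OF ml ounit_closed, of "[]" "[]"]
      multilinear.smult_slot[OF ml _ ounit_closed, of _ "[]" "[]"]
    by (intro restrict_linear_maps[OF V]) auto
qed

section \<open>Linearity and insertion rules for the action on the free algebra\<close>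

context
  fixes V :: "('r, 'v) module"
  assumes V: "module R V"
begin

interpretation V: module R V by (rule V)
interpretation S: module R "S V" by (rule Schur_module[OF V])

lemma eta_closed: "v \<in> carrier V \<Longrightarrow> eta V v \<in> carrier (S V)"
  using cls_closed[OF V, of "ounit P" "[v]"] ounit_closed by simp

lemma map_eta_closed: "set vs \<subseteq> carrier V \<Longrightarrow> set (map (eta V) vs) \<subseteq> carrier (S V)"
  using eta_closed by auto

lemma papp_multilinear:
  "set xs \<subseteq> carrier (S V) \<Longrightarrow> multilinear R (Ops P (n + length xs)) V n (S V) (papp V xs)"
  using papp_multilinear_sym[OF V] by blast

lemma papp_closed:
  assumes "\<mu> \<in> carrier (Ops P k)" "k = length vs + length xs" "set vs \<subseteq> carrier V" "set xs \<subseteq> carrier (S V)"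
  shows "papp V xs \<mu> vs \<in> carrier (S V)"
  using multilinear.closed[OF papp_multilinear, OF assms(4) _ refl] assms by simp

lemma papp_family:
  assumes "\<mu> \<in> carrier (Ops P k)" "k = Suc (length vs + length xs)" "set vs \<subseteq> carrier V"
    "set xs \<subseteq> carrier (S V)"
  shows "symmetric_family R P V (S V)
    (\<lambda>\<nu> us. papp V xs (pcomp P (Suc (length vs + length xs)) (length us) (length vs) \<mu> \<nu>) (vs @ us))"
  using papp_multilinear_sym[OF V assms(4)] assms by (intro papp_family_step[OF V]) auto

lemma papp_Cons_linear:
  assumes "\<mu> \<in> carrier (Ops P k)" "k = Suc (length vs + length xs)" "set vs \<subseteq> carrier V"
    "set xs \<subseteq> carrier (S V)"
  shows "(\<lambda>x. papp V (x # xs) \<mu> vs) \<in> linear_maps R (S V) (S V)"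
  using Schur_lift_linear[OF V S.module_axioms papp_family[OF assms]] by simp

lemma papp_Cons_cls:
  assumes "\<mu> \<in> carrier (Ops P k)" "k = Suc (length vs + length xs)" "set vs \<subseteq> carrier V"
    "set xs \<subseteq> carrier (S V)" "\<nu> \<in> carrier (Ops P (length us))" "set us \<subseteq> carrier V"
  shows "papp V (cls R P V \<nu> us # xs) \<mu> vs = papp V xs (pcomp P k (length us) (length vs) \<mu> \<nu>) (vs @ us)"
  using Schur_lift_cls[OF V S.module_axioms papp_family[OF assms(1-4)] assms(5,6)] assms(2) by simp

text \<open>For a slot behind other arguments the induction expands the first argument by its lift,
  which turns it into elements of \<open>V\<close> and leaves the slot one place nearer the
  front.\<close>

lemma papp_add_slot:
  assumes "\<mu> \<in> carrier (Ops P k)" "k = Suc (length vs + length xs + length ys)" "set vs \<subseteq> carrier V"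
    "set xs \<subseteq> carrier (S V)" "set ys \<subseteq> carrier (S V)"
    "x \<in> carrier (S V)" "y \<in> carrier (S V)"
  shows "papp V (xs @ (x \<oplus>\<^bsub>S V\<^esub> y) # ys) \<mu> vs =
    papp V (xs @ x # ys) \<mu> vs \<oplus>\<^bsub>S V\<^esub> papp V (xs @ y # ys) \<mu> vs"
  using assms
proof (induction xs arbitrary: \<mu> k vs)
  case Nil
  then show ?case using linear_mapsD(2)[OF papp_Cons_linear, of \<mu> k vs ys x y] by simp
next
  case (Cons a xs)
  let ?S = "S V"
  have a: "a \<in> carrier ?S" and xs: "set xs \<subseteq> carrier ?S" using Cons.prems by auto
  have k: "Suc (length vs + length (xs @ z # ys)) = k" for z using Cons.prems by simp
  have fam: "symmetric_family R P V ?S (\<lambda>\<nu> us. papp V (xs @ z # ys)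
      (pcomp P (Suc (length vs + length (xs @ z # ys))) (length us) (length vs) \<mu> \<nu>) (vs @ us))"
    if "z \<in> carrier ?S" for z
    using Cons.prems that xs by (intro papp_family[of _ k]) auto
  show ?case
    unfolding append_Cons papp.simps
  proof (rule Schur_lift_add[OF V S.module_axioms fam fam fam _ a])
    fix \<nu> us assume \<nu>: "\<nu> \<in> carrier (Ops P (length us))" and us: "set us \<subseteq> carrier V"
    have "pcomp P k (length us) (length vs) \<mu> \<nu> \<in> carrier (Ops P (Suc (length (vs @ us) + length xs + length ys)))"
      by (rule pcomp_closed[OF Cons.prems(1) \<nu>]) (use Cons.prems in auto)
    from Cons.IH[OF this refl _ xs] show "papp V (xs @ (x \<oplus>\<^bsub>?S\<^esub> y) # ys)
        (pcomp P (Suc (length vs + length (xs @ (x \<oplus>\<^bsub>?S\<^esub> y) # ys))) (length us) (length vs) \<mu> \<nu>) (vs @ us) =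
        papp V (xs @ x # ys) (pcomp P (Suc (length vs + length (xs @ x # ys))) (length us) (length vs) \<mu> \<nu>) (vs @ us)
        \<oplus>\<^bsub>?S\<^esub> papp V (xs @ y # ys) (pcomp P (Suc (length vs + length (xs @ y # ys))) (length us) (length vs) \<mu> \<nu>) (vs @ us)"
      unfolding k using us Cons.prems by simp
  qed (use Cons.prems in auto)
qed

lemma papp_smult_slot:
  assumes "r \<in> carrier R" "\<mu> \<in> carrier (Ops P k)" "k = Suc (length vs + length xs + length ys)" "set vs \<subseteq> carrier V"
    "set xs \<subseteq> carrier (S V)" "set ys \<subseteq> carrier (S V)" "x \<in> carrier (S V)"
  shows "papp V (xs @ (r \<odot>\<^bsub>S V\<^esub> x) # ys) \<mu> vs = r \<odot>\<^bsub>S V\<^esub> papp V (xs @ x # ys) \<mu> vs"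
  using assms
proof (induction xs arbitrary: \<mu> k vs)
  case Nil
  then show ?case using linear_mapsD(3)[OF papp_Cons_linear, of \<mu> k vs ys r x] by simp
next
  case (Cons a xs)
  let ?S = "S V"
  have a: "a \<in> carrier ?S" and xs: "set xs \<subseteq> carrier ?S" using Cons.prems by auto
  have k: "Suc (length vs + length (xs @ z # ys)) = k" for z using Cons.prems by simp
  have fam: "symmetric_family R P V ?S (\<lambda>\<nu> us. papp V (xs @ z # ys)
      (pcomp P (Suc (length vs + length (xs @ z # ys))) (length us) (length vs) \<mu> \<nu>) (vs @ us))"
    if "z \<in> carrier ?S" for z
    using Cons.prems that xs by (intro papp_family[of _ k]) auto
  show ?case
    unfolding append_Cons papp.simps
  proof (rule Schur_lift_smult[OF V S.module_axioms fam fam _ a Cons.prems(1)])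
    fix \<nu> us assume \<nu>: "\<nu> \<in> carrier (Ops P (length us))" and us: "set us \<subseteq> carrier V"
    have "pcomp P k (length us) (length vs) \<mu> \<nu> \<in> carrier (Ops P (Suc (length (vs @ us) + length xs + length ys)))"
      by (rule pcomp_closed[OF Cons.prems(2) \<nu>]) (use Cons.prems in auto)
    from Cons.IH[OF Cons.prems(1) this refl _ xs] show "papp V (xs @ (r \<odot>\<^bsub>?S\<^esub> x) # ys)
        (pcomp P (Suc (length vs + length (xs @ (r \<odot>\<^bsub>?S\<^esub> x) # ys))) (length us) (length vs) \<mu> \<nu>) (vs @ us) =
        r \<odot>\<^bsub>?S\<^esub> papp V (xs @ x # ys) (pcomp P (Suc (length vs + length (xs @ x # ys))) (length us) (length vs) \<mu> \<nu>) (vs @ us)"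
      unfolding k using us Cons.prems by simp
  qed (use Cons.prems in auto)
qed

text \<open>By the right unit axiom, inserting \<open>eta V u\<close> leaves the operation unchanged
  and only moves \<open>u\<close> into the list of elements of \<open>V\<close>.\<close>

lemma papp_map_eta:
  assumes "\<mu> \<in> carrier (Ops P k)" "k = length vs + length us + length xs" "set vs \<subseteq> carrier V"
    "set us \<subseteq> carrier V" "set xs \<subseteq> carrier (S V)"
  shows "papp V (map (eta V) us @ xs) \<mu> vs = papp V xs \<mu> (vs @ us)"
  using assms
proof (induction us arbitrary: vs)
  case Nil
  then show ?case by simp
next
  case (Cons u us)
  have "papp V (eta V u # map (eta V) us @ xs) \<mu> vs =
      papp V (map (eta V) us @ xs) (pcomp P k (length [u]) (length vs) \<mu> (ounit P)) (vs @ [u])"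
    using Cons.prems map_eta_closed[of us] ounit_closed by (intro papp_Cons_cls) auto
  also have "pcomp P k (length [u]) (length vs) \<mu> (ounit P) = \<mu>"
    using ounit_right[of "length vs" k \<mu>] Cons.prems by simp
  also have "papp V (map (eta V) us @ xs) \<mu> (vs @ [u]) = papp V xs \<mu> ((vs @ [u]) @ us)"
    using Cons.prems by (intro Cons.IH) auto
  finally show ?case by simp
qed

text \<open>At the first slot this is the defining clause. At a later slot the insertion of
  \<open>\<nu>\<close> has to be moved past the insertions before it, which the parallel axiom
  allows.\<close>

lemma papp_insert:
  assumes "\<mu> \<in> carrier (Ops P k)" "k = Suc (length vs + length xs + length ys)" "set vs \<subseteq> carrier V"
    "set xs \<subseteq> carrier (S V)" "set ys \<subseteq> carrier (S V)"
    "\<nu> \<in> carrier (Ops P (length us))" "set us \<subseteq> carrier V"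
  shows "papp V (xs @ cls R P V \<nu> us # ys) \<mu> vs =
    papp V (xs @ map (eta V) us @ ys) (pcomp P k (length us) (length vs + length xs) \<mu> \<nu>) vs"
  using assms
proof (induction xs arbitrary: \<mu> k vs)
  case Nil
  have "papp V (cls R P V \<nu> us # ys) \<mu> vs = papp V ys (pcomp P k (length us) (length vs) \<mu> \<nu>) (vs @ us)"
    using Nil by (intro papp_Cons_cls) auto
  also have "\<dots> = papp V (map (eta V) us @ ys) (pcomp P k (length us) (length vs) \<mu> \<nu>) vs"
    using Nil
    by (intro papp_map_eta[symmetric, of _ "k + length us - 1"] pcomp_closed[of _ k _ "length us"]) auto
  finally show ?case by simp
next
  case (Cons a xs)
  let ?S = "S V" and ?i = "length vs + length (a # xs)"
  have a: "a \<in> carrier ?S" and xs: "set xs \<subseteq> carrier ?S" using Cons.prems by auto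
  have k: "Suc (length vs + length (xs @ cls R P V \<nu> us # ys)) = k" using Cons.prems by simp
  have k': "Suc (length vs + length (xs @ map (eta V) us @ ys)) = k + length us - 1" using Cons.prems by simp
  show ?case
    unfolding append_Cons papp.simps k k'
  proof (rule arg_cong[where f = "\<lambda>h. h a"], rule Schur_lift_cong)
    fix \<rho> ws assume \<rho>: "\<rho> \<in> carrier (Ops P (length ws))" and ws: "set ws \<subseteq> carrier V"
    let ?j = "k + length ws - 1"
    have pc: "pcomp P k (length ws) (length vs) \<mu> \<rho> \<in> carrier (Ops P ?j)"
      by (rule pcomp_closed[OF Cons.prems(1) \<rho>]) (use Cons.prems in auto)
    have "papp V (xs @ cls R P V \<nu> us # ys) (pcomp P k (length ws) (length vs) \<mu> \<rho>) (vs @ ws) =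
        papp V (xs @ map (eta V) us @ ys)
          (pcomp P ?j (length us) (length (vs @ ws) + length xs) (pcomp P k (length ws) (length vs) \<mu> \<rho>) \<nu>) (vs @ ws)"
      using Cons.prems ws xs by (intro Cons.IH[OF pc]) auto
    also have "length (vs @ ws) + length xs = ?i + length ws - 1" by simp
    \<comment> \<open>The parallel axiom: filling the earlier slot with \<open>\<rho>\<close> shifts
      the later slot from \<open>?i\<close> to \<open>?i + length ws - 1\<close>.\<close>
    also have "pcomp P ?j (length us) (?i + length ws - 1) (pcomp P k (length ws) (length vs) \<mu> \<rho>) \<nu> =
        pcomp P (k + length us - 1) (length ws) (length vs) (pcomp P k (length us) ?i \<mu> \<nu>) \<rho>"
      using Cons.prems \<rho> by (intro pcomp_parallel) auto
    finally show "papp V (xs @ cls R P V \<nu> us # ys) (pcomp P k (length ws) (length vs) \<mu> \<rho>) (vs @ ws) =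
        papp V (xs @ map (eta V) us @ ys)
          (pcomp P (k + length us - 1) (length ws) (length vs) (pcomp P k (length us) ?i \<mu> \<nu>) \<rho>) (vs @ ws)" .
  qed
qed

lemma app_closed:
  "\<lbrakk>\<mu> \<in> carrier (Ops P (length xs)); set xs \<subseteq> carrier (S V)\<rbrakk> \<Longrightarrow> app V \<mu> xs \<in> carrier (S V)"
  unfolding app_def by (intro papp_closed) auto

lemma app_multilinear: "multilinear R (Ops P n) (S V) n (S V) (app V)"
proof (rule multilinear.intro)
  have ml: "multilinear R (Ops P n) V 0 (S V) (papp V xs)"
    if "length xs = n" "set xs \<subseteq> carrier (S V)" for xs
    using papp_multilinear[of xs 0] that by simp
  show "app V (\<mu> \<oplus>\<^bsub>Ops P n\<^esub> \<mu>') xs = app V \<mu> xs \<oplus>\<^bsub>S V\<^esub> app V \<mu>' xs"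
    if "\<mu> \<in> carrier (Ops P n)" "\<mu>' \<in> carrier (Ops P n)" "length xs = n" "set xs \<subseteq> carrier (S V)"
    for \<mu> \<mu>' xs
    unfolding app_def using that by (intro multilinear.add_left[OF ml]) auto
  show "app V (r \<odot>\<^bsub>Ops P n\<^esub> \<mu>) xs = r \<odot>\<^bsub>S V\<^esub> app V \<mu> xs"
    if "r \<in> carrier R" "\<mu> \<in> carrier (Ops P n)" "length xs = n" "set xs \<subseteq> carrier (S V)"
    for r \<mu> xs
    unfolding app_def using that by (intro multilinear.smult_left[OF ml]) auto
qed (auto simp: app_def intro!: papp_closed papp_add_slot papp_smult_slot)

lemmas app_add_slot = multilinear.add_slot[OF app_multilinear]
lemmas app_smult_slot = multilinear.smult_slot[OF app_multilinear]

lemma app_map_eta: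
  "\<lbrakk>\<mu> \<in> carrier (Ops P (length vs)); set vs \<subseteq> carrier V\<rbrakk> \<Longrightarrow> app V \<mu> (map (eta V) vs) = cls R P V \<mu> vs"
  using papp_map_eta[of \<mu> "length vs" "[]" vs "[]"] by (simp add: app_def)

lemma app_insert:
  assumes "\<mu> \<in> carrier (Ops P k)" "k = Suc (length xs + length ys)"
    "set xs \<subseteq> carrier (S V)" "set ys \<subseteq> carrier (S V)"
    "\<nu> \<in> carrier (Ops P (length us))" "set us \<subseteq> carrier V"
  shows "app V \<mu> (xs @ cls R P V \<nu> us # ys) =
    app V (pcomp P k (length us) (length xs) \<mu> \<nu>) (xs @ map (eta V) us @ ys)"
  using papp_insert[of \<mu> k "[]" xs ys \<nu> us] assms by (simp add: app_def)

text \<open>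
  Statements about \<open>app\<close> are proved by splitting the arguments into classes and then replacing, one by
  one, the classes by lists of units.
\<close>

lemma app_spanned:
  assumes xs: "set xs \<subseteq> carrier (S V)" and \<mu>: "\<mu> \<in> carrier (Ops P (length xs))"
    and eta: "\<And>\<mu> vs. \<lbrakk>\<mu> \<in> carrier (Ops P (length vs)); set vs \<subseteq> carrier V\<rbrakk> \<Longrightarrow> Q \<mu> (map (eta V) vs)"
    and add: "\<And>\<mu> xs x y ys. \<lbrakk>\<mu> \<in> carrier (Ops P (Suc (length xs + length ys))); set xs \<subseteq> carrier (S V);
      set ys \<subseteq> carrier (S V); x \<in> carrier (S V); y \<in> carrier (S V);
      Q \<mu> (xs @ x # ys); Q \<mu> (xs @ y # ys)\<rbrakk> \<Longrightarrow> Q \<mu> (xs @ (x \<oplus>\<^bsub>S V\<^esub> y) # ys)"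
    and cls: "\<And>\<mu> xs \<nu> us ys. \<lbrakk>\<mu> \<in> carrier (Ops P (Suc (length xs + length ys))); set xs \<subseteq> carrier (S V);
      set ys \<subseteq> carrier (S V); \<nu> \<in> carrier (Ops P (length us)); set us \<subseteq> carrier V;
      Q (pcomp P (Suc (length xs + length ys)) (length us) (length xs) \<mu> \<nu>) (xs @ map (eta V) us @ ys)\<rbrakk> \<Longrightarrow>
      Q \<mu> (xs @ cls R P V \<nu> us # ys)"
  shows "Q \<mu> xs"
proof -
  \<comment> \<open>The part already reduced to units stands at the right. The induction therefore
    consumes \<open>xs\<close> from its last element, and the units of an expanded class join
    \<open>vs\<close>.\<close>
  have "Q \<mu> (xs @ map (eta V) vs)"
    if "set xs \<subseteq> carrier (S V)" "\<mu> \<in> carrier (Ops P (length xs + length vs))" "set vs \<subseteq> carrier V" for \<mu> xs vs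
    using that
  proof (induction xs arbitrary: \<mu> vs rule: rev_induct)
    case Nil
    then show ?case using eta[of \<mu> vs] by simp
  next
    case (snoc x xs)
    then have xs: "set xs \<subseteq> carrier (S V)" and x: "x \<in> carrier (S V)"
      and \<mu>: "\<mu> \<in> carrier (Ops P (Suc (length xs + length (map (eta V) vs))))" by auto
    note vs = map_eta_closed[OF snoc.prems(3)]
    from V x have "Q \<mu> (xs @ x # map (eta V) vs)"
    proof (induction rule: Schur_induct)
      case (cls \<nu> us)
      have "pcomp P (Suc (length xs + length (map (eta V) vs))) (length us) (length xs) \<mu> \<nu>
          \<in> carrier (Ops P (length xs + length (us @ vs)))"
        by (rule pcomp_closed[OF \<mu> cls(1)]) auto
      then show ?case
        using snoc.IH[OF xs, of _ "us @ vs"] cls snoc.prems(3) by (intro assms(5)[OF \<mu> xs vs]) auto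
    next
      case (add x y)
      then show ?case by (intro assms(4)[OF \<mu> xs vs])
    qed
    then show ?case by simp
  qed
  from this[of xs \<mu> "[]"] show ?thesis using xs \<mu> by simp
qed

end

lemmas app_induct = app_spanned [consumes 3, case_names eta add cls]

section \<open>Symmetry, associativity and unit law of the free algebra\<close>

context
  fixes V :: "('r, 'v) module"
  assumes V: "module R V"
begin

interpretation V: module R V by (rule V)
interpretation S: module R "S V" by (rule Schur_module[OF V])

text \<open>\<open>permute_list_split\<close> follows the chosen slot through
  \<open>\<sigma>\<close>. Expanding a class there replaces \<open>\<sigma>\<close> by its partial
  composition with the identity, hence the induction over arbitrary \<open>\<sigma>\<close>.\<close>

lemma app_sym:
  assumes "set xs \<subseteq> carrier (S V)" "\<mu> \<in> carrier (Ops P (length xs))" "\<sigma> permutes {..<length xs}"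
  shows "app V (act P (length xs) \<mu> \<sigma>) (permute_list \<sigma> xs) = app V \<mu> xs"
  using V assms
proof (induction arbitrary: \<sigma> rule: app_induct)
  case (eta \<mu> vs)
  then have \<sigma>: "\<sigma> permutes {..<length vs}" by simp
  then have "app V (act P (length vs) \<mu> \<sigma>) (map (eta V) (permute_list \<sigma> vs)) = cls R P V \<mu> vs"
    using eta symmetric_family.sym[OF cls_symmetric_family[OF V] eta(1) refl]
    by (subst app_map_eta[OF V]) (auto simp: act_closed)
  then show ?case using eta \<sigma> by (simp add: permute_list_map app_map_eta[OF V])
next
  case (add \<mu> xs x y ys)
  let ?k = "Suc (length xs + length ys)"
  have \<sigma>: "\<sigma> permutes {..<?k}" using add.prems by simp
  obtain as bs where s: "length as + length bs = length xs + length ys"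
    "set as \<subseteq> set xs \<union> set ys" "set bs \<subseteq> set xs \<union> set ys"
    "\<And>z. permute_list \<sigma> (xs @ z # ys) = as @ z # bs"
    using permute_list_split[OF \<sigma>] by metis
  have sub: "set as \<subseteq> carrier (S V)" "set bs \<subseteq> carrier (S V)"
    using s add.hyps by blast+
  have "app V (act P ?k \<mu> \<sigma>) (as @ (x \<oplus>\<^bsub>S V\<^esub> y) # bs) =
      app V (act P ?k \<mu> \<sigma>) (as @ x # bs) \<oplus>\<^bsub>S V\<^esub> app V (act P ?k \<mu> \<sigma>) (as @ y # bs)"
    using s(1) by (intro app_add_slot[OF V act_closed[OF add.hyps(1) \<sigma>]] sub add.hyps) auto
  moreover have "app V \<mu> (xs @ (x \<oplus>\<^bsub>S V\<^esub> y) # ys) =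
      app V \<mu> (xs @ x # ys) \<oplus>\<^bsub>S V\<^esub> app V \<mu> (xs @ y # ys)"
    by (intro app_add_slot[OF V add.hyps(1)] add.hyps) auto
  ultimately show ?case
    using add.IH[of \<sigma>] \<sigma> by (simp add: s(4))
next
  case (cls \<mu> xs \<nu> us ys)
  let ?k = "Suc (length xs + length ys)"
  have \<sigma>: "\<sigma> permutes {..<?k}" using cls.prems by simp
  obtain as bs where s: "\<sigma> (length as) = length xs" "length as + length bs = length xs + length ys"
    "set as \<subseteq> set xs \<union> set ys" "set bs \<subseteq> set xs \<union> set ys"
    "\<And>z. permute_list \<sigma> (xs @ z # ys) = as @ z # bs"
    "\<And>us. permute_list (perm_pcomp ?k (length us) (length as) \<sigma> id) (xs @ us @ ys) = as @ us @ bs"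
    using permute_list_split[OF \<sigma>] by metis
  have sub: "set as \<subseteq> carrier (S V)" "set bs \<subseteq> carrier (S V)"
    using s cls.hyps by blast+
  let ?\<sigma> = "perm_pcomp ?k (length us) (length as) \<sigma> id"
  have len: "length (xs @ map (eta V) us @ ys) = ?k + length us - 1" by simp
  have \<sigma>': "?\<sigma> permutes {..<?k + length us - 1}"
    using s(2) by (intro perm_pcomp_permutes[OF \<sigma> permutes_id]) auto
  have "app V (act P ?k \<mu> \<sigma>) (as @ cls R P V \<nu> us # bs) =
      app V (pcomp P ?k (length us) (length as) (act P ?k \<mu> \<sigma>) \<nu>) (as @ map (eta V) us @ bs)"
    using s(2) by (intro app_insert[OF V act_closed[OF cls.hyps(1) \<sigma>]] sub cls.hyps) auto
  also have "pcomp P ?k (length us) (length as) (act P ?k \<mu> \<sigma>) \<nu> =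
      act P (?k + length us - 1) (pcomp P ?k (length us) (length xs) \<mu> \<nu>) ?\<sigma>"
    using pcomp_equivariant[of "length as" ?k \<mu> \<nu> "length us" \<sigma> id] s(1,2) cls.hyps \<sigma>
    by (simp add: act_id permutes_id)
  also have "as @ map (eta V) us @ bs = permute_list ?\<sigma> (xs @ map (eta V) us @ ys)"
    using s(6)[of "map (eta V) us"] by simp
  also have "app V (act P (?k + length us - 1) (pcomp P ?k (length us) (length xs) \<mu> \<nu>) ?\<sigma>)
      (permute_list ?\<sigma> (xs @ map (eta V) us @ ys)) =
      app V (pcomp P ?k (length us) (length xs) \<mu> \<nu>) (xs @ map (eta V) us @ ys)"
    using cls.IH[of ?\<sigma>] \<sigma>' unfolding len by simp
  also have "\<dots> = app V \<mu> (xs @ cls R P V \<nu> us # ys)"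
    by (rule app_insert[OF V cls.hyps(1) refl cls.hyps(2-5), symmetric])
  finally show ?case by (simp add: s(5))
qed

lemma app_symmetric_family: "symmetric_family R P (S V) (S V) (app V)"
  by (rule symmetric_family.intro[OF app_multilinear[OF V]]) (use app_sym in blast)

text \<open>Associativity of the algebra structure, by induction on the arguments of the inner
  operation. On units it is \<open>app_insert\<close>; expanding a class among the inner arguments
  is the sequential axiom.\<close>

lemma app_assoc:
  assumes "set ys \<subseteq> carrier (S V)" "\<nu> \<in> carrier (Ops P (length ys))"
    "\<mu> \<in> carrier (Ops P k)" "k = Suc (length xs + length zs)"
    "set xs \<subseteq> carrier (S V)" "set zs \<subseteq> carrier (S V)"
  shows "app V (pcomp P k (length ys) (length xs) \<mu> \<nu>) (xs @ ys @ zs) = app V \<mu> (xs @ app V \<nu> ys # zs)"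
  using V assms
proof (induction rule: app_induct)
  case (eta \<nu> us)
  then show ?case by (simp add: app_map_eta[OF V] app_insert[OF V])
next
  case (add \<nu> as x y bs)
  let ?S = "S V" and ?n = "Suc (length as + length bs)"
  have pc: "pcomp P k ?n (length xs) \<mu> \<nu> \<in> carrier (Ops P (k + ?n - 1))"
    using add by (intro pcomp_closed) auto
  have ac: "app V \<nu> (as @ z # bs) \<in> carrier ?S" if "z \<in> carrier ?S" for z
    using add that by (intro app_closed[OF V]) auto
  have "app V \<nu> (as @ (x \<oplus>\<^bsub>?S\<^esub> y) # bs) = app V \<nu> (as @ x # bs) \<oplus>\<^bsub>?S\<^esub> app V \<nu> (as @ y # bs)"
    by (intro app_add_slot[OF V add.hyps(1)] add.hyps) auto
  then have "app V \<mu> (xs @ app V \<nu> (as @ (x \<oplus>\<^bsub>?S\<^esub> y) # bs) # zs) =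
      app V \<mu> (xs @ app V \<nu> (as @ x # bs) # zs) \<oplus>\<^bsub>?S\<^esub> app V \<mu> (xs @ app V \<nu> (as @ y # bs) # zs)"
    using add.prems add.hyps ac by (simp add: app_add_slot[OF V])
  moreover have "app V (pcomp P k ?n (length xs) \<mu> \<nu>) ((xs @ as) @ (x \<oplus>\<^bsub>?S\<^esub> y) # bs @ zs) =
      app V (pcomp P k ?n (length xs) \<mu> \<nu>) ((xs @ as) @ x # bs @ zs) \<oplus>\<^bsub>?S\<^esub>
      app V (pcomp P k ?n (length xs) \<mu> \<nu>) ((xs @ as) @ y # bs @ zs)"
    using add by (intro app_add_slot[OF V pc]) auto
  ultimately show ?case using add.IH[OF add.prems] by simp
next
  case (cls \<nu> as \<rho> us bs)
  let ?S = "S V" and ?n = "Suc (length as + length bs)" and ?l = "length us"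
  have pc: "pcomp P k ?n (length xs) \<mu> \<nu> \<in> carrier (Ops P (k + ?n - 1))"
    using cls by (intro pcomp_closed) auto
  have "app V (pcomp P k ?n (length xs) \<mu> \<nu>) ((xs @ as) @ cls R P V \<rho> us # bs @ zs) =
      app V (pcomp P (k + ?n - 1) ?l (length (xs @ as)) (pcomp P k ?n (length xs) \<mu> \<nu>) \<rho>)
        ((xs @ as) @ map (eta V) us @ bs @ zs)"
    using cls by (intro app_insert[OF V pc]) auto
  \<comment> \<open>The sequential axiom: input \<open>length as\<close> of \<open>\<nu>\<close> is
    input \<open>length xs + length as\<close> of the composite.\<close>
  also have "pcomp P (k + ?n - 1) ?l (length (xs @ as)) (pcomp P k ?n (length xs) \<mu> \<nu>) \<rho> =
      pcomp P k (?n + ?l - 1) (length xs) \<mu> (pcomp P ?n ?l (length as) \<nu> \<rho>)"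
    using pcomp_sequential[of "length xs" k "length as" ?n \<mu> \<nu> \<rho> ?l] cls by simp
  finally have "app V (pcomp P k ?n (length xs) \<mu> \<nu>) ((xs @ as) @ cls R P V \<rho> us # bs @ zs) =
      app V (pcomp P k (?n + ?l - 1) (length xs) \<mu> (pcomp P ?n ?l (length as) \<nu> \<rho>))
        ((xs @ as) @ map (eta V) us @ bs @ zs)" .
  moreover have "?n + ?l - 1 = length (as @ map (eta V) us @ bs)" by simp
  ultimately show ?case
    using cls.IH[OF cls.prems] app_insert[OF V cls.hyps(1) refl cls.hyps(2-5)]
    by (simp only: append_assoc append_Cons length_append list.size add_Suc_right add_Suc add_0_right)
qed

lemma app_ounit:
  assumes "x \<in> carrier (S V)"
  shows "app V (ounit P) [x] = x"
  using V assms
proof (induction rule: Schur_induct)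
  case (cls \<nu> us)
  then show ?case
    using papp_Cons_cls[OF V ounit_closed, of "[]" "[]" \<nu> us] ounit_left by (simp add: app_def)
next
  case (add x y)
  then show ?case using app_add_slot[OF V ounit_closed, of "[]" "[]" x y] by simp
qed

end

end

section \<open>Leibniz sums\<close>

text \<open>The arguments of one Leibniz summand, written in the same form as the list in
  \<open>Schur_partial\<close>, so that the two agree by unfolding.\<close>

definition mark :: "('a \<Rightarrow> 'b) \<Rightarrow> ('a \<Rightarrow> 'b) \<Rightarrow> 'a list \<Rightarrow> nat \<Rightarrow> 'b list" where
  "mark f g xs i = map (\<lambda>j. if j = i then g (xs ! j) else f (xs ! j)) [0..<length xs]"

lemma length_mark [simp]: "length (mark f g xs i) = length xs"
  by (simp add: mark_def)

lemma nth_mark: "j < length xs \<Longrightarrow> mark f g xs i ! j = (if j = i then g (xs ! j) else f (xs ! j))"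
  by (simp add: mark_def)

text \<open>An index beyond the list marks nothing; this is why \<open>mark_append\<close> can keep
  \<open>mark f g xs i\<close> as the first part for every \<open>i\<close>.\<close>

lemma mark_eq_map: "length xs \<le> i \<Longrightarrow> mark f g xs i = map f xs"
  by (rule nth_equalityI) (auto simp: nth_mark)

lemma mark_append:
  "mark f g (xs @ ys) i = mark f g xs i @ (if i < length xs then map f ys else mark f g ys (i - length xs))"
  by (rule nth_equalityI) (auto simp: nth_mark nth_append)

lemma mark_Cons:
  "mark f g (x # xs) i = (if i = 0 then g x # map f xs else f x # mark f g xs (i - 1))"
proof (rule nth_equalityI)
  fix j assume "j < length (mark f g (x # xs) i)"
  then show "mark f g (x # xs) i ! j = (if i = 0 then g x # map f xs else f x # mark f g xs (i - 1)) ! j"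
    by (cases j) (auto simp: nth_mark)
qed simp

lemma mark_split:
  assumes "i < length xs"
  shows "mark f g xs i = map f (take i xs) @ g (xs ! i) # map f (drop (Suc i) xs)"
proof -
  have "mark f g (take i xs @ xs ! i # drop (Suc i) xs) i =
      map f (take i xs) @ g (xs ! i) # map f (drop (Suc i) xs)"
    using assms by (simp add: mark_append mark_eq_map mark_Cons)
  then show ?thesis using id_take_nth_drop[OF assms] by simp
qed

lemma mark_map: "mark f g (map h xs) i = mark (f \<circ> h) (g \<circ> h) xs i"
  by (rule nth_equalityI) (auto simp: nth_mark)

lemma map_mark: "map h (mark f g xs i) = mark (h \<circ> f) (h \<circ> g) xs i"
  by (rule nth_equalityI) (auto simp: nth_mark)

lemma mark_cong:
  assumes "\<And>x. x \<in> set xs \<Longrightarrow> f x = f' x" "\<And>x. x \<in> set xs \<Longrightarrow> g x = g' x"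
  shows "mark f g xs i = mark f' g' xs i"
  by (rule nth_equalityI) (auto simp: nth_mark assms)

lemma mark_permute_list:
  assumes "\<sigma> permutes {..<length xs}"
  shows "mark f g (permute_list \<sigma> xs) i = permute_list \<sigma> (mark f g xs (\<sigma> i))"
proof (rule nth_equalityI)
  fix j assume j: "j < length (mark f g (permute_list \<sigma> xs) i)"
  have "\<sigma> j = \<sigma> i \<longleftrightarrow> j = i" using permutes_inj[OF assms] by (auto dest: injD)
  then show "mark f g (permute_list \<sigma> xs) i ! j = permute_list \<sigma> (mark f g xs (\<sigma> i)) ! j"
    using j permutes_in_image[OF assms, of j] by (simp add: nth_mark permute_list_def)
qed simp

lemma set_mark_subset:
  assumes "set xs \<subseteq> A" "\<And>x. x \<in> A \<Longrightarrow> f x \<in> B" "\<And>x. x \<in> A \<Longrightarrow> g x \<in> B"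
  shows "set (mark f g xs i) \<subseteq> B"
proof -
  have "xs ! j \<in> A" if "j < length xs" for j
    using that assms(1) nth_mem by blast
  then show ?thesis using assms(2,3) by (auto simp: mark_def)
qed

text \<open>\<open>\<Phi>\<close> is an arbitrary function of the list, so that a sum over some of
  the arguments with the others held fixed has the same form, as in
  \<open>leibniz_append\<close>.\<close>

definition leibniz :: "('r, 'n) module \<Rightarrow> ('b list \<Rightarrow> 'n) \<Rightarrow> ('a \<Rightarrow> 'b) \<Rightarrow> ('a \<Rightarrow> 'b) \<Rightarrow> 'a list \<Rightarrow> 'n" where
  "leibniz N \<Phi> f g xs = (\<Oplus>\<^bsub>N\<^esub> i\<in>{..<length xs}. \<Phi> (mark f g xs i))"

lemma finsum_lessThan_add:
  fixes a b :: nat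
  assumes N: "module R N" and h: "\<And>i. i < a + b \<Longrightarrow> h i \<in> carrier N"
  shows "(\<Oplus>\<^bsub>N\<^esub> i\<in>{..<a + b}. h i) = (\<Oplus>\<^bsub>N\<^esub> i\<in>{..<a}. h i) \<oplus>\<^bsub>N\<^esub> (\<Oplus>\<^bsub>N\<^esub> i\<in>{..<b}. h (a + i))"
proof -
  interpret N: module R N by (rule N)
  show ?thesis
    using h
  proof (induction b)
    case 0
    then show ?case by (simp add: Pi_def)
  next
    case (Suc b)
    then have IH: "(\<Oplus>\<^bsub>N\<^esub> i\<in>{..<a + b}. h i) = (\<Oplus>\<^bsub>N\<^esub> i\<in>{..<a}. h i) \<oplus>\<^bsub>N\<^esub> (\<Oplus>\<^bsub>N\<^esub> i\<in>{..<b}. h (a + i))"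
      by simp
    have c: "(\<Oplus>\<^bsub>N\<^esub> i\<in>{..<a}. h i) \<in> carrier N" "(\<Oplus>\<^bsub>N\<^esub> i\<in>{..<b}. h (a + i)) \<in> carrier N" "h (a + b) \<in> carrier N"
      using Suc.prems by (auto intro!: N.finsum_closed)
    have "(\<Oplus>\<^bsub>N\<^esub> i\<in>{..<a + Suc b}. h i) = h (a + b) \<oplus>\<^bsub>N\<^esub> (\<Oplus>\<^bsub>N\<^esub> i\<in>{..<a + b}. h i)"
      using Suc.prems by (simp add: lessThan_Suc Pi_def)
    also have "\<dots> = (\<Oplus>\<^bsub>N\<^esub> i\<in>{..<a}. h i) \<oplus>\<^bsub>N\<^esub> (h (a + b) \<oplus>\<^bsub>N\<^esub> (\<Oplus>\<^bsub>N\<^esub> i\<in>{..<b}. h (a + i)))"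
      unfolding IH using c by (simp add: N.M.a_lcomm)
    also have "h (a + b) \<oplus>\<^bsub>N\<^esub> (\<Oplus>\<^bsub>N\<^esub> i\<in>{..<b}. h (a + i)) = (\<Oplus>\<^bsub>N\<^esub> i\<in>{..<Suc b}. h (a + i))"
      using Suc.prems by (simp add: lessThan_Suc Pi_def)
    finally show ?case .
  qed
qed

context
  fixes R :: "('r, 'c) ring_scheme" and N :: "('r, 'n) module"
  assumes N: "module R N"
begin

interpretation N: module R N by (rule N)

lemma leibniz_closed:
  "(\<And>i. i < length xs \<Longrightarrow> \<Phi> (mark f g xs i) \<in> carrier N) \<Longrightarrow> leibniz N \<Phi> f g xs \<in> carrier N"
  unfolding leibniz_def by (rule N.finsum_closed) auto

lemma leibniz_cong:
  assumes "\<And>i. i < length xs \<Longrightarrow> \<Psi> (mark f' g' ys i) \<in> carrier N"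
    and "\<And>i. i < length xs \<Longrightarrow> \<Phi> (mark f g xs i) = \<Psi> (mark f' g' ys i)" and "length xs = length ys"
  shows "leibniz N \<Phi> f g xs = leibniz N \<Psi> f' g' ys"
  unfolding leibniz_def using assms by (intro N.finsum_cong') auto

lemma leibniz_single: "\<Phi> [g x] \<in> carrier N \<Longrightarrow> leibniz N \<Phi> f g [x] = \<Phi> [g x]"
  by (simp add: leibniz_def mark_Cons lessThan_Suc)

lemma leibniz_append:
  assumes "\<And>i. i < length (xs @ ys) \<Longrightarrow> \<Phi> (mark f g (xs @ ys) i) \<in> carrier N"
  shows "leibniz N \<Phi> f g (xs @ ys) =
    leibniz N (\<lambda>l. \<Phi> (l @ map f ys)) f g xs \<oplus>\<^bsub>N\<^esub> leibniz N (\<lambda>l. \<Phi> (map f xs @ l)) f g ys"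
proof -
  have 1: "\<Phi> (mark f g (xs @ ys) i) = \<Phi> (mark f g xs i @ map f ys)" if "i < length xs" for i
    using that by (simp add: mark_append)
  have 2: "\<Phi> (mark f g (xs @ ys) (length xs + i)) = \<Phi> (map f xs @ mark f g ys i)" for i
    by (simp add: mark_append mark_eq_map)
  have "(\<Oplus>\<^bsub>N\<^esub> i\<in>{..<length xs}. \<Phi> (mark f g (xs @ ys) i)) = leibniz N (\<lambda>l. \<Phi> (l @ map f ys)) f g xs"
    unfolding leibniz_def using assms by (intro N.finsum_cong') (auto simp flip: 1)
  moreover have "(\<Oplus>\<^bsub>N\<^esub> i\<in>{..<length ys}. \<Phi> (mark f g (xs @ ys) (length xs + i))) =
      leibniz N (\<lambda>l. \<Phi> (map f xs @ l)) f g ys"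
    unfolding leibniz_def using assms by (intro N.finsum_cong') (auto simp flip: 2)
  ultimately show ?thesis
    using finsum_lessThan_add[OF N, of "length xs" "length ys" "\<lambda>i. \<Phi> (mark f g (xs @ ys) i)"] assms
    by (simp add: leibniz_def)
qed

lemma leibniz_append3:
  assumes "\<And>i. i < length (xs @ ys @ zs) \<Longrightarrow> \<Phi> (mark f g (xs @ ys @ zs) i) \<in> carrier N"
  shows "leibniz N \<Phi> f g (xs @ ys @ zs) = leibniz N (\<lambda>l. \<Phi> (l @ map f (ys @ zs))) f g xs \<oplus>\<^bsub>N\<^esub>
    (leibniz N (\<lambda>l. \<Phi> (map f xs @ l @ map f zs)) f g ys \<oplus>\<^bsub>N\<^esub>
     leibniz N (\<lambda>l. \<Phi> (map f xs @ map f ys @ l)) f g zs)"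
proof -
  have "\<Phi> (map f xs @ mark f g (ys @ zs) i) \<in> carrier N" if "i < length (ys @ zs)" for i
    using assms[of "length xs + i"] that by (simp add: mark_append[of f g xs] mark_eq_map)
  then have "leibniz N (\<lambda>l. \<Phi> (map f xs @ l)) f g (ys @ zs) =
      leibniz N (\<lambda>l. \<Phi> (map f xs @ l @ map f zs)) f g ys \<oplus>\<^bsub>N\<^esub>
      leibniz N (\<lambda>l. \<Phi> (map f xs @ map f ys @ l)) f g zs"
    by (rule leibniz_append[where \<Phi> = "\<lambda>l. \<Phi> (map f xs @ l)"])
  then show ?thesis using leibniz_append[of xs "ys @ zs" \<Phi> f g] assms by simp
qed

lemma linear_leibniz:
  assumes "h \<in> linear_maps R N N'" "module R N'" "\<And>i. i < length xs \<Longrightarrow> \<Phi> (mark f g xs i) \<in> carrier N"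
  shows "h (leibniz N \<Phi> f g xs) = leibniz N' (\<lambda>l. h (\<Phi> l)) f g xs"
  unfolding leibniz_def using assms by (intro linear_maps_finsum[OF assms(1) N assms(2)]) auto

end

context operad
begin

lemma symmetric_family_map:
  assumes \<phi>: "symmetric_family R P W N \<phi>" and f: "f \<in> linear_maps R V W"
  shows "symmetric_family R P V N (\<lambda>\<mu> vs. \<phi> \<mu> (map f vs))"
proof -
  have fc: "set (map f vs) \<subseteq> carrier W" if "set vs \<subseteq> carrier V" for vs
    using that linear_mapsD(1)[OF f] by auto
  show ?thesis
  proof (rule symmetric_family.intro)
    fix n
    note ml = symmetric_family.multilinear[OF \<phi>, of n]
    show "multilinear R (Ops P n) V n N (\<lambda>\<mu> vs. \<phi> \<mu> (map f vs))"
      by (rule multilinear.intro)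
        (simp_all del: set_map add: fc linear_mapsD[OF f] multilinear.closed[OF ml] multilinear.add_left[OF ml]
          multilinear.smult_left[OF ml] multilinear.add_slot[OF ml] multilinear.smult_slot[OF ml])
  next
    fix n \<mu> vs \<sigma>
    assume *: "\<mu> \<in> carrier (Ops P n)" "length vs = n" "set vs \<subseteq> carrier V" "\<sigma> permutes {..<n}"
    then show "\<phi> (act P n \<mu> \<sigma>) (map f (permute_list \<sigma> vs)) = \<phi> \<mu> (map f vs)"
      using symmetric_family.sym[OF \<phi> *(1) _ fc[OF *(3)] *(4)] by (simp flip: permute_list_map)
  qed
qed

text \<open>In every summand the entry of a given slot passes through exactly one of the linear maps
  \<open>f\<close> and \<open>g\<close>, so each summand is linear in that slot. Invariance holds
  only for the whole sum: a permutation reindexes the summands.\<close>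

lemma symmetric_family_leibniz:
  fixes V :: "('r, 'v) module"
  assumes N: "module R N" and V: "module R V" and \<phi>: "symmetric_family R P W N \<phi>"
    and f: "f \<in> linear_maps R V W" and g: "g \<in> linear_maps R V W"
  shows "symmetric_family R P V N (\<lambda>\<mu> vs. leibniz N (\<phi> \<mu>) f g vs)"
proof -
  interpret N: module R N by (rule N)
  interpret V: module R V by (rule V)
  have mc: "set (mark f g vs i) \<subseteq> carrier W" if "set vs \<subseteq> carrier V" for vs i
    using that linear_mapsD(1)[OF f] linear_mapsD(1)[OF g] by (rule set_mark_subset)
  have fc: "set (map f vs) \<subseteq> carrier W" if "set vs \<subseteq> carrier V" for vs
    using that linear_mapsD(1)[OF f] by auto
  have cl: "\<phi> \<mu> (mark f g vs i) \<in> carrier N"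
    if "\<mu> \<in> carrier (Ops P n)" "length vs = n" "set vs \<subseteq> carrier V" for n \<mu> vs i
    using that by (intro multilinear.closed[OF symmetric_family.multilinear[OF \<phi>]] mc) auto
  have lc: "leibniz N (\<phi> \<mu>) f g vs \<in> carrier N"
    if "\<mu> \<in> carrier (Ops P n)" "length vs = n" "set vs \<subseteq> carrier V" for n \<mu> vs
    using that by (intro leibniz_closed[OF N] cl)
  show ?thesis
  proof (rule symmetric_family.intro)
    fix n
    note ml = symmetric_family.multilinear[OF \<phi>, of n]
    \<comment> \<open>The part of the marked list after the slot. It does not involve the entry of
      the slot, so the three lists compared below share it.\<close>
    define B where "B us ws i = (if i \<le> length us then map f ws else mark f g ws (i - Suc (length us)))"
      for us ws :: "'v list" and i
    have split: "mark f g (us @ v # ws) i = mark f g us i @ (if i = length us then g v else f v) # B us ws i"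
      for us v ws i
      by (auto simp: mark_append mark_Cons B_def mark_eq_map)
    have B: "length (B us ws i) = length ws" "set ws \<subseteq> carrier V \<Longrightarrow> set (B us ws i) \<subseteq> carrier W" for us ws i
      using fc[of ws] mc[of ws] by (auto simp: B_def)
    show "multilinear R (Ops P n) V n N (\<lambda>\<mu> vs. leibniz N (\<phi> \<mu>) f g vs)"
    proof (rule multilinear.intro)
      fix \<mu> \<mu>' vs
      assume *: "\<mu> \<in> carrier (Ops P n)" "\<mu>' \<in> carrier (Ops P n)" "length vs = n" "set vs \<subseteq> carrier V"
      have "(\<Oplus>\<^bsub>N\<^esub> i\<in>{..<length vs}. \<phi> (\<mu> \<oplus>\<^bsub>Ops P n\<^esub> \<mu>') (mark f g vs i)) =
          (\<Oplus>\<^bsub>N\<^esub> i\<in>{..<length vs}. \<phi> \<mu> (mark f g vs i) \<oplus>\<^bsub>N\<^esub> \<phi> \<mu>' (mark f g vs i))"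
        using * by (intro N.M.finsum_cong') (auto simp: cl multilinear.add_left[OF ml _ _ _ mc])
      also have "\<dots> = leibniz N (\<phi> \<mu>) f g vs \<oplus>\<^bsub>N\<^esub> leibniz N (\<phi> \<mu>') f g vs"
        unfolding leibniz_def using * by (intro N.M.finsum_addf) (auto intro: cl)
      finally show "leibniz N (\<phi> (\<mu> \<oplus>\<^bsub>Ops P n\<^esub> \<mu>')) f g vs =
          leibniz N (\<phi> \<mu>) f g vs \<oplus>\<^bsub>N\<^esub> leibniz N (\<phi> \<mu>') f g vs"
        by (simp add: leibniz_def)
    next
      fix r \<mu> vs
      assume *: "r \<in> carrier R" "\<mu> \<in> carrier (Ops P n)" "length vs = n" "set vs \<subseteq> carrier V"
      have "(\<Oplus>\<^bsub>N\<^esub> i\<in>{..<length vs}. \<phi> (r \<odot>\<^bsub>Ops P n\<^esub> \<mu>) (mark f g vs i)) =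
          (\<Oplus>\<^bsub>N\<^esub> i\<in>{..<length vs}. r \<odot>\<^bsub>N\<^esub> \<phi> \<mu> (mark f g vs i))"
        using * by (intro N.M.finsum_cong') (auto simp: cl multilinear.smult_left[OF ml _ _ _ mc])
      also have "\<dots> = r \<odot>\<^bsub>N\<^esub> leibniz N (\<phi> \<mu>) f g vs"
        unfolding leibniz_def using * by (intro N.finsum_smult_ldistr[symmetric]) (auto intro: cl)
      finally show "leibniz N (\<phi> (r \<odot>\<^bsub>Ops P n\<^esub> \<mu>)) f g vs = r \<odot>\<^bsub>N\<^esub> leibniz N (\<phi> \<mu>) f g vs"
        by (simp add: leibniz_def)
    next
      fix \<mu> us v w ws
      assume \<mu>: "\<mu> \<in> carrier (Ops P n)" and l: "length us + length ws + 1 = n"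
        and uw: "set us \<subseteq> carrier V" "set ws \<subseteq> carrier V" and v: "v \<in> carrier V" and w: "w \<in> carrier V"
      have c: "\<phi> \<mu> (mark f g (us @ x # ws) i) \<in> carrier N" if "x \<in> carrier V" for x i
        using l uw that by (intro cl[OF \<mu>]) auto
      have "\<phi> \<mu> (mark f g (us @ (v \<oplus>\<^bsub>V\<^esub> w) # ws) i) =
          \<phi> \<mu> (mark f g (us @ v # ws) i) \<oplus>\<^bsub>N\<^esub> \<phi> \<mu> (mark f g (us @ w # ws) i)" for i
        using multilinear.add_slot[OF ml \<mu>, of "mark f g us i" "B us ws i"] l mc[OF uw(1)] B(2)[OF uw(2)] v w
        by (cases "i = length us") (simp_all add: split B(1) linear_mapsD[OF f] linear_mapsD[OF g])
      then have "(\<Oplus>\<^bsub>N\<^esub> i\<in>{..<n}. \<phi> \<mu> (mark f g (us @ (v \<oplus>\<^bsub>V\<^esub> w) # ws) i)) =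
          (\<Oplus>\<^bsub>N\<^esub> i\<in>{..<n}. \<phi> \<mu> (mark f g (us @ v # ws) i) \<oplus>\<^bsub>N\<^esub> \<phi> \<mu> (mark f g (us @ w # ws) i))"
        by simp
      also have "\<dots> = (\<Oplus>\<^bsub>N\<^esub> i\<in>{..<n}. \<phi> \<mu> (mark f g (us @ v # ws) i)) \<oplus>\<^bsub>N\<^esub>
          (\<Oplus>\<^bsub>N\<^esub> i\<in>{..<n}. \<phi> \<mu> (mark f g (us @ w # ws) i))"
        using v w by (intro N.M.finsum_addf) (auto intro: c)
      finally show "leibniz N (\<phi> \<mu>) f g (us @ (v \<oplus>\<^bsub>V\<^esub> w) # ws) =
          leibniz N (\<phi> \<mu>) f g (us @ v # ws) \<oplus>\<^bsub>N\<^esub> leibniz N (\<phi> \<mu>) f g (us @ w # ws)"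
        using l by (simp add: leibniz_def)
    next
      fix r \<mu> us v ws
      assume r: "r \<in> carrier R" and \<mu>: "\<mu> \<in> carrier (Ops P n)" and l: "length us + length ws + 1 = n"
        and uw: "set us \<subseteq> carrier V" "set ws \<subseteq> carrier V" and v: "v \<in> carrier V"
      have c: "\<phi> \<mu> (mark f g (us @ x # ws) i) \<in> carrier N" if "x \<in> carrier V" for x i
        using l uw that by (intro cl[OF \<mu>]) auto
      have "\<phi> \<mu> (mark f g (us @ (r \<odot>\<^bsub>V\<^esub> v) # ws) i) = r \<odot>\<^bsub>N\<^esub> \<phi> \<mu> (mark f g (us @ v # ws) i)" for i
        using multilinear.smult_slot[OF ml r \<mu>, of "mark f g us i" "B us ws i"] l mc[OF uw(1)] B(2)[OF uw(2)] v r
        by (cases "i = length us") (simp_all add: split B(1) linear_mapsD[OF f] linear_mapsD[OF g])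
      then have "(\<Oplus>\<^bsub>N\<^esub> i\<in>{..<n}. \<phi> \<mu> (mark f g (us @ (r \<odot>\<^bsub>V\<^esub> v) # ws) i)) =
          (\<Oplus>\<^bsub>N\<^esub> i\<in>{..<n}. r \<odot>\<^bsub>N\<^esub> \<phi> \<mu> (mark f g (us @ v # ws) i))"
        by simp
      also have "\<dots> = r \<odot>\<^bsub>N\<^esub> (\<Oplus>\<^bsub>N\<^esub> i\<in>{..<n}. \<phi> \<mu> (mark f g (us @ v # ws) i))"
        using v r by (intro N.finsum_smult_ldistr[symmetric]) (auto intro: c)
      finally show "leibniz N (\<phi> \<mu>) f g (us @ (r \<odot>\<^bsub>V\<^esub> v) # ws) = r \<odot>\<^bsub>N\<^esub> leibniz N (\<phi> \<mu>) f g (us @ v # ws)"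
        using l by (simp add: leibniz_def)
    qed (rule lc)
  next
    fix n \<mu> vs \<sigma>
    assume *: "\<mu> \<in> carrier (Ops P n)" "length vs = n" "set vs \<subseteq> carrier V" "\<sigma> permutes {..<n}"
    have "\<phi> (act P n \<mu> \<sigma>) (mark f g (permute_list \<sigma> vs) i) = \<phi> \<mu> (mark f g vs (\<sigma> i))" for i
      using symmetric_family.sym[OF \<phi> *(1) _ mc[OF *(3)] *(4), of "\<sigma> i"] * by (simp add: mark_permute_list)
    then have "leibniz N (\<phi> (act P n \<mu> \<sigma>)) f g (permute_list \<sigma> vs) =
        (\<Oplus>\<^bsub>N\<^esub> i\<in>{..<n}. \<phi> \<mu> (mark f g vs (\<sigma> i)))"
      using * by (simp add: leibniz_def)
    \<comment> \<open>Permuting the arguments moves the mark from \<open>i\<close> to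
      \<open>\<sigma> i\<close>, a reindexing of the sum.\<close>
    also have "\<dots> = (\<Oplus>\<^bsub>N\<^esub> i\<in>\<sigma> ` {..<n}. \<phi> \<mu> (mark f g vs i))"
      using * by (intro N.M.finsum_reindex[symmetric] permutes_inj_on[OF *(4)]) (auto intro: cl)
    also have "\<sigma> ` {..<n} = {..<n}" by (rule permutes_image[OF *(4)])
    finally show "leibniz N (\<phi> (act P n \<mu> \<sigma>)) f g (permute_list \<sigma> vs) = leibniz N (\<phi> \<mu>) f g vs"
      using * by (simp add: leibniz_def)
  qed
qed

subsection \<open>The Kleisli extension\<close>

definition kext :: "('r, 'v) module \<Rightarrow> ('r, 'w) module \<Rightarrow> ('v \<Rightarrow> ('r, 'p, 'w) schur) \<Rightarrow>
    ('r, 'p, 'v) schur \<Rightarrow> ('r, 'p, 'w) schur" where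
  "kext V W f = Schur_lift R P V (S W) (\<lambda>\<mu> vs. app W \<mu> (map f vs))"

definition kder :: "('r, 'v) module \<Rightarrow> ('r, 'w) module \<Rightarrow> ('v \<Rightarrow> ('r, 'p, 'w) schur) \<Rightarrow>
    ('v \<Rightarrow> ('r, 'p, 'w) schur) \<Rightarrow> ('r, 'p, 'v) schur \<Rightarrow> ('r, 'p, 'w) schur" where
  "kder V W f g = Schur_lift R P V (S W) (\<lambda>\<mu> vs. leibniz (S W) (app W \<mu>) f g vs)"

context
  fixes V :: "('r, 'v) module" and W :: "('r, 'w) module" and f :: "'v \<Rightarrow> ('r, 'p, 'w) schur"
  assumes V: "module R V" and W: "module R W" and f: "f \<in> linear_maps R V (S W)"
begin

lemma kext_linear: "kext V W f \<in> linear_maps R (S V) (S W)"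
  unfolding kext_def
  by (rule Schur_lift_linear[OF V Schur_module[OF W] symmetric_family_map[OF app_symmetric_family[OF W] f]])

lemma kext_cls:
  "\<lbrakk>\<mu> \<in> carrier (Ops P (length vs)); set vs \<subseteq> carrier V\<rbrakk> \<Longrightarrow> kext V W f (cls R P V \<mu> vs) = app W \<mu> (map f vs)"
  unfolding kext_def
  by (rule Schur_lift_cls[OF V Schur_module[OF W] symmetric_family_map[OF app_symmetric_family[OF W] f]])

lemma kext_eta: "v \<in> carrier V \<Longrightarrow> kext V W f (eta V v) = f v"
  using kext_cls[of "ounit P" "[v]"] ounit_closed app_ounit[OF W] linear_mapsD(1)[OF f] by simp

lemma map_f_closed: "set vs \<subseteq> carrier V \<Longrightarrow> set (map f vs) \<subseteq> carrier (S W)"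
  using linear_mapsD(1)[OF f] by auto

lemma map_kext_closed: "set xs \<subseteq> carrier (S V) \<Longrightarrow> set (map (kext V W f) xs) \<subseteq> carrier (S W)"
  using linear_mapsD(1)[OF kext_linear] by auto

lemma map_kext_eta: "set vs \<subseteq> carrier V \<Longrightarrow> map (kext V W f) (map (eta V) vs) = map f vs"
  by (auto simp: kext_eta)

text \<open>The homomorphism property. Expanding a class in \<open>S V\<close> inserts
  \<open>\<nu>\<close> into \<open>\<mu>\<close>; in \<open>S W\<close> the same insertion is undone
  by \<open>app_assoc\<close>.\<close>

lemma kext_app:
  assumes "set xs \<subseteq> carrier (S V)" "\<mu> \<in> carrier (Ops P (length xs))"
  shows "kext V W f (app V \<mu> xs) = app W \<mu> (map (kext V W f) xs)"
  using V assms
proof (induction rule: app_induct)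
  case (eta \<mu> vs)
  then show ?case
    using map_kext_eta[OF eta(2)] by (simp add: app_map_eta[OF V] kext_cls del: map_map)
next
  case (add \<mu> xs x y ys)
  have ac: "app V \<mu> (xs @ z # ys) \<in> carrier (S V)" if "z \<in> carrier (S V)" for z
    using add.hyps that by (intro app_closed[OF V]) auto
  show ?case
    using add.IH add.hyps map_kext_closed[OF add.hyps(2)] map_kext_closed[OF add.hyps(3)]
    by (simp add: app_add_slot[OF V] app_add_slot[OF W] ac linear_mapsD[OF kext_linear])
next
  case (cls \<mu> xs \<nu> us ys)
  have "kext V W f (app V \<mu> (xs @ cls R P V \<nu> us # ys)) =
      app W (pcomp P (Suc (length xs + length ys)) (length us) (length xs) \<mu> \<nu>)
        (map (kext V W f) xs @ map f us @ map (kext V W f) ys)"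
    using cls.IH app_insert[OF V cls.hyps(1) refl cls.hyps(2-5)]
    by (simp only: map_append map_kext_eta[OF cls.hyps(5)])
  also have "\<dots> = app W \<mu> (map (kext V W f) xs @ app W \<nu> (map f us) # map (kext V W f) ys)"
  proof -
    have "app W (pcomp P (Suc (length xs + length ys)) (length (map f us)) (length (map (kext V W f) xs)) \<mu> \<nu>)
        (map (kext V W f) xs @ map f us @ map (kext V W f) ys) =
        app W \<mu> (map (kext V W f) xs @ app W \<nu> (map f us) # map (kext V W f) ys)"
      by (rule app_assoc[OF W map_f_closed[OF cls.hyps(5)] _ cls.hyps(1) _ map_kext_closed[OF cls.hyps(2)]
          map_kext_closed[OF cls.hyps(3)]]) (simp_all add: cls.hyps(4))
    then show ?thesis unfolding length_map .
  qed
  finally show ?case using cls.hyps by (simp add: kext_cls)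
qed

section \<open>Derivations along a Kleisli extension\<close>

context
  fixes g :: "'v \<Rightarrow> ('r, 'p, 'w) schur"
  assumes g: "g \<in> linear_maps R V (S W)"
begin

lemma kder_linear: "kder V W f g \<in> linear_maps R (S V) (S W)"
  unfolding kder_def
  by (rule Schur_lift_linear[OF V Schur_module[OF W]
        symmetric_family_leibniz[OF Schur_module[OF W] V app_symmetric_family[OF W] f g]])

lemma kder_cls:
  "\<lbrakk>\<mu> \<in> carrier (Ops P (length vs)); set vs \<subseteq> carrier V\<rbrakk> \<Longrightarrow>
    kder V W f g (cls R P V \<mu> vs) = leibniz (S W) (app W \<mu>) f g vs"
  unfolding kder_def
  by (rule Schur_lift_cls[OF V Schur_module[OF W]
        symmetric_family_leibniz[OF Schur_module[OF W] V app_symmetric_family[OF W] f g]])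

lemma kder_eta: "v \<in> carrier V \<Longrightarrow> kder V W f g (eta V v) = g v"
  using kder_cls[of "ounit P" "[v]"] ounit_closed app_ounit[OF W] linear_mapsD(1)[OF g]
    leibniz_single[OF Schur_module[OF W], of "app W (ounit P)" g v f] by simp

lemma leibniz_kext_kder_multilinear:
  "multilinear R (Ops P n) (S V) n (S W)
    (\<lambda>\<mu> xs. leibniz (S W) (app W \<mu>) (kext V W f) (kder V W f g) xs)"
  by (rule symmetric_family.multilinear[OF symmetric_family_leibniz[OF Schur_module[OF W] Schur_module[OF V]
        app_symmetric_family[OF W] kext_linear kder_linear]])

text \<open>The Leibniz rule for arbitrary arguments. When a class is expanded into units, the
  summands fall into those that hit \<open>xs\<close>, the units, or \<open>ys\<close>. By
  \<open>app_assoc\<close> the first and last kinds match the summands for the class itself, and the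
  middle ones add up to the single summand in which the derivation hits the class.\<close>

lemma kder_app:
  assumes "set xs \<subseteq> carrier (S V)" "\<mu> \<in> carrier (Ops P (length xs))"
  shows "kder V W f g (app V \<mu> xs) = leibniz (S W) (app W \<mu>) (kext V W f) (kder V W f g) xs"
  using V assms
proof (induction rule: app_induct)
  let ?S = "S W" and ?F = "kext V W f" and ?D = "kder V W f g"
  {
    case (eta \<mu> vs)
    have "mark ?F ?D (map (eta V) vs) i = mark f g vs i" for i
      unfolding mark_map using eta by (intro mark_cong) (auto simp: kext_eta kder_eta)
    then show ?case using eta by (simp add: app_map_eta[OF V] kder_cls leibniz_def)
  next
    case (add \<mu> xs x y ys)
    have ac: "app V \<mu> (xs @ z # ys) \<in> carrier (S V)" if "z \<in> carrier (S V)" for z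
      using add.hyps that by (intro app_closed[OF V]) auto
    show ?case
      using add.IH add.hyps multilinear.add_slot[OF leibniz_kext_kder_multilinear add.hyps(1), of xs ys x y]
      by (simp add: app_add_slot[OF V] ac linear_mapsD[OF kder_linear])
  next
    case (cls \<mu> xs \<nu> us ys)
    let ?k = "Suc (length xs + length ys)"
    let ?\<mu>\<nu> = "pcomp P ?k (length us) (length xs) \<mu> \<nu>" and ?us = "map (eta V) us" and ?c = "cls R P V \<nu> us"
    interpret S: module R ?S by (rule Schur_module[OF W])
    note hyps = cls.hyps
    have F: "set (map ?F zs) \<subseteq> carrier ?S" if "set zs \<subseteq> carrier (S V)" for zs
      by (rule map_kext_closed[OF that])
    have M: "set (mark ?F ?D zs i) \<subseteq> carrier ?S" if "set zs \<subseteq> carrier (S V)" for zs i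
      using that linear_mapsD(1)[OF kext_linear] linear_mapsD(1)[OF kder_linear] by (rule set_mark_subset)
    have us: "set ?us \<subseteq> carrier (S V)" by (rule map_eta_closed[OF V hyps(5)])
    have c: "?c \<in> carrier (S V)" using hyps by (intro cls_closed[OF V])
    have pc: "?\<mu>\<nu> \<in> carrier (Ops P (length (xs @ ?us @ ys)))"
      by (rule pcomp_closed[OF hyps(1,4)]) auto
    have assoc: "app W ?\<mu>\<nu> (as @ bs @ cs) = app W \<mu> (as @ app W \<nu> bs # cs)"
      if "length as = length xs" "length bs = length us" "length cs = length ys"
        "set as \<subseteq> carrier ?S" "set bs \<subseteq> carrier ?S" "set cs \<subseteq> carrier ?S" for as bs cs
    proof -
      have "app W (pcomp P ?k (length bs) (length as) \<mu> \<nu>) (as @ bs @ cs) = app W \<mu> (as @ app W \<nu> bs # cs)"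
        by (rule app_assoc[OF W that(5) _ hyps(1) _ that(4,6)]) (simp_all add: that(1-3) hyps(4))
      then show ?thesis by (simp only: that(1,2))
    qed
    have ac: "app W \<mu> as \<in> carrier ?S" if "length as = ?k" "set as \<subseteq> carrier ?S" for as
      using that hyps by (intro app_closed[OF W]) auto
    have ac': "app W \<nu> as \<in> carrier ?S" if "length as = length us" "set as \<subseteq> carrier ?S" for as
      using that hyps by (intro app_closed[OF W]) auto
    have ac'': "app W ?\<mu>\<nu> as \<in> carrier ?S" if "length as = length (xs @ ?us @ ys)" "set as \<subseteq> carrier ?S" for as
      using that pc by (intro app_closed[OF W]) auto
    have Fc: "?F ?c = app W \<nu> (map ?F ?us)"
      using kext_cls[OF hyps(4,5)] by (simp only: map_kext_eta[OF hyps(5)])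
    have Dc: "?D ?c = leibniz ?S (app W \<nu>) ?F ?D ?us"
    proof -
      have "mark ?F ?D ?us i = mark f g us i" for i
        unfolding mark_map using hyps(5) by (intro mark_cong) (auto simp: kext_eta kder_eta)
      then show ?thesis using hyps by (simp add: kder_cls leibniz_def)
    qed
    note clo = hyps(2,3) us c F M
    have subs: "set (xs @ ?us @ ys) \<subseteq> carrier (S V)" "set (?us @ ys) \<subseteq> carrier (S V)"
      "set (xs @ ?c # ys) \<subseteq> carrier (S V)" "set (?c # ys) \<subseteq> carrier (S V)" "set [?c] \<subseteq> carrier (S V)"
      using clo(1-4) by auto
    have 1: "leibniz ?S (\<lambda>l. app W ?\<mu>\<nu> (l @ map ?F (?us @ ys))) ?F ?D xs =
        leibniz ?S (\<lambda>l. app W \<mu> (l @ map ?F (?c # ys))) ?F ?D xs"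
    proof (rule leibniz_cong[OF Schur_module[OF W] _ _ refl])
      fix i
      show "app W ?\<mu>\<nu> (mark ?F ?D xs i @ map ?F (?us @ ys)) = app W \<mu> (mark ?F ?D xs i @ map ?F (?c # ys))"
        using assoc[of "mark ?F ?D xs i" "map ?F ?us" "map ?F ys"] M[OF hyps(2), of i] F[OF us] F[OF hyps(3)]
        by (simp add: Fc)
      show "app W \<mu> (mark ?F ?D xs i @ map ?F (?c # ys)) \<in> carrier ?S"
        using M[OF hyps(2), of i] F[OF subs(4)] by (intro ac) auto
    qed
    have 2: "leibniz ?S (\<lambda>l. app W ?\<mu>\<nu> (map ?F xs @ l @ map ?F ys)) ?F ?D ?us =
        app W \<mu> (map ?F xs @ ?D ?c # map ?F ys)"
    proof -
      \<comment> \<open>The operation \<open>\<mu>\<close> as a linear map of the slot of the class,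
        through which the inner Leibniz sum is taken out.\<close>
      let ?h = "\<lambda>x\<in>carrier ?S. app W \<mu> (map ?F xs @ x # map ?F ys)"
      have h: "?h \<in> linear_maps R ?S ?S"
        using F[OF hyps(2)] F[OF hyps(3)] hyps(1)
        by (intro restrict_linear_maps[OF Schur_module[OF W]] app_add_slot[OF W] app_smult_slot[OF W] ac) auto
      have "leibniz ?S (\<lambda>l. app W ?\<mu>\<nu> (map ?F xs @ l @ map ?F ys)) ?F ?D ?us =
          leibniz ?S (\<lambda>l. ?h (app W \<nu> l)) ?F ?D ?us"
      proof (rule leibniz_cong[OF Schur_module[OF W] _ _ refl])
        fix i
        have m: "app W \<nu> (mark ?F ?D ?us i) \<in> carrier ?S" using M[OF us, of i] by (intro ac') auto
        then show "?h (app W \<nu> (mark ?F ?D ?us i)) \<in> carrier ?S" by (rule linear_mapsD(1)[OF h])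
        show "app W ?\<mu>\<nu> (map ?F xs @ mark ?F ?D ?us i @ map ?F ys) = ?h (app W \<nu> (mark ?F ?D ?us i))"
          using assoc[of "map ?F xs" "mark ?F ?D ?us i" "map ?F ys"] M[OF us, of i] F[OF hyps(2)] F[OF hyps(3)] m
          by simp
      qed
      also have "\<dots> = ?h (leibniz ?S (app W \<nu>) ?F ?D ?us)"
        using M[OF us] by (intro linear_leibniz[OF Schur_module[OF W] h Schur_module[OF W], symmetric] ac') auto
      finally show ?thesis
        unfolding Dc[symmetric] using linear_mapsD(1)[OF kder_linear c] by simp
    qed
    have 3: "leibniz ?S (\<lambda>l. app W ?\<mu>\<nu> (map ?F xs @ map ?F ?us @ l)) ?F ?D ys =
        leibniz ?S (\<lambda>l. app W \<mu> (map ?F xs @ map ?F [?c] @ l)) ?F ?D ys"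
    proof (rule leibniz_cong[OF Schur_module[OF W] _ _ refl])
      fix i
      show "app W ?\<mu>\<nu> (map ?F xs @ map ?F ?us @ mark ?F ?D ys i) = app W \<mu> (map ?F xs @ map ?F [?c] @ mark ?F ?D ys i)"
        using assoc[of "map ?F xs" "map ?F ?us" "mark ?F ?D ys i"] M[OF hyps(3), of i] F[OF us] F[OF hyps(2)]
        by (simp add: Fc)
      show "app W \<mu> (map ?F xs @ map ?F [?c] @ mark ?F ?D ys i) \<in> carrier ?S"
        using M[OF hyps(3), of i] F[OF hyps(2)] F[OF subs(5)] by (intro ac) auto
    qed
    have "leibniz ?S (app W ?\<mu>\<nu>) ?F ?D (xs @ ?us @ ys) =
        leibniz ?S (\<lambda>l. app W ?\<mu>\<nu> (l @ map ?F (?us @ ys))) ?F ?D xs \<oplus>\<^bsub>?S\<^esub>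
        (leibniz ?S (\<lambda>l. app W ?\<mu>\<nu> (map ?F xs @ l @ map ?F ys)) ?F ?D ?us \<oplus>\<^bsub>?S\<^esub>
         leibniz ?S (\<lambda>l. app W ?\<mu>\<nu> (map ?F xs @ map ?F ?us @ l)) ?F ?D ys)"
      by (rule leibniz_append3[OF Schur_module[OF W]], rule ac''[OF length_mark M[OF subs(1)]])
    also have "\<dots> = leibniz ?S (\<lambda>l. app W \<mu> (l @ map ?F (?c # ys))) ?F ?D xs \<oplus>\<^bsub>?S\<^esub>
        (app W \<mu> (map ?F xs @ ?D ?c # map ?F ys) \<oplus>\<^bsub>?S\<^esub>
         leibniz ?S (\<lambda>l. app W \<mu> (map ?F xs @ map ?F [?c] @ l)) ?F ?D ys)"
      unfolding 1 2 3 ..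
    also have "app W \<mu> (map ?F xs @ ?D ?c # map ?F ys) =
        leibniz ?S (\<lambda>l. app W \<mu> (map ?F xs @ l @ map ?F ys)) ?F ?D [?c]"
    proof -
      have "app W \<mu> (map ?F xs @ ?D ?c # map ?F ys) \<in> carrier ?S"
        using F[OF hyps(2)] F[OF hyps(3)] linear_mapsD(1)[OF kder_linear c] by (intro ac) auto
      then show ?thesis
        using leibniz_single[OF Schur_module[OF W], of "\<lambda>l. app W \<mu> (map ?F xs @ l @ map ?F ys)" ?D ?c ?F] by simp
    qed
    also have "leibniz ?S (\<lambda>l. app W \<mu> (l @ map ?F (?c # ys))) ?F ?D xs \<oplus>\<^bsub>?S\<^esub>
        (leibniz ?S (\<lambda>l. app W \<mu> (map ?F xs @ l @ map ?F ys)) ?F ?D [?c] \<oplus>\<^bsub>?S\<^esub>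
         leibniz ?S (\<lambda>l. app W \<mu> (map ?F xs @ map ?F [?c] @ l)) ?F ?D ys) =
        leibniz ?S (app W \<mu>) ?F ?D (xs @ [?c] @ ys)"
    proof -
      have "app W \<mu> (mark ?F ?D (xs @ [?c] @ ys) i) \<in> carrier ?S" for i
        using M[OF subs(3), of i] by (intro ac) auto
      from leibniz_append3[OF Schur_module[OF W], of xs "[?c]" ys "app W \<mu>" ?F ?D, OF this]
      show ?thesis by (simp only: append_Cons append_Nil)
    qed
    finally have "leibniz ?S (app W ?\<mu>\<nu>) ?F ?D (xs @ ?us @ ys) = leibniz ?S (app W \<mu>) ?F ?D (xs @ ?c # ys)"
      by simp
    then show ?case
      using cls.IH app_insert[OF V hyps(1) refl hyps(2-5)] by simp
  }
qed

end

end

end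

section \<open>The monad structure\<close>

context operad
begin

lemma Schur_map_eq:
  "Schur_map R P V W f = Schur_lift R P V (S W) (\<lambda>\<mu> vs. cls R P W \<mu> (map f vs))"
  unfolding Schur_map_def Schur_lift_def ..

context
  fixes V :: "('r, 'v) module"
  assumes V: "module R V"
begin

interpretation S: module R "S V" by (rule Schur_module[OF V])

private abbreviation (input) "ok xs \<equiv> \<forall>(\<nu>, vs)\<in>set xs. \<nu> \<in> carrier (Ops P (length vs)) \<and> set vs \<subseteq> carrier V"
private abbreviation (input) "c \<equiv> \<lambda>(\<nu>, vs). cls R P V \<nu> vs"

lemma map_cls_closed: "ok xs \<Longrightarrow> set (map c xs) \<subseteq> carrier (S V)"
  using cls_closed[OF V] by auto

text \<open>\<open>papp\<close> and \<open>insert_from\<close> both proceed from left to right, so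
  the running arity and position coincide at every step. This identifies the action on classes with
  complete composition.\<close>

lemma papp_map_cls:
  assumes "\<mu> \<in> carrier (Ops P k)" "k = length vs + length xs" "set vs \<subseteq> carrier V" "ok xs"
  shows "papp V (map c xs) \<mu> vs =
    cls R P V (insert_from P k (length vs) \<mu> (map (\<lambda>(\<nu>, vs). (length vs, \<nu>)) xs)) (vs @ concat (map snd xs))"
  using assms
proof (induction xs arbitrary: k \<mu> vs)
  case Nil
  then show ?case by simp
next
  case (Cons x xs)
  obtain \<nu> us where x: "x = (\<nu>, us)" by (cases x)
  have ok: "ok xs" and \<nu>: "\<nu> \<in> carrier (Ops P (length us))" and us: "set us \<subseteq> carrier V"
    using Cons.prems x by auto
  have "papp V (map c (x # xs)) \<mu> vs = papp V (map c xs) (pcomp P k (length us) (length vs) \<mu> \<nu>) (vs @ us)"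
    using Cons.prems x \<nu> us map_cls_closed[OF ok] by (simp del: set_map papp.simps add: papp_Cons_cls[OF V, of \<mu> k])
  also have "\<dots> = cls R P V (insert_from P (k + length us - 1) (length (vs @ us)) (pcomp P k (length us) (length vs) \<mu> \<nu>)
      (map (\<lambda>(\<nu>, vs). (length vs, \<nu>)) xs)) ((vs @ us) @ concat (map snd xs))"
    using Cons.prems \<nu> us ok by (intro Cons.IH pcomp_closed[of _ k _ "length us"]) auto
  finally show ?case by (simp add: x)
qed

lemma app_map_cls:
  assumes "\<mu> \<in> carrier (Ops P (length xs))" "ok xs"
  shows "app V \<mu> (map c xs) =
    cls R P V (full_comp P \<mu> (map (\<lambda>(\<nu>, vs). (length vs, \<nu>)) xs)) (concat (map snd xs))"
  using papp_map_cls[of \<mu> "length xs" "[]" xs] assms by (simp add: app_def full_comp_def)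

text \<open>\<open>Schur_mult\<close> is prescribed only on classes whose entries are themselves
  classes. Uniqueness therefore requires passing to arbitrary entries, one at a time, by additivity
  in each slot.\<close>

lemma Schur_mult_eq: "Schur_mult R P V = Schur_lift R P (S V) (S V) (app V)"
proof -
  let ?S = "S V"
  let ?l = "Schur_lift R P ?S ?S (app V)"
  have l: "?l \<in> linear_maps R (S ?S) ?S"
    "\<And>\<mu> xs. \<lbrakk>\<mu> \<in> carrier (Ops P (length xs)); set xs \<subseteq> carrier ?S\<rbrakk> \<Longrightarrow> ?l (cls R P ?S \<mu> xs) = app V \<mu> xs"
    using Schur_lift_linear[OF S.module_axioms S.module_axioms app_symmetric_family[OF V]]
      Schur_lift_cls[OF S.module_axioms S.module_axioms app_symmetric_family[OF V]] by blast+
  show ?thesis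
    unfolding Schur_mult_def
  proof (rule the_equality, intro conjI allI impI l(1))
    fix \<mu> xs
    assume "\<mu> \<in> carrier (Ops P (length xs))" "ok xs"
    then show "?l (cls R P ?S \<mu> (map c xs)) =
        cls R P V (full_comp P \<mu> (map (\<lambda>(\<nu>, vs). (length vs, \<nu>)) xs)) (concat (map snd xs))"
      using map_cls_closed[of xs] by (simp del: set_map add: l(2) app_map_cls)
  next
    fix h
    assume "h \<in> linear_maps R (S ?S) ?S \<and>
      (\<forall>\<mu> xs. \<mu> \<in> carrier (Ops P (length xs)) \<longrightarrow> ok xs \<longrightarrow> h (cls R P ?S \<mu> (map c xs)) =
         cls R P V (full_comp P \<mu> (map (\<lambda>(\<nu>, vs). (length vs, \<nu>)) xs)) (concat (map snd xs)))"
    then have h: "h \<in> linear_maps R (S ?S) ?S"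
      and hc: "\<And>\<mu> xs. \<lbrakk>\<mu> \<in> carrier (Ops P (length xs)); ok xs\<rbrakk> \<Longrightarrow> h (cls R P ?S \<mu> (map c xs)) = app V \<mu> (map c xs)"
      using app_map_cls by auto
    \<comment> \<open>The entries from \<open>xs\<close> are classes, those in \<open>ys\<close> are
      arbitrary; the induction moves entries from \<open>ys\<close> to \<open>xs\<close>.\<close>
    have *: "h (cls R P ?S \<mu> (map c xs @ ys)) = app V \<mu> (map c xs @ ys)"
      if "set ys \<subseteq> carrier ?S" "\<mu> \<in> carrier (Ops P (length xs + length ys))" "ok xs" for \<mu> xs ys
      using that
    proof (induction ys arbitrary: xs)
      case Nil
      then show ?case using hc[of \<mu> xs] by simp
    next
      case (Cons y ys)
      then have y: "y \<in> carrier ?S" and ys: "set ys \<subseteq> carrier ?S"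
        and \<mu>: "\<mu> \<in> carrier (Ops P (Suc (length (map c xs) + length ys)))" by auto
      note xs = map_cls_closed[OF Cons.prems(3)]
      from V y show ?case
      proof (induction rule: Schur_induct)
        case (cls \<nu> us)
        then show ?case using Cons.IH[OF ys, of "xs @ [(\<nu>, us)]"] Cons.prems by simp
      next
        case (add x y)
        have "cls R P ?S \<mu> (map c xs @ (x \<oplus>\<^bsub>?S\<^esub> y) # ys) =
            cls R P ?S \<mu> (map c xs @ x # ys) \<oplus>\<^bsub>S ?S\<^esub> cls R P ?S \<mu> (map c xs @ y # ys)"
          by (rule multilinear.add_slot[OF symmetric_family.multilinear[OF cls_symmetric_family[OF S.module_axioms]] \<mu>])
            (use xs ys add in simp_all)
        moreover have "cls R P ?S \<mu> (map c xs @ z # ys) \<in> carrier (S ?S)" if "z \<in> carrier ?S" for z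
          using \<mu> xs ys that by (intro cls_closed[OF S.module_axioms]) auto
        moreover have "app V \<mu> (map c xs @ (x \<oplus>\<^bsub>?S\<^esub> y) # ys) =
            app V \<mu> (map c xs @ x # ys) \<oplus>\<^bsub>?S\<^esub> app V \<mu> (map c xs @ y # ys)"
          by (rule app_add_slot[OF V \<mu>]) (use xs ys add in simp_all)
        ultimately show ?case using add by (simp add: linear_mapsD(2)[OF h])
      qed
    qed
    show "h = ?l"
      by (rule Schur_linear_maps_eqI[OF S.module_axioms h l(1)]) (use *[of _ _ "[]"] in \<open>simp add: l(2)\<close>)
  qed
qed

end

text \<open>The composite \<gamma> \<circ> S(f) is the homomorphic extension of f, so Kleisli
  composition can be computed with \<open>kext\<close>.\<close>

lemma Schur_mult_map:
  assumes V: "module R V" and W: "module R W" and f: "f \<in> linear_maps R V (S W)"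
    and x: "x \<in> carrier (S V)"
  shows "Schur_mult R P W (Schur_map R P V (S W) f x) = kext V W f x"
proof -
  note S = Schur_module[OF W]
  note fam = symmetric_family_map[OF cls_symmetric_family[OF S] f]
  have m: "Schur_map R P V (S W) f \<in> linear_maps R (S V) (S (S W))"
    "\<And>\<mu> vs. \<lbrakk>\<mu> \<in> carrier (Ops P (length vs)); set vs \<subseteq> carrier V\<rbrakk> \<Longrightarrow>
      Schur_map R P V (S W) f (cls R P V \<mu> vs) = cls R P (S W) \<mu> (map f vs)"
    unfolding Schur_map_eq
    using Schur_lift_linear[OF V Schur_module[OF S] fam] Schur_lift_cls[OF V Schur_module[OF S] fam] by blast+
  have l: "Schur_mult R P W \<in> linear_maps R (S (S W)) (S W)"
    "\<And>\<mu> xs. \<lbrakk>\<mu> \<in> carrier (Ops P (length xs)); set xs \<subseteq> carrier (S W)\<rbrakk> \<Longrightarrow>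
      Schur_mult R P W (cls R P (S W) \<mu> xs) = app W \<mu> xs"
    unfolding Schur_mult_eq[OF W]
    using Schur_lift_linear[OF S S app_symmetric_family[OF W]] Schur_lift_cls[OF S S app_symmetric_family[OF W]] by blast+
  show ?thesis
    using V x
  proof (induction rule: Schur_induct)
    case (cls \<mu> vs)
    then show ?case
      using map_f_closed[OF V W f cls(2)] by (simp del: set_map add: m(2) l(2) kext_cls[OF V W f])
  next
    case (add x y)
    then show ?case
      using linear_mapsD(1)[OF m(1)]
      by (simp add: linear_mapsD(2)[OF m(1)] linear_mapsD(2)[OF l(1)] linear_mapsD(2)[OF kext_linear[OF V W f]])
  qed
qed

lemma kext_unit:
  assumes V: "module R V" and x: "x \<in> carrier (S V)"
  shows "kext V V (Schur_unit R P V) x = x"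
  using V x
proof (induction rule: Schur_induct)
  case (cls \<mu> vs)
  then have "map (Schur_unit R P V) vs = map (eta V) vs" by (auto simp: Schur_unit_def)
  then show ?case using cls by (simp add: kext_cls[OF V V linear_eta[OF V]] app_map_eta[OF V] del: map_eq_conv)
next
  case (add x y)
  then show ?case by (simp add: linear_mapsD(2)[OF kext_linear[OF V V linear_eta[OF V]]])
qed

text \<open>Associativity of Kleisli composition. It holds because \<open>kext V W f\<close> is a
  homomorphism, which is \<open>kext_app\<close>.\<close>

lemma kext_kext:
  assumes U: "module R U" and V: "module R V" and W: "module R W"
    and f: "f \<in> linear_maps R V (S W)" and g: "g \<in> linear_maps R U (S V)"
    and x: "x \<in> carrier (S U)"
  shows "kext V W f (kext U V g x) = kext U W (\<lambda>u\<in>carrier U. kext V W f (g u)) x"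
proof -
  define h where "h = (\<lambda>u\<in>carrier U. kext V W f (g u))"
  have fg: "h \<in> linear_maps R U (S W)"
    unfolding h_def by (rule linear_maps_compose[OF g kext_linear[OF V W f] U])
  have "kext V W f (kext U V g x) = kext U W h x"
    using U x
  proof (induction rule: Schur_induct)
    case (cls \<mu> vs)
    have "map (kext V W f) (map g vs) = map h vs"
      using cls by (auto simp: h_def)
    then show ?case
      using kext_app[OF V W f map_f_closed[OF U V g cls(2)], of \<mu>] cls(1)
      unfolding kext_cls[OF U V g cls] kext_cls[OF U W fg cls] by (simp only: length_map)
  next
    case (add x y)
    then show ?case
      using linear_mapsD(1)[OF kext_linear[OF U V g]]
      by (simp add: linear_mapsD(2)[OF kext_linear[OF U V g]] linear_mapsD(2)[OF kext_linear[OF V W f]]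
          linear_mapsD(2)[OF kext_linear[OF U W fg]])
  qed
  then show ?thesis unfolding h_def .
qed

end


section \<open>Products\<close>

context
  fixes pr :: "'u \<times> 'u \<Rightarrow> 'u"
  assumes pr: "inj pr"
begin

lemma inv_pr [simp]: "inv_into UNIV pr (pr x) = x"
  by (rule inv_f_f[OF pr])

text \<open>The module of pairs is a biproduct, so two linear maps into a module assemble to the sum
  of their values on the decoded components. With \<open>N\<close> a Schur module this is the
  pairing of the opposite category.\<close>

definition copair :: "('r, 'u) module \<Rightarrow> ('r, 'u) module \<Rightarrow> ('r, 'n) module \<Rightarrow> ('u \<Rightarrow> 'n) \<Rightarrow> ('u \<Rightarrow> 'n) \<Rightarrow> 'u \<Rightarrow> 'n" where
  "copair V W N f g = (\<lambda>p\<in>carrier (prod_module pr V W).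
     f (fst (inv_into UNIV pr p)) \<oplus>\<^bsub>N\<^esub> g (snd (inv_into UNIV pr p)))"

context
  fixes R :: "('r, 'c) ring_scheme" and V W :: "('r, 'u) module"
  assumes V: "module R V" and W: "module R W"
begin

interpretation V: module R V by (rule V)
interpretation W: module R W by (rule W)

lemma prod_carrier: "carrier (prod_module pr V W) = pr ` (carrier V \<times> carrier W)"
  by (simp add: prod_module_def)

lemma prod_simps:
  "pr (a, b) \<oplus>\<^bsub>prod_module pr V W\<^esub> pr (c, d) = pr (a \<oplus>\<^bsub>V\<^esub> c, b \<oplus>\<^bsub>W\<^esub> d)"
  "r \<odot>\<^bsub>prod_module pr V W\<^esub> pr (a, b) = pr (r \<odot>\<^bsub>V\<^esub> a, r \<odot>\<^bsub>W\<^esub> b)"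
  "\<zero>\<^bsub>prod_module pr V W\<^esub> = pr (\<zero>\<^bsub>V\<^esub>, \<zero>\<^bsub>W\<^esub>)"
  by (simp_all add: prod_module_def)

lemma prod_module: "module R (prod_module pr V W)"
proof (rule moduleI[OF V.is_cring])
  show "abelian_group (prod_module pr V W)"
  proof (rule abelian_groupI)
    show "\<exists>y\<in>carrier (prod_module pr V W). y \<oplus>\<^bsub>prod_module pr V W\<^esub> x = \<zero>\<^bsub>prod_module pr V W\<^esub>"
      if "x \<in> carrier (prod_module pr V W)" for x
    proof -
      obtain a b where x: "x = pr (a, b)" "a \<in> carrier V" "b \<in> carrier W"
        using \<open>x \<in> _\<close> by (auto simp: prod_carrier)
      show ?thesis
        by (rule bexI[of _ "pr (\<ominus>\<^bsub>V\<^esub> a, \<ominus>\<^bsub>W\<^esub> b)"])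
          (simp_all add: x prod_simps prod_carrier V.M.l_neg W.M.l_neg)
    qed
  qed (auto simp: prod_carrier prod_simps V.M.a_ac W.M.a_ac)
qed (auto simp: prod_carrier prod_simps V.smult_l_distr W.smult_l_distr V.smult_r_distr W.smult_r_distr
    V.smult_assoc1 W.smult_assoc1)

lemma prod_inl_linear: "(\<lambda>v\<in>carrier V. pr (v, \<zero>\<^bsub>W\<^esub>)) \<in> linear_maps R V (prod_module pr V W)"
  by (rule restrict_linear_maps[OF V]) (auto simp: prod_carrier prod_simps)

lemma prod_inr_linear: "(\<lambda>w\<in>carrier W. pr (\<zero>\<^bsub>V\<^esub>, w)) \<in> linear_maps R W (prod_module pr V W)"
  by (rule restrict_linear_maps[OF W]) (auto simp: prod_carrier prod_simps)

lemma copair_pr: "\<lbrakk>a \<in> carrier V; b \<in> carrier W\<rbrakk> \<Longrightarrow> copair V W N f g (pr (a, b)) = f a \<oplus>\<^bsub>N\<^esub> g b"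
  by (simp add: copair_def prod_carrier)

context
  fixes N :: "('r, 'n) module"
  assumes N: "module R N"
begin

interpretation N: module R N by (rule N)

lemma copair_linear:
  assumes f: "f \<in> linear_maps R V N" and g: "g \<in> linear_maps R W N"
  shows "copair V W N f g \<in> linear_maps R (prod_module pr V W) N"
  unfolding copair_def
  using linear_mapsD[OF f] linear_mapsD[OF g]
  by (intro restrict_linear_maps[OF prod_module])
    (auto simp: prod_carrier prod_simps N.M.a_ac N.smult_r_distr)

lemma copair_inl:
  assumes "f \<in> linear_maps R V N" "g \<in> linear_maps R W N" "a \<in> carrier V"
  shows "copair V W N f g (pr (a, \<zero>\<^bsub>W\<^esub>)) = f a"
  using assms(3) linear_mapsD(1)[OF assms(1)] linear_maps_zero[OF assms(2) W N] by (simp add: copair_pr)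

lemma copair_inr:
  assumes "f \<in> linear_maps R V N" "g \<in> linear_maps R W N" "b \<in> carrier W"
  shows "copair V W N f g (pr (\<zero>\<^bsub>V\<^esub>, b)) = g b"
  using assms(3) linear_mapsD(1)[OF assms(2)] linear_maps_zero[OF assms(1) V N] by (simp add: copair_pr)

lemma copair_unique:
  assumes h: "h \<in> linear_maps R (prod_module pr V W) N" and f: "f \<in> linear_maps R V N" and g: "g \<in> linear_maps R W N"
    and "\<And>a. a \<in> carrier V \<Longrightarrow> h (pr (a, \<zero>\<^bsub>W\<^esub>)) = f a" "\<And>b. b \<in> carrier W \<Longrightarrow> h (pr (\<zero>\<^bsub>V\<^esub>, b)) = g b"
  shows "h = copair V W N f g"
proof (rule linear_maps_eqI[OF h copair_linear[OF f g]])
  fix x assume "x \<in> carrier (prod_module pr V W)"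
  then obtain a b where x: "x = pr (a, b)" "a \<in> carrier V" "b \<in> carrier W" by (auto simp: prod_carrier)
  then have "x = pr (a, \<zero>\<^bsub>W\<^esub>) \<oplus>\<^bsub>prod_module pr V W\<^esub> pr (\<zero>\<^bsub>V\<^esub>, b)" by (simp add: prod_simps)
  also have "h \<dots> = f a \<oplus>\<^bsub>N\<^esub> g b"
    using x assms(4,5) by (subst linear_mapsD(2)[OF h]) (simp_all add: prod_carrier)
  finally show "h x = copair V W N f g x" using x by (simp add: copair_pr)
qed

end

end

end

section \<open>The differential category\<close>

lemma zero_module:
  assumes "cring R"
  shows "module R (zero_module :: ('r, 'u) module)"
  by (rule moduleI[OF assms abelian_groupI]) (auto simp: zero_module_def)

lemma linear_maps_zero_map:
  assumes "module R V" "module R N"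
  shows "(\<lambda>v\<in>carrier V. \<zero>\<^bsub>N\<^esub>) \<in> linear_maps R V N"
proof -
  interpret N: module R N by (rule assms(2))
  show ?thesis by (rule restrict_linear_maps[OF assms(1)]) simp_all
qed

lemma linear_maps_add:
  assumes "module R V" "module R N" and f: "f \<in> linear_maps R V N" and g: "g \<in> linear_maps R V N"
  shows "(\<lambda>v\<in>carrier V. f v \<oplus>\<^bsub>N\<^esub> g v) \<in> linear_maps R V N"
proof -
  interpret N: module R N by (rule assms(2))
  show ?thesis
    using linear_mapsD[OF f] linear_mapsD[OF g]
    by (intro restrict_linear_maps[OF assms(1)]) (simp_all add: N.M.a_ac N.smult_r_distr)
qed

lemma linear_maps_restrict_eqI:
  assumes "f \<in> linear_maps R M N" "\<And>x. x \<in> carrier M \<Longrightarrow> g x = f x"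
  shows "(\<lambda>x\<in>carrier M. g x) = f"
  using assms(2) linear_mapsD(4)[OF assms(1)] by (intro extensionalityI) auto

lemma linear_maps_comm_monoid:
  assumes V: "module R V" and N: "module R N"
  shows "comm_monoid \<lparr>carrier = linear_maps R V N, monoid.mult = \<lambda>f g. \<lambda>v\<in>carrier V. f v \<oplus>\<^bsub>N\<^esub> g v,
    one = \<lambda>v\<in>carrier V. \<zero>\<^bsub>N\<^esub>\<rparr>"
proof -
  interpret N: module R N by (rule N)
  show ?thesis
  proof (rule comm_monoidI, goal_cases)
    case (1 f g)
    then show ?case using linear_maps_add[OF V N] by simp
  next
    case 2
    then show ?case using linear_maps_zero_map[OF V N] by simp
  next
    case (3 f g h)
    then show ?case by (auto intro!: restrict_ext simp: N.M.a_assoc linear_mapsD(1))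
  next
    case (4 f)
    then show ?case by (auto intro!: linear_maps_restrict_eqI simp: linear_mapsD(1))
  next
    case (5 f g)
    then show ?case by (auto intro!: restrict_ext simp: N.M.a_comm linear_mapsD(1))
  qed
qed

text \<open>
  The arguments of a second derivative at \<open>\<langle>\<langle>g, h\<rangle>, \<langle>k, j\<rangle>\<rangle>\<close>: the two derivatives hit the inputs \<open>l\<close> and \<open>i\<close>.
\<close>

definition mark2 :: "('a \<Rightarrow> 'b) \<Rightarrow> ('a \<Rightarrow> 'b) \<Rightarrow> ('a \<Rightarrow> 'b) \<Rightarrow> ('a \<Rightarrow> 'b) \<Rightarrow> 'a list \<Rightarrow> nat \<Rightarrow> nat \<Rightarrow> 'b list" where
  "mark2 g h k j xs i l = map (\<lambda>q. if q = i then if q = l then j (xs ! q) else h (xs ! q)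
     else if q = l then k (xs ! q) else g (xs ! q)) [0..<length xs]"

text \<open>The position hit by both derivatives carries \<open>j\<close> on either side; a position
  hit by one of them only keeps its value when the roles of \<open>h\<close> and \<open>k\<close>
  are exchanged. This is the combinatorial content of CD.7.\<close>

lemma mark2_swap: "mark2 g h k j xs i l = mark2 g k h j xs l i"
  unfolding mark2_def by (rule map_cong) auto

lemma length_mark2 [simp]: "length (mark2 g h k j xs i l) = length xs"
  by (simp add: mark2_def)

context operad
begin

lemma Schur_unit_closed: "\<lbrakk>module R V; v \<in> carrier V\<rbrakk> \<Longrightarrow> Schur_unit R P V v \<in> carrier (S V)"
  by (rule linear_mapsD(1)[OF linear_eta])

lemma kext_Schur_unit:
  "\<lbrakk>module R V; module R W; f \<in> linear_maps R V (S W); v \<in> carrier V\<rbrakk> \<Longrightarrow>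
    kext V W f (Schur_unit R P V v) = f v"
  by (simp add: Schur_unit_def kext_eta)

section \<open>Additivity of a derivation in its values on units\<close>

context
  fixes V :: "('r, 'v) module" and W :: "('r, 'w) module"
  assumes V: "module R V" and W: "module R W"
begin

interpretation S: module R "S W" by (rule Schur_module[OF W])

lemma app_mark_closed:
  assumes "f \<in> linear_maps R V (S W)" "g \<in> linear_maps R V (S W)"
    "\<mu> \<in> carrier (Ops P (length vs))" "set vs \<subseteq> carrier V"
  shows "app W \<mu> (mark f g vs i) \<in> carrier (S W)"
  using assms(3) set_mark_subset[OF assms(4) linear_mapsD(1)[OF assms(1)] linear_mapsD(1)[OF assms(2)]]
  by (intro app_closed[OF W]) simp_all

text \<open>Each summand of the Leibniz sum contains the second map in exactly one slot, so
  additivity in that slot suffices.\<close>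

lemma kder_add:
  assumes g: "g \<in> linear_maps R V (S W)" and h: "h \<in> linear_maps R V (S W)"
    and k: "k \<in> linear_maps R V (S W)" and x: "x \<in> carrier (S V)"
  shows "kder V W g (\<lambda>v\<in>carrier V. h v \<oplus>\<^bsub>S W\<^esub> k v) x =
    kder V W g h x \<oplus>\<^bsub>S W\<^esub> kder V W g k x"
proof -
  define hk where "hk = (\<lambda>v\<in>carrier V. h v \<oplus>\<^bsub>S W\<^esub> k v)"
  have hk: "hk \<in> linear_maps R V (S W)"
    unfolding hk_def by (rule linear_maps_add[OF V S.module_axioms h k])
  have "kder V W g hk x = kder V W g h x \<oplus>\<^bsub>S W\<^esub> kder V W g k x"
    using V x
  proof (induction rule: Schur_induct)
    case (cls \<mu> vs)
    have eq: "app W \<mu> (mark g hk vs i) = app W \<mu> (mark g h vs i) \<oplus>\<^bsub>S W\<^esub> app W \<mu> (mark g k vs i)"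
      if i: "i < length vs" for i
    proof -
      have sub: "set (map g (take i vs)) \<subseteq> carrier (S W)" "set (map g (drop (Suc i) vs)) \<subseteq> carrier (S W)"
        using cls(2) set_take_subset[of i vs] set_drop_subset[of "Suc i" vs] linear_mapsD(1)[OF g] by auto
      have v: "vs ! i \<in> carrier V" using cls(2) i nth_mem by blast
      show ?thesis
        using app_add_slot[OF W cls(1), of "map g (take i vs)" "map g (drop (Suc i) vs)" "h (vs ! i)" "k (vs ! i)"]
          sub v i linear_mapsD(1)[OF h v] linear_mapsD(1)[OF k v]
        by (simp add: mark_split hk_def del: set_map)
    qed
    have "leibniz (S W) (app W \<mu>) g hk vs =
        (\<Oplus>\<^bsub>S W\<^esub> i\<in>{..<length vs}. app W \<mu> (mark g h vs i) \<oplus>\<^bsub>S W\<^esub> app W \<mu> (mark g k vs i))"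
      unfolding leibniz_def
      using app_mark_closed[OF g h cls] app_mark_closed[OF g k cls] eq by (intro S.M.finsum_cong') auto
    also have "\<dots> = leibniz (S W) (app W \<mu>) g h vs \<oplus>\<^bsub>S W\<^esub> leibniz (S W) (app W \<mu>) g k vs"
      unfolding leibniz_def
      using app_mark_closed[OF g h cls] app_mark_closed[OF g k cls] by (intro S.M.finsum_addf) auto
    finally show ?case
      using cls by (simp only: kder_cls[OF V W g hk] kder_cls[OF V W g h] kder_cls[OF V W g k])
  next
    case (add x y)
    then show ?case
      using linear_mapsD(1)[OF kder_linear[OF V W g h]] linear_mapsD(1)[OF kder_linear[OF V W g k]]
      by (simp add: linear_mapsD(2)[OF kder_linear[OF V W g h]] linear_mapsD(2)[OF kder_linear[OF V W g k]]
          linear_mapsD(2)[OF kder_linear[OF V W g hk]] S.M.a_ac)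
  qed
  then show ?thesis unfolding hk_def .
qed

lemma app_zero_slot:
  assumes "\<mu> \<in> carrier (Ops P (length xs))" "set xs \<subseteq> carrier (S W)" "\<zero>\<^bsub>S W\<^esub> \<in> set xs"
  shows "app W \<mu> xs = \<zero>\<^bsub>S W\<^esub>"
proof -
  obtain as bs where xs: "xs = as @ \<zero>\<^bsub>S W\<^esub> # bs"
    using assms(3) by (meson split_list)
  \<comment> \<open>Zero is written as a zero multiple, which slot linearity takes out.\<close>
  have "app W \<mu> (as @ (\<zero>\<^bsub>R\<^esub> \<odot>\<^bsub>S W\<^esub> \<zero>\<^bsub>S W\<^esub>) # bs) = \<zero>\<^bsub>R\<^esub> \<odot>\<^bsub>S W\<^esub> app W \<mu> xs"
    unfolding xs using assms xs by (intro app_smult_slot[OF W _ assms(1)]) auto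
  then show ?thesis using xs app_closed[OF W assms(1,2)] by simp
qed

lemma kder_zero:
  assumes g: "g \<in> linear_maps R V (S W)" and x: "x \<in> carrier (S V)"
  shows "kder V W g (\<lambda>v\<in>carrier V. \<zero>\<^bsub>S W\<^esub>) x = \<zero>\<^bsub>S W\<^esub>"
proof -
  define z where "z = (\<lambda>v\<in>carrier V. \<zero>\<^bsub>S W\<^esub>)"
  have z: "z \<in> linear_maps R V (S W)"
    unfolding z_def by (rule linear_maps_zero_map[OF V S.module_axioms])
  have "kder V W g z x = \<zero>\<^bsub>S W\<^esub>"
    using V x
  proof (induction rule: Schur_induct)
    case (cls \<mu> vs)
    have "app W \<mu> (mark g z vs i) = \<zero>\<^bsub>S W\<^esub>" if i: "i < length vs" for i
    proof (rule app_zero_slot)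
      have "vs ! i \<in> carrier V" using cls(2) i nth_mem by blast
      then show "\<zero>\<^bsub>S W\<^esub> \<in> set (mark g z vs i)"
        using i by (simp add: mark_split z_def)
      show "set (mark g z vs i) \<subseteq> carrier (S W)"
        by (rule set_mark_subset[OF cls(2) linear_mapsD(1)[OF g] linear_mapsD(1)[OF z]])
    qed (use cls in simp)
    then have "leibniz (S W) (app W \<mu>) g z vs = (\<Oplus>\<^bsub>S W\<^esub> i\<in>{..<length vs}. \<zero>\<^bsub>S W\<^esub>)"
      unfolding leibniz_def by (intro S.M.finsum_cong') auto
    then show ?case using cls by (simp add: kder_cls[OF V W g z])
  next
    case (add x y)
    then show ?case by (simp add: linear_mapsD(2)[OF kder_linear[OF V W g z]])
  qed
  then show ?thesis unfolding z_def .
qed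

end

section \<open>Composition, projections and pairings in the opposite Kleisli category\<close>

context
  fixes pr :: "'u \<times> 'u \<Rightarrow> 'u"
  assumes pr: "inj pr"
begin

private abbreviation (input) K :: "(('r, 'u) module, 'u \<Rightarrow> ('r, 'p, 'u) schur) cdc" where
  "K \<equiv> KLop R P pr"

private abbreviation (input) "prd \<equiv> prod_module pr"

text \<open>Composition, projections and the differential are kept out of this list: goals stay in
  categorical form until a rule such as \<open>KL_Comp_linear\<close> applies.\<close>

lemma KL_simps:
  "Obj K = {V. module R V}"
  "Hom K V W = linear_maps R W (S V)"
  "Id K = Schur_unit R P"
  "Term K = zero_module"
  "Prod K = prod_module pr"
  "Plus K V W f g = (\<lambda>w\<in>carrier W. f w \<oplus>\<^bsub>S V\<^esub> g w)"
  "Zero K V W = (\<lambda>w\<in>carrier W. \<zero>\<^bsub>S V\<^esub>)"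
  by (simp_all add: KLop_def Kleisli_def opposite_def cat.extend_def)

lemma KL_Fst: "Fst K V W = (\<lambda>v\<in>carrier V. Schur_unit R P (prd V W) (pr (v, \<zero>\<^bsub>W\<^esub>)))"
  and KL_Snd: "Snd K V W = (\<lambda>w\<in>carrier W. Schur_unit R P (prd V W) (pr (\<zero>\<^bsub>V\<^esub>, w)))"
  and KL_Diff: "Diff K V W f = (\<lambda>w\<in>carrier W. Schur_partial R P pr V (f w))"
  by (simp_all add: KLop_def Kleisli_def opposite_def cat.extend_def)

text \<open>By reversal of arrows, the map extended to a homomorphism is \<open>f\<close>, the first
  of the two to be composed. Of \<open>g\<close> only the values are constrained, because the
  projections \<open>nproj\<close> are handled through pointwise information.\<close>

lemma KL_Comp:
  assumes "module R X" "module R Y" "f \<in> linear_maps R Y (S X)"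
    "\<And>z. z \<in> carrier Z \<Longrightarrow> g z \<in> carrier (S Y)"
  shows "Comp K X Y Z g f = (\<lambda>z\<in>carrier Z. kext Y X f (g z))"
  using assms Schur_mult_map[OF assms(2,1,3)]
  by (simp add: KLop_def Kleisli_def opposite_def cat.extend_def cong: restrict_cong)

context
  fixes V W :: "('r, 'u) module"
  assumes V: "module R V" and W: "module R W"
begin

lemma Fst_linear: "Fst K V W \<in> linear_maps R V (S (prd V W))"
proof -
  have "Fst K V W = (\<lambda>v\<in>carrier V. Schur_unit R P (prd V W) ((\<lambda>v\<in>carrier V. pr (v, \<zero>\<^bsub>W\<^esub>)) v))"
    unfolding KL_Fst by (rule restrict_ext) simp
  then show ?thesis
    using linear_maps_compose[OF prod_inl_linear[OF pr V W] linear_eta[OF prod_module[OF pr V W]] V] by simp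
qed

lemma Snd_linear: "Snd K V W \<in> linear_maps R W (S (prd V W))"
proof -
  have "Snd K V W = (\<lambda>v\<in>carrier W. Schur_unit R P (prd V W) ((\<lambda>w\<in>carrier W. pr (\<zero>\<^bsub>V\<^esub>, w)) v))"
    unfolding KL_Snd by (rule restrict_ext) simp
  then show ?thesis
    using linear_maps_compose[OF prod_inr_linear[OF pr V W] linear_eta[OF prod_module[OF pr V W]] W] by simp
qed

lemma inl_closed: "v \<in> carrier V \<Longrightarrow> pr (v, \<zero>\<^bsub>W\<^esub>) \<in> carrier (prd V W)"
  and inr_closed: "w \<in> carrier W \<Longrightarrow> pr (\<zero>\<^bsub>V\<^esub>, w) \<in> carrier (prd V W)"
  using linear_mapsD(1)[OF prod_inl_linear[OF pr V W]] linear_mapsD(1)[OF prod_inr_linear[OF pr V W]] by auto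

lemma KL_Comp_Fst:
  assumes "module R X" "h \<in> linear_maps R (prd V W) (S X)"
  shows "Comp K X (prd V W) V (Fst K V W) h = (\<lambda>v\<in>carrier V. h (pr (v, \<zero>\<^bsub>W\<^esub>)))"
proof -
  note VW = prod_module[OF pr V W]
  have "Comp K X (prd V W) V (Fst K V W) h = (\<lambda>v\<in>carrier V. kext (prd V W) X h (Fst K V W v))"
    by (rule KL_Comp[OF assms(1) VW assms(2) linear_mapsD(1)[OF Fst_linear]])
  also have "\<dots> = (\<lambda>v\<in>carrier V. h (pr (v, \<zero>\<^bsub>W\<^esub>)))"
    by (rule restrict_ext) (simp add: KL_Fst Schur_unit_def inl_closed kext_eta[OF VW assms])
  finally show ?thesis .
qed

lemma KL_Comp_Snd:
  assumes "module R X" "h \<in> linear_maps R (prd V W) (S X)"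
  shows "Comp K X (prd V W) W (Snd K V W) h = (\<lambda>w\<in>carrier W. h (pr (\<zero>\<^bsub>V\<^esub>, w)))"
proof -
  note VW = prod_module[OF pr V W]
  have "Comp K X (prd V W) W (Snd K V W) h = (\<lambda>v\<in>carrier W. kext (prd V W) X h (Snd K V W v))"
    by (rule KL_Comp[OF assms(1) VW assms(2) linear_mapsD(1)[OF Snd_linear]])
  also have "\<dots> = (\<lambda>v\<in>carrier W. h (pr (\<zero>\<^bsub>V\<^esub>, v)))"
    by (rule restrict_ext) (simp add: KL_Snd Schur_unit_def inr_closed kext_eta[OF VW assms])
  finally show ?thesis .
qed

text \<open>As an equivalence it rewrites both the unique existence in the product axiom and the
  description in \<open>pairing\<close>.\<close>

lemma copair_universal:
  assumes X: "module R X" and f: "f \<in> linear_maps R V (S X)" and g: "g \<in> linear_maps R W (S X)"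
  shows "h \<in> linear_maps R (prd V W) (S X) \<and> Comp K X (prd V W) V (Fst K V W) h = f \<and>
      Comp K X (prd V W) W (Snd K V W) h = g \<longleftrightarrow> h = copair pr V W (S X) f g"
proof -
  note S = Schur_module[OF X]
  let ?c = "copair pr V W (S X) f g"
  have "Comp K X (prd V W) V (Fst K V W) ?c = f" "Comp K X (prd V W) W (Snd K V W) ?c = g"
    using copair_inl[OF pr V W S f g] copair_inr[OF pr V W S f g] linear_mapsD(4)[OF f] linear_mapsD(4)[OF g]
    by (auto simp: KL_Comp_Fst[OF X copair_linear[OF pr V W S f g]] KL_Comp_Snd[OF X copair_linear[OF pr V W S f g]]
        extensional_restrict cong: restrict_cong)
  moreover have "h = ?c" if h: "h \<in> linear_maps R (prd V W) (S X)"
    "Comp K X (prd V W) V (Fst K V W) h = f" "Comp K X (prd V W) W (Snd K V W) h = g"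
  proof (rule copair_unique[OF pr V W S h(1) f g])
    show "h (pr (a, \<zero>\<^bsub>W\<^esub>)) = f a" if "a \<in> carrier V" for a
      using that h(2) KL_Comp_Fst[OF X h(1)] by (metis restrict_apply')
    show "h (pr (\<zero>\<^bsub>V\<^esub>, b)) = g b" if "b \<in> carrier W" for b
      using that h(3) KL_Comp_Snd[OF X h(1)] by (metis restrict_apply')
  qed
  ultimately show ?thesis using copair_linear[OF pr V W S f g] by blast
qed

lemma KL_pairing:
  assumes "module R X" "f \<in> linear_maps R V (S X)" "g \<in> linear_maps R W (S X)"
  shows "pairing K X V W f g = copair pr V W (S X) f g"
  unfolding pairing_def KL_simps copair_universal[OF assms] by simp

end

section \<open>The map \<partial> and its composites with homomorphisms and derivations\<close>

context
  fixes V :: "('r, 'u) module"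
  assumes V: "module R V"
begin

private lemma VV: "module R (prd V V)"
  by (rule prod_module[OF pr V V])

text \<open>The projections turn the marked list of pairs into the list of units of these pairs, and
  an operation applied to units is the class by \<open>app_map_eta\<close>.\<close>

lemma Schur_partial_eq: "Schur_partial R P pr V = kder V (prd V V) (Fst K V V) (Snd K V V)"
proof -
  let ?S = "S (prd V V)"
  interpret S: module R ?S by (rule Schur_module[OF VV])
  interpret V: module R V by (rule V)
  have "Schur_partial R P pr V = Schur_lift R P V ?S
      (\<lambda>\<mu> vs. leibniz ?S (cls R P (prd V V) \<mu>) (\<lambda>v. pr (v, \<zero>\<^bsub>V\<^esub>)) (\<lambda>v. pr (\<zero>\<^bsub>V\<^esub>, v)) vs)"
    unfolding Schur_partial_def Schur_lift_def leibniz_def mark_def Let_def ..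
  also have "\<dots> = kder V (prd V V) (Fst K V V) (Snd K V V)"
    unfolding kder_def
  proof (rule Schur_lift_cong, rule leibniz_cong[OF S.module_axioms _ _ refl])
    fix \<mu> vs i
    assume \<mu>: "\<mu> \<in> carrier (Ops P (length vs))" and vs: "set vs \<subseteq> carrier V"
    let ?m = "mark (\<lambda>v. pr (v, \<zero>\<^bsub>V\<^esub>)) (\<lambda>v. pr (\<zero>\<^bsub>V\<^esub>, v)) vs i"
    have m: "set ?m \<subseteq> carrier (prd V V)"
      using vs inl_closed[OF V V] inr_closed[OF V V] by (rule set_mark_subset)
    have "mark (Fst K V V) (Snd K V V) vs i = map (eta (prd V V)) ?m"
      unfolding map_mark using vs inl_closed[OF V V] inr_closed[OF V V]
      by (intro mark_cong) (auto simp: KL_Fst KL_Snd Schur_unit_def)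
    then show "cls R P (prd V V) \<mu> ?m = app (prd V V) \<mu> (mark (Fst K V V) (Snd K V V) vs i)"
      using app_map_eta[OF VV, of \<mu> ?m] \<mu> m by simp
    show "app (prd V V) \<mu> (mark (Fst K V V) (Snd K V V) vs i) \<in> carrier ?S"
      by (rule app_mark_closed[OF V VV Fst_linear[OF V V] Snd_linear[OF V V] \<mu> vs])
  qed
  finally show ?thesis .
qed

lemma Schur_partial_linear: "Schur_partial R P pr V \<in> linear_maps R (S V) (S (prd V V))"
  unfolding Schur_partial_eq by (rule kder_linear[OF V VV Fst_linear[OF V V] Snd_linear[OF V V]])

lemma Schur_partial_unit: "v \<in> carrier V \<Longrightarrow> Schur_partial R P pr V (Schur_unit R P V v) = Snd K V V v"
  using kder_eta[OF V VV Fst_linear[OF V V] Snd_linear[OF V V]]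
  by (simp add: Schur_partial_eq Schur_unit_def)

text \<open>A homomorphism after a derivation is again a derivation, along the composite; the
  copairing sends the two projections to \<open>g\<close> and \<open>h\<close>.\<close>

lemma kext_partial:
  assumes X: "module R X" and g: "g \<in> linear_maps R V (S X)" and h: "h \<in> linear_maps R V (S X)"
    and s: "s \<in> carrier (S V)"
  shows "kext (prd V V) X (copair pr V V (S X) g h) (Schur_partial R P pr V s) = kder V X g h s"
proof -
  let ?c = "copair pr V V (S X) g h"
  note S = Schur_module[OF X]
  note c = copair_linear[OF pr V V S g h]
  note kl = kext_linear[OF VV X c]
  note F = Fst_linear[OF V V] and G = Snd_linear[OF V V]
  show ?thesis
    using V s
  proof (induction rule: Schur_induct)
    case (cls \<mu> vs)
    have "kext (prd V V) X ?c (Schur_partial R P pr V (cls R P V \<mu> vs)) =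
        leibniz (S X) (\<lambda>l. kext (prd V V) X ?c (app (prd V V) \<mu> l)) (Fst K V V) (Snd K V V) vs"
      unfolding Schur_partial_eq kder_cls[OF V VV F G cls]
      by (rule linear_leibniz[OF Schur_module[OF VV] kl S], rule app_mark_closed[OF V VV F G cls])
    also have "\<dots> = leibniz (S X) (app X \<mu>) g h vs"
    proof (rule leibniz_cong[OF S _ _ refl])
      fix i
      have "kext (prd V V) X ?c (Fst K V V v) = g v" "kext (prd V V) X ?c (Snd K V V v) = h v"
        if "v \<in> carrier V" for v
        using that copair_inl[OF pr V V S g h that] copair_inr[OF pr V V S g h that]
        by (simp_all add: KL_Fst KL_Snd Schur_unit_def inl_closed[OF V V] inr_closed[OF V V] kext_eta[OF VV X c])
      then have "map (kext (prd V V) X ?c) (mark (Fst K V V) (Snd K V V) vs i) = mark g h vs i"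
        unfolding map_mark using cls(2) by (intro mark_cong) auto
      moreover have "set (mark (Fst K V V) (Snd K V V) vs i) \<subseteq> carrier (S (prd V V))"
        by (rule set_mark_subset[OF cls(2) linear_mapsD(1)[OF F] linear_mapsD(1)[OF G]])
      ultimately show "kext (prd V V) X ?c (app (prd V V) \<mu> (mark (Fst K V V) (Snd K V V) vs i)) = app X \<mu> (mark g h vs i)"
        using cls(1) by (simp add: kext_app[OF VV X c])
      show "app X \<mu> (mark g h vs i) \<in> carrier (S X)"
        by (rule app_mark_closed[OF V X g h cls])
    qed
    also have "\<dots> = kder V X g h (cls R P V \<mu> vs)"
      by (rule kder_cls[OF V X g h cls, symmetric])
    finally show ?case .
  next
    case (add x y)
    then show ?case
      using linear_mapsD(1)[OF Schur_partial_linear]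
      by (simp add: linear_mapsD(2)[OF Schur_partial_linear] linear_mapsD(2)[OF kl] linear_mapsD(2)[OF kder_linear[OF V X g h]])
  qed
qed

text \<open>A derivation after a homomorphism: the rule \<open>kder_app\<close> for \<partial> is
  applied to the arguments \<open>map f vs\<close>. The two maps on the right are the components of
  the pairing in CD.5.\<close>

lemma partial_kext:
  assumes Y: "module R Y" and f: "f \<in> linear_maps R Y (S V)" and s: "s \<in> carrier (S Y)"
  shows "Schur_partial R P pr V (kext Y V f s) =
    kder Y (prd V V) (\<lambda>y\<in>carrier Y. kext V (prd V V) (Fst K V V) (f y)) (\<lambda>y\<in>carrier Y. Schur_partial R P pr V (f y)) s"
proof -
  note F = Fst_linear[OF V V] and G = Snd_linear[OF V V]
  define F' where "F' = (\<lambda>y\<in>carrier Y. kext V (prd V V) (Fst K V V) (f y))"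
  define D' where "D' = (\<lambda>y\<in>carrier Y. Schur_partial R P pr V (f y))"
  have F': "F' \<in> linear_maps R Y (S (prd V V))"
    unfolding F'_def by (rule linear_maps_compose[OF f kext_linear[OF V VV F] Y])
  have D': "D' \<in> linear_maps R Y (S (prd V V))"
    unfolding D'_def by (rule linear_maps_compose[OF f Schur_partial_linear Y])
  have "Schur_partial R P pr V (kext Y V f s) = kder Y (prd V V) F' D' s"
    using Y s
  proof (induction rule: Schur_induct)
    case (cls \<mu> vs)
    have "Schur_partial R P pr V (kext Y V f (cls R P Y \<mu> vs)) =
        leibniz (S (prd V V)) (app (prd V V) \<mu>) (kext V (prd V V) (Fst K V V)) (Schur_partial R P pr V) (map f vs)"
      using map_f_closed[OF Y V f cls(2)] cls(1)
      by (simp add: kext_cls[OF Y V f cls] Schur_partial_eq kder_app[OF V VV F G] del: set_map)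
    also have "\<dots> = leibniz (S (prd V V)) (app (prd V V) \<mu>) F' D' vs"
    proof -
      have "mark (kext V (prd V V) (Fst K V V)) (Schur_partial R P pr V) (map f vs) i = mark F' D' vs i" for i
        unfolding mark_map using cls(2) by (intro mark_cong) (auto simp: F'_def D'_def)
      then show ?thesis by (simp add: leibniz_def)
    qed
    finally show ?case by (simp only: kder_cls[OF Y VV F' D' cls])
  next
    case (add x y)
    then show ?case
      using linear_mapsD(1)[OF kext_linear[OF Y V f]]
      by (simp add: linear_mapsD(2)[OF Schur_partial_linear] linear_mapsD(2)[OF kext_linear[OF Y V f]]
          linear_mapsD(2)[OF kder_linear[OF Y VV F' D']])
  qed
  then show ?thesis unfolding F'_def D'_def .
qed

context
  fixes X :: "('r, 'u) module" and g h k j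
  assumes X: "module R X"
    and g: "g \<in> linear_maps R V (S X)" and h: "h \<in> linear_maps R V (S X)"
    and k: "k \<in> linear_maps R V (S X)" and j: "j \<in> linear_maps R V (S X)"
begin

lemma mark2_closed:
  assumes "set vs \<subseteq> carrier V"
  shows "set (mark2 g h k j vs i l) \<subseteq> carrier (S X)"
proof -
  have "vs ! q \<in> carrier V" if "q < length vs" for q
    using that assms nth_mem by blast
  then show ?thesis
    using linear_mapsD(1)[OF g] linear_mapsD(1)[OF h] linear_mapsD(1)[OF k] linear_mapsD(1)[OF j]
    by (auto simp: mark2_def)
qed

lemma app_mark2_closed:
  "\<lbrakk>\<mu> \<in> carrier (Ops P (length vs)); set vs \<subseteq> carrier V\<rbrakk> \<Longrightarrow>
    app X \<mu> (mark2 g h k j vs i l) \<in> carrier (S X)"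
  by (intro app_closed[OF X] mark2_closed) simp_all

text \<open>The index \<open>i\<close> comes from \<partial>, which puts a pair with zero first
  entry at \<open>i\<close> and pairs with zero second entry elsewhere. So the first copairing reads
  \<open>h\<close> at \<open>i\<close> and \<open>g\<close> elsewhere, and the second one, used at
  the position \<open>l\<close> of the outer derivation, reads \<open>j\<close> if
  \<open>l = i\<close> and \<open>k\<close> otherwise.\<close>

lemma second_derivative:
  assumes "\<mu> \<in> carrier (Ops P (length vs))" "set vs \<subseteq> carrier V"
  shows "kder (prd V V) X (copair pr V V (S X) g h) (copair pr V V (S X) k j)
      (Schur_partial R P pr V (cls R P V \<mu> vs)) =
    (\<Oplus>\<^bsub>S X\<^esub> i\<in>{..<length vs}. \<Oplus>\<^bsub>S X\<^esub> l\<in>{..<length vs}. app X \<mu> (mark2 g h k j vs i l))"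
proof -
  note S = Schur_module[OF X]
  interpret S: module R "S X" by (rule S)
  let ?G = "copair pr V V (S X) g h" and ?H = "copair pr V V (S X) k j"
  note G = copair_linear[OF pr V V S g h] and H = copair_linear[OF pr V V S k j]
  note kl = kder_linear[OF VV X G H]
  note F1 = Fst_linear[OF V V] and F2 = Snd_linear[OF V V]
  let ?m = "mark (\<lambda>v. pr (v, \<zero>\<^bsub>V\<^esub>)) (\<lambda>v. pr (\<zero>\<^bsub>V\<^esub>, v)) vs"
  have m: "set (?m i) \<subseteq> carrier (prd V V)" for i
    using assms(2) inl_closed[OF V V] inr_closed[OF V V] by (rule set_mark_subset)
  have mF: "mark (Fst K V V) (Snd K V V) vs i = map (eta (prd V V)) (?m i)" for i
    unfolding map_mark using assms(2) inl_closed[OF V V] inr_closed[OF V V]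
    by (intro mark_cong) (auto simp: KL_Fst KL_Snd Schur_unit_def)
  have mm: "mark ?G ?H (?m i) l = mark2 g h k j vs i l" for i l
  proof (rule nth_equalityI)
    fix q assume "q < length (mark ?G ?H (?m i) l)"
    then have q: "q < length vs" by simp
    then have "vs ! q \<in> carrier V" using assms(2) nth_mem by blast
    then show "mark ?G ?H (?m i) l ! q = mark2 g h k j vs i l ! q"
      using q copair_inl[OF pr V V S g h] copair_inr[OF pr V V S g h] copair_inl[OF pr V V S k j] copair_inr[OF pr V V S k j]
      by (auto simp: nth_mark mark2_def)
  qed simp
  have "kder (prd V V) X ?G ?H (Schur_partial R P pr V (cls R P V \<mu> vs)) =
      leibniz (S X) (\<lambda>l. kder (prd V V) X ?G ?H (app (prd V V) \<mu> l)) (Fst K V V) (Snd K V V) vs"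
    unfolding Schur_partial_eq kder_cls[OF V VV F1 F2 assms]
    by (rule linear_leibniz[OF Schur_module[OF VV] kl S], rule app_mark_closed[OF V VV F1 F2 assms])
  also have "\<dots> = (\<Oplus>\<^bsub>S X\<^esub> i\<in>{..<length vs}. kder (prd V V) X ?G ?H (cls R P (prd V V) \<mu> (?m i)))"
    unfolding leibniz_def mF using m assms(1) by (simp add: app_map_eta[OF VV])
  also have "\<dots> = (\<Oplus>\<^bsub>S X\<^esub> i\<in>{..<length vs}. \<Oplus>\<^bsub>S X\<^esub> l\<in>{..<length vs}. app X \<mu> (mark2 g h k j vs i l))"
    using m assms(1) by (simp add: kder_cls[OF VV X G H] leibniz_def mm)
  finally show ?thesis .
qed

end

lemma second_derivative_swap:
  fixes X :: "('r, 'u) module"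
  assumes X: "module R X"
    and g: "g \<in> linear_maps R V (S X)" and h: "h \<in> linear_maps R V (S X)"
    and k: "k \<in> linear_maps R V (S X)" and j: "j \<in> linear_maps R V (S X)"
    and s: "s \<in> carrier (S V)"
  shows "kder (prd V V) X (copair pr V V (S X) g h) (copair pr V V (S X) k j) (Schur_partial R P pr V s) =
    kder (prd V V) X (copair pr V V (S X) g k) (copair pr V V (S X) h j) (Schur_partial R P pr V s)"
proof -
  note S = Schur_module[OF X]
  note c = copair_linear[OF pr V V S]
  show ?thesis
    using V s
  proof (induction rule: Schur_induct)
    case (cls \<mu> vs)
    show ?case
      unfolding second_derivative[OF X g h k j cls] second_derivative[OF X g k h j cls]
      by (subst finsum_swap[OF S finite_lessThan finite_lessThan app_mark2_closed[OF X g h k j cls]])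
        (subst mark2_swap, rule refl)
  next
    case (add x y)
    then show ?case
      using linear_mapsD(1)[OF Schur_partial_linear]
      by (simp add: linear_mapsD(2)[OF Schur_partial_linear]
          linear_mapsD(2)[OF kder_linear[OF VV X c[OF g h] c[OF k j]]]
          linear_mapsD(2)[OF kder_linear[OF VV X c[OF g k] c[OF h j]]])
  qed
qed

text \<open>With zero for both middle maps, every summand off the diagonal has a zero argument at
  \<open>l\<close>, and the diagonal ones are the summands of the first derivative.\<close>

lemma second_derivative_linear:
  fixes X :: "('r, 'u) module"
  assumes X: "module R X" and g: "g \<in> linear_maps R V (S X)" and h: "h \<in> linear_maps R V (S X)"
    and z: "z = (\<lambda>v\<in>carrier V. \<zero>\<^bsub>S X\<^esub>)" and s: "s \<in> carrier (S V)"
  shows "kder (prd V V) X (copair pr V V (S X) g z) (copair pr V V (S X) z h) (Schur_partial R P pr V s) =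
    kder V X g h s"
proof -
  note S = Schur_module[OF X]
  interpret S: module R "S X" by (rule S)
  note c = copair_linear[OF pr V V S]
  have z': "z \<in> linear_maps R V (S X)"
    unfolding z by (rule linear_maps_zero_map[OF V S])
  show ?thesis
    using V s
  proof (induction rule: Schur_induct)
    case (cls \<mu> vs)
    have vs: "vs ! q \<in> carrier V" if "q < length vs" for q
      using that cls(2) nth_mem by blast
    have off: "app X \<mu> (mark2 g z z h vs i l) = \<zero>\<^bsub>S X\<^esub>" if "i \<noteq> l" "l < length vs" for i l
    proof (rule app_zero_slot[OF V X _ mark2_closed[OF X g z' z' h cls(2)]])
      have "z (vs ! l) = \<zero>\<^bsub>S X\<^esub>" using vs[OF that(2)] by (simp add: z)
      then show "\<zero>\<^bsub>S X\<^esub> \<in> set (mark2 g z z h vs i l)"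
        using that by (auto simp: mark2_def image_iff intro!: bexI[of _ l])
    qed (use cls in simp)
    have diag: "app X \<mu> (mark2 g z z h vs i i) = app X \<mu> (mark g h vs i)" for i
      unfolding mark2_def mark_def by (intro arg_cong[where f = "app X \<mu>"] map_cong) auto
    have "(\<Oplus>\<^bsub>S X\<^esub> l\<in>{..<length vs}. app X \<mu> (mark2 g z z h vs i l)) = app X \<mu> (mark g h vs i)"
      if i: "i < length vs" for i
    proof -
      have "(\<Oplus>\<^bsub>S X\<^esub> l\<in>{..<length vs}. app X \<mu> (mark2 g z z h vs i l)) =
          (\<Oplus>\<^bsub>S X\<^esub> l\<in>{..<length vs}. if i = l then app X \<mu> (mark g h vs l) else \<zero>\<^bsub>S X\<^esub>)"
        using app_mark_closed[OF V X g h cls] by (intro S.M.finsum_cong') (auto simp: off diag)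
      also have "\<dots> = app X \<mu> (mark g h vs i)"
        using i app_mark_closed[OF V X g h cls] by (intro S.M.finsum_singleton) auto
      finally show ?thesis .
    qed
    then have "(\<Oplus>\<^bsub>S X\<^esub> i\<in>{..<length vs}. \<Oplus>\<^bsub>S X\<^esub> l\<in>{..<length vs}. app X \<mu> (mark2 g z z h vs i l)) =
        leibniz (S X) (app X \<mu>) g h vs"
      unfolding leibniz_def using app_mark_closed[OF V X g h cls] by (intro S.M.finsum_cong') auto
    then show ?case
      unfolding second_derivative[OF X g z' z' h cls] kder_cls[OF V X g h cls] .
  next
    case (add x y)
    then show ?case
      using linear_mapsD(1)[OF Schur_partial_linear]
      by (simp add: linear_mapsD(2)[OF Schur_partial_linear]
          linear_mapsD(2)[OF kder_linear[OF VV X c[OF g z'] c[OF z' h]]]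
          linear_mapsD(2)[OF kder_linear[OF V X g h]])
  qed
qed

end

section \<open>The category, its finite products and its projections\<close>

lemma KL_Comp_linear:
  assumes "module R X" "module R Y" "module R Z" "f \<in> linear_maps R Y (S X)" "g \<in> linear_maps R Z (S Y)"
  shows "Comp K X Y Z g f = (\<lambda>z\<in>carrier Z. kext Y X f (g z))"
    and "Comp K X Y Z g f \<in> linear_maps R Z (S X)"
proof -
  show "Comp K X Y Z g f = (\<lambda>z\<in>carrier Z. kext Y X f (g z))"
    by (rule KL_Comp[OF assms(1,2,4) linear_mapsD(1)[OF assms(5)]])
  then show "Comp K X Y Z g f \<in> linear_maps R Z (S X)"
    using linear_maps_compose[OF assms(5) kext_linear[OF assms(2,1,4)] assms(3)] by simp
qed

lemma KL_Diff_linear: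
  assumes "module R V" "module R W" "f \<in> linear_maps R W (S V)"
  shows "Diff K V W f \<in> linear_maps R W (S (prd V V))"
  unfolding KL_Diff by (rule linear_maps_compose[OF assms(3) Schur_partial_linear[OF assms(1)] assms(2)])

text \<open>Cases 3 and 4 are the identity laws: \<open>kext\<close> extends a map from units, and
  the extension of the unit map is the identity. Case 5 is associativity, from
  \<open>kext_kext\<close>.\<close>

lemma KL_category: "category K"
proof (unfold_locales, unfold KL_simps mem_Collect_eq, goal_cases)
  case (1 X)
  then show ?case by (rule linear_eta)
next
  case (2 X Y Z f g)
  then show ?case by (rule KL_Comp_linear(2))
next
  case (3 X Y f)
  then show ?case
    by (simp add: KL_Comp_linear(1) linear_eta kext_Schur_unit linear_maps_restrict_eqI)
next
  case (4 X Y f)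
  then show ?case
    by (simp add: KL_Comp_linear(1) linear_eta kext_unit linear_mapsD(1) linear_maps_restrict_eqI)
next
  case (5 W X Y Z f g h)
  have gf: "Comp K W X Y g f \<in> linear_maps R Y (S W)" and hg: "Comp K X Y Z h g \<in> linear_maps R Z (S X)"
    using 5 by (auto intro: KL_Comp_linear(2))
  show ?case
    unfolding KL_Comp_linear(1)[OF 5(1,3,4) gf 5(7)] KL_Comp_linear(1)[OF 5(1,2,4,5) hg]
  proof (rule restrict_ext)
    fix z assume z: "z \<in> carrier Z"
    show "kext Y W (Comp K W X Y g f) (h z) = kext X W f (Comp K X Y Z h g z)"
      unfolding KL_Comp_linear(1)[OF 5(1,2,3,5,6)] KL_Comp_linear(1)[OF 5(2,3,4,6,7)]
      using z linear_mapsD(1)[OF 5(7)] by (simp only: restrict_apply' kext_kext[OF 5(3,2,1,5,6)])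
  qed
qed

lemma KL_finite_products: "finite_products K"
proof -
  interpret category K by (rule KL_category)
  show ?thesis
  proof (unfold_locales, unfold KL_simps mem_Collect_eq, goal_cases)
    case 1
    then show ?case by (rule zero_module[OF cring])
  next
    case (2 X)
    have z: "module R (zero_module :: ('r, 'u) module)" by (rule zero_module[OF cring])
    note S = Schur_module[OF 2]
    show ?case
    proof (rule ex1I[of _ "\<lambda>v\<in>carrier (zero_module :: ('r, 'u) module). \<zero>\<^bsub>S X\<^esub>"])
      show "(\<lambda>v\<in>carrier (zero_module :: ('r, 'u) module). \<zero>\<^bsub>S X\<^esub>) \<in> linear_maps R (zero_module :: ('r, 'u) module) (S X)"
        by (rule linear_maps_zero_map[OF z S])
      fix f assume f: "f \<in> linear_maps R (zero_module :: ('r, 'u) module) (S X)"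
      have "f \<zero>\<^bsub>(zero_module :: ('r, 'u) module)\<^esub> = \<zero>\<^bsub>S X\<^esub>"
        by (rule linear_maps_zero[OF f z S])
      then show "f = (\<lambda>v\<in>carrier (zero_module :: ('r, 'u) module). \<zero>\<^bsub>S X\<^esub>)"
        by (intro linear_maps_restrict_eqI[OF f, symmetric]) (simp add: zero_module_def)
    qed
  next
    case (3 A B)
    then show ?case by (rule prod_module[OF pr])
  next
    case (4 A B)
    then show ?case by (rule Fst_linear)
  next
    case (5 A B)
    then show ?case by (rule Snd_linear)
  next
    case (6 X A B f g)
    then show ?case using copair_universal[OF 6(2,3,1,4,5)] by simp
  qed
qed

lemma nprod_module: "set As \<subseteq> {V. module R V} \<Longrightarrow> module R (nprod K As)"
  by (induction As rule: induct_list012) (simp_all add: KL_simps zero_module[OF cring] prod_module[OF pr])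

text \<open>A projection sends \<open>a\<close> to the unit of the tuple with \<open>a\<close> in
  its own factor and zeros elsewhere. Knowing that it is a unit is enough: composition with a map of
  units is evaluation, by \<open>KL_Comp_unit\<close>.\<close>

lemma nproj_unit:
  assumes "set As \<subseteq> {V. module R V}" "j < length As"
  shows "nproj K As j \<in> extensional (carrier (As ! j)) \<and>
    (\<forall>a\<in>carrier (As ! j). \<exists>p\<in>carrier (nprod K As). nproj K As j a = Schur_unit R P (nprod K As) p)"
  using assms
proof (induction As arbitrary: j rule: induct_list012)
  case 1
  then show ?case by simp
next
  case (2 A)
  then show ?case by (auto simp: KL_simps Schur_unit_def extensional_def)
next
  case (3 A B As)
  let ?N = "nprod K (B # As)"
  have m: "module R A" "module R ?N" and sub: "set (B # As) \<subseteq> {V. module R V}"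
    using 3(3) nprod_module[of "B # As"] by auto
  note M = prod_module[OF pr m]
  show ?case
  proof (cases j)
    case 0
    then show ?thesis using inl_closed[OF m] by (auto simp: KL_Fst KL_simps extensional_def)
  next
    case (Suc i)
    then have i: "i < length (B # As)" using 3(4) by simp
    note IH = 3(2)[OF sub i]
    have eq: "nproj K (A # B # As) (Suc i) =
        (\<lambda>a\<in>carrier ((B # As) ! i). kext ?N (prd A ?N) (Snd K A ?N) (nproj K (B # As) i a))"
      unfolding nproj.simps nprod.simps KL_simps
      by (rule KL_Comp[OF M m(2) Snd_linear[OF m]]) (use IH Schur_unit_closed[OF m(2)] in auto)
    show ?thesis
      unfolding Suc eq nth_Cons_Suc
    proof (intro conjI ballI)
      fix a assume a: "a \<in> carrier ((B # As) ! i)"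
      with IH obtain p where p: "p \<in> carrier ?N" "nproj K (B # As) i a = Schur_unit R P ?N p" by blast
      have "kext ?N (prd A ?N) (Snd K A ?N) (nproj K (B # As) i a) = Schur_unit R P (prd A ?N) (pr (\<zero>\<^bsub>A\<^esub>, p))"
        unfolding p(2) kext_Schur_unit[OF m(2) M Snd_linear[OF m] p(1)] using p by (simp add: KL_Snd)
      then show "\<exists>p\<in>carrier (nprod K (A # B # As)).
          (\<lambda>a\<in>carrier ((B # As) ! i). kext ?N (prd A ?N) (Snd K A ?N) (nproj K (B # As) i a)) a =
          Schur_unit R P (nprod K (A # B # As)) p"
        using a inr_closed[OF m p(1)] by (intro bexI[of _ "pr (\<zero>\<^bsub>A\<^esub>, p)"]) (simp_all add: KL_simps)
    qed (rule restrict_extensional)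
  qed
qed

lemma nproj_obtain:
  assumes "set As \<subseteq> {V. module R V}" "j < length As"
  obtains q where "\<And>a. a \<in> carrier (As ! j) \<Longrightarrow> q a \<in> carrier (nprod K As)"
    and "nproj K As j = (\<lambda>a\<in>carrier (As ! j). Schur_unit R P (nprod K As) (q a))"
proof -
  obtain q where q: "\<And>a. a \<in> carrier (As ! j) \<Longrightarrow> q a \<in> carrier (nprod K As) \<and> nproj K As j a = Schur_unit R P (nprod K As) (q a)"
    using nproj_unit[OF assms] by metis
  have "nproj K As j = (\<lambda>a\<in>carrier (As ! j). Schur_unit R P (nprod K As) (q a))"
    using nproj_unit[OF assms] q by (intro extensionalityI[of _ "carrier (As ! j)"]) auto
  with q show thesis using that by blast
qed

lemma KL_Comp_unit:
  assumes X: "module R X" and Y: "module R Y" and f: "f \<in> linear_maps R Y (S X)"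
    and q: "\<And>z. z \<in> carrier Z \<Longrightarrow> q z \<in> carrier Y"
  shows "Comp K X Y Z (\<lambda>z\<in>carrier Z. Schur_unit R P Y (q z)) f = (\<lambda>z\<in>carrier Z. f (q z))"
proof -
  have "Comp K X Y Z (\<lambda>z\<in>carrier Z. Schur_unit R P Y (q z)) f =
      (\<lambda>z\<in>carrier Z. kext Y X f ((\<lambda>z\<in>carrier Z. Schur_unit R P Y (q z)) z))"
    using q by (intro KL_Comp[OF X Y f]) (simp add: Schur_unit_closed[OF Y])
  also have "\<dots> = (\<lambda>z\<in>carrier Z. f (q z))"
    using q by (intro restrict_ext) (simp add: kext_Schur_unit[OF Y X f])
  finally show ?thesis .
qed

text \<open>Left additivity is linearity of the extension \<open>kext Y X h\<close>. Compatibility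
  of projections with sums holds because composing with a projection is evaluation at points, and
  sums are pointwise.\<close>

lemma KL_left_additive: "cartesian_left_additive_category K"
proof (rule cartesian_left_additive_category.intro[OF KL_finite_products])
  show "cartesian_left_additive_category_axioms K"
  proof (rule cartesian_left_additive_category_axioms.intro, unfold KL_simps mem_Collect_eq, goal_cases)
    case (1 X Y)
    then show ?case by (intro linear_maps_comm_monoid Schur_module)
  next
    case (2 X Y Z f g h)
    note S = Schur_module[OF 2(2)]
    define fg where "fg = (\<lambda>w\<in>carrier Z. f w \<oplus>\<^bsub>S Y\<^esub> g w)"
    have fg: "fg \<in> linear_maps R Z (S Y)"
      unfolding fg_def by (rule linear_maps_add[OF 2(3) S 2(5,6)])
    show ?case
      unfolding fg_def[symmetric] KL_Comp_linear(1)[OF 2(1-4) fg] KL_Comp_linear(1)[OF 2(1-4) 2(5)]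
        KL_Comp_linear(1)[OF 2(1-4) 2(6)]
      by (rule restrict_ext)
        (simp add: fg_def linear_mapsD(2)[OF kext_linear[OF 2(2,1,4)]] linear_mapsD(1)[OF 2(5)] linear_mapsD(1)[OF 2(6)])
  next
    case (3 X Y Z h)
    note S = Schur_module[OF 3(2)] Schur_module[OF 3(1)]
    show ?case
      unfolding KL_Comp_linear(1)[OF 3(1-4) linear_maps_zero_map[OF 3(3) S(1)]]
      by (rule restrict_ext) (simp add: linear_maps_zero[OF kext_linear[OF 3(2,1,4)] S])
  next
    case (4 X As j f g)
    note N = nprod_module[OF 4(2)]
    obtain q where q: "\<And>a. a \<in> carrier (As ! j) \<Longrightarrow> q a \<in> carrier (nprod K As)"
      "nproj K As j = (\<lambda>a\<in>carrier (As ! j). Schur_unit R P (nprod K As) (q a))"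
      using nproj_obtain[OF 4(2,3)] by blast
    have Comp: "Comp K X (nprod K As) (As ! j) (nproj K As j) h = (\<lambda>a\<in>carrier (As ! j). h (q a))"
      if "h \<in> linear_maps R (nprod K As) (S X)" for h
      unfolding q(2) by (rule KL_Comp_unit[OF 4(1) N that q(1)])
    define fg where "fg = (\<lambda>w\<in>carrier (nprod K As). f w \<oplus>\<^bsub>S X\<^esub> g w)"
    have fg: "fg \<in> linear_maps R (nprod K As) (S X)"
      unfolding fg_def by (rule linear_maps_add[OF N Schur_module[OF 4(1)] 4(4,5)])
    show ?case
      unfolding fg_def[symmetric] Comp[OF fg] Comp[OF 4(4)] Comp[OF 4(5)]
      by (rule restrict_ext) (simp add: q(1) fg_def)
  next
    case (5 X As j)
    note N = nprod_module[OF 5(2)]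
    obtain q where q: "\<And>a. a \<in> carrier (As ! j) \<Longrightarrow> q a \<in> carrier (nprod K As)"
      "nproj K As j = (\<lambda>a\<in>carrier (As ! j). Schur_unit R P (nprod K As) (q a))"
      using nproj_obtain[OF 5(2,3)] by blast
    have Comp: "Comp K X (nprod K As) (As ! j) (nproj K As j) h = (\<lambda>a\<in>carrier (As ! j). h (q a))"
      if "h \<in> linear_maps R (nprod K As) (S X)" for h
      unfolding q(2) by (rule KL_Comp_unit[OF 5(1) N that q(1)])
    show ?case
      unfolding Comp[OF linear_maps_zero_map[OF N Schur_module[OF 5(1)]]]
      by (rule restrict_ext) (simp add: q(1))
  qed
qed

section \<open>Differentials of tuples\<close>

text \<open>CD.4 for pairs is additivity of \<partial>, since a pairing is a pointwise sum of two
  components.\<close>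

lemma Diff_copair:
  assumes X: "module R X" and A: "module R A" and B: "module R B"
    and f: "f \<in> linear_maps R A (S X)" and g: "g \<in> linear_maps R B (S X)"
  shows "Diff K X (prd A B) (copair pr A B (S X) f g) =
    copair pr A B (S (prd X X)) (Diff K X A f) (Diff K X B g)"
  unfolding KL_Diff copair_def[OF pr, of A B "S (prd X X)"]
proof (rule restrict_ext)
  fix p assume "p \<in> carrier (prd A B)"
  then obtain a b where p: "p = pr (a, b)" "a \<in> carrier A" "b \<in> carrier B"
    by (auto simp: prod_carrier[OF pr A B])
  then show "Schur_partial R P pr X (copair pr A B (S X) f g p) =
      (\<lambda>w\<in>carrier A. Schur_partial R P pr X (f w)) (fst (inv_into UNIV pr p)) \<oplus>\<^bsub>S (prd X X)\<^esub>
      (\<lambda>w\<in>carrier B. Schur_partial R P pr X (g w)) (snd (inv_into UNIV pr p))"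
    using linear_mapsD(1)[OF f] linear_mapsD(1)[OF g]
    by (simp add: copair_pr[OF pr A B] inv_pr[OF pr] linear_mapsD(2)[OF Schur_partial_linear[OF X]])
qed

lemma ntuple_linear:
  assumes X: "module R X" and "\<forall>(A, f)\<in>set fs. module R A \<and> f \<in> linear_maps R A (S X)"
  shows "ntuple K X fs \<in> linear_maps R (nprod K (map fst fs)) (S X)"
  using assms(2)
proof (induction fs rule: induct_list012)
  case 1
  show ?case
    using theI'[OF finite_products.terminal[OF KL_finite_products, of X]] X by (simp add: KL_simps)
next
  case (2 x)
  then show ?case by (cases x) simp
next
  case (3 x y zs)
  obtain A f where x: "x = (A, f)" by (cases x)
  have N: "module R (nprod K (map fst (y # zs)))"
    using 3(3) by (intro nprod_module) auto
  have A: "module R A" "f \<in> linear_maps R A (S X)" using 3(3) x by auto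
  have t: "ntuple K X (y # zs) \<in> linear_maps R (nprod K (map fst (y # zs))) (S X)"
    using 3 by auto
  show ?case
    using copair_linear[OF pr A(1) N Schur_module[OF X] A(2) t] KL_pairing[OF A(1) N X A(2) t]
    by (simp add: x KL_simps)
qed

lemma Diff_ntuple:
  assumes X: "module R X" and "\<forall>(A, f)\<in>set fs. module R A \<and> f \<in> linear_maps R A (S X)"
  shows "Diff K X (nprod K (map fst fs)) (ntuple K X fs) = ntuple K (prd X X) (map (\<lambda>(A, f). (A, Diff K X A f)) fs)"
  using assms(2)
proof (induction fs rule: induct_list012)
  case 1
  have XX: "module R (prd X X)" by (rule prod_module[OF pr X X])
  have "module R (nprod K (map fst []))" by (rule nprod_module) simp
  \<comment> \<open>For the empty tuple both sides are maps into the terminal object.\<close>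
  from KL_Diff_linear[OF X this ntuple_linear[OF X]]
  have "Diff K X (nprod K []) (ntuple K X []) \<in> Hom K (prd X X) (Term K)"
    by (simp add: KL_simps)
  then show ?case
    using the1_equality[OF finite_products.terminal[OF KL_finite_products, of "prd X X"]] XX
    by (simp add: KL_simps)
next
  case (2 x)
  then show ?case by (cases x) simp
next
  case (3 x y zs)
  obtain A f where x: "x = (A, f)" by (cases x)
  obtain B g where y: "y = (B, g)" by (cases y)
  let ?N = "nprod K (map fst (y # zs))" and ?D = "\<lambda>(A, f). (A, Diff K X A f)"
  have XX: "module R (prd X X)" by (rule prod_module[OF pr X X])
  have N: "module R ?N"
    using 3(3) by (intro nprod_module) auto
  have A: "module R A" "f \<in> linear_maps R A (S X)" using 3(3) x by auto
  have t: "ntuple K X (y # zs) \<in> linear_maps R ?N (S X)"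
    using 3(3) by (intro ntuple_linear[OF X]) auto
  have IH: "Diff K X ?N (ntuple K X (y # zs)) = ntuple K (prd X X) (map ?D (y # zs))"
    using 3 by auto
  have fst_D: "fst \<circ> ?D = fst" by (auto simp: fun_eq_iff)
  have "Diff K X (nprod K (map fst (x # y # zs))) (ntuple K X (x # y # zs)) =
      Diff K X (prd A ?N) (copair pr A ?N (S X) f (ntuple K X (y # zs)))"
    using KL_pairing[OF A(1) N X A(2) t] by (simp add: x KL_simps)
  also have "\<dots> = copair pr A ?N (S (prd X X)) (Diff K X A f) (Diff K X ?N (ntuple K X (y # zs)))"
    by (rule Diff_copair[OF X A(1) N A(2) t])
  also have "\<dots> = pairing K (prd X X) A ?N (Diff K X A f) (Diff K X ?N (ntuple K X (y # zs)))"
    by (rule KL_pairing[OF A(1) N XX KL_Diff_linear[OF X A] KL_Diff_linear[OF X N t], symmetric])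
  also have "\<dots> = ntuple K (prd X X) (map ?D (x # y # zs))"
    unfolding IH by (simp add: x y fst_D)
  finally show ?case .
qed

section \<open>The axioms of the differential\<close>

text \<open>Rewrites D[f] \<circ> \<langle>g, h\<rangle> as a derivation after f, so that CD.2, CD.5
  and CD.6 become statements about \<open>kder\<close>.\<close>

lemma KL_Comp_Diff_pairing:
  assumes X: "module R X" and A: "module R A" and B: "module R B" and f: "f \<in> linear_maps R B (S A)"
    and g: "g \<in> linear_maps R A (S X)" and h: "h \<in> linear_maps R A (S X)"
  shows "Comp K X (prd A A) B (Diff K A B f) (pairing K X A A g h) = (\<lambda>b\<in>carrier B. kder A X g h (f b))"
  unfolding KL_pairing[OF A A X g h]
    KL_Comp_linear(1)[OF X prod_module[OF pr A A] B copair_linear[OF pr A A Schur_module[OF X] g h] KL_Diff_linear[OF A B f]]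
  by (rule restrict_ext) (simp add: KL_Diff kext_partial[OF A X g h] linear_mapsD(1)[OF f])

lemma KL_Comp_Diff_Diff_pairing:
  assumes X: "module R X" and A: "module R A" and B: "module R B" and f: "f \<in> linear_maps R B (S A)"
    and g: "g \<in> linear_maps R A (S X)" and h: "h \<in> linear_maps R A (S X)"
    and k: "k \<in> linear_maps R A (S X)" and j: "j \<in> linear_maps R A (S X)"
  shows "Comp K X (prd (prd A A) (prd A A)) B (Diff K (prd A A) B (Diff K A B f))
      (pairing K X (prd A A) (prd A A) (pairing K X A A g h) (pairing K X A A k j)) =
    (\<lambda>b\<in>carrier B. kder (prd A A) X (copair pr A A (S X) g h) (copair pr A A (S X) k j)
      (Schur_partial R P pr A (f b)))"
  unfolding KL_pairing[OF A A X g h] KL_pairing[OF A A X k j]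
    KL_Comp_Diff_pairing[OF X prod_module[OF pr A A] B KL_Diff_linear[OF A B f]
      copair_linear[OF pr A A Schur_module[OF X] g h] copair_linear[OF pr A A Schur_module[OF X] k j]]
  by (rule restrict_ext) (simp add: KL_Diff)

text \<open>The goals come in the order of the axioms: case 1 is \<open>Diff_hom\<close>, cases 2
  and 3 are CD.1, cases 4 and 5 CD.2, cases 6 and 7 CD.3, and cases 8 to 11 are CD.4 to CD.7. CD.1
  is linearity of \<partial>, and CD.3 is its value on units.\<close>

lemma KL_differential: "cartesian_differential_category K"
proof -
  interpret cartesian_left_additive_category K by (rule KL_left_additive)
  show ?thesis
  proof (unfold_locales, unfold KL_simps mem_Collect_eq, goal_cases)
    case (1 A B f)
    then show ?case by (rule KL_Diff_linear)
  next
    case (2 A B f g)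
    then show ?case
      unfolding KL_Diff
      by (intro restrict_ext) (simp add: linear_mapsD(2)[OF Schur_partial_linear[OF 2(1)]] linear_mapsD(1))
  next
    case (3 A B)
    show ?case
      unfolding KL_Diff
      by (rule restrict_ext)
        (simp add: linear_maps_zero[OF Schur_partial_linear[OF 3(1)] Schur_module[OF 3(1)] Schur_module[OF prod_module[OF pr 3(1) 3(1)]]])
  next
    case (4 X A B f g h k)
    note S = Schur_module[OF 4(1)]
    show ?case
      unfolding KL_Comp_Diff_pairing[OF 4(1-5) linear_maps_add[OF 4(2) S 4(6,7)]]
        KL_Comp_Diff_pairing[OF 4(1-6)] KL_Comp_Diff_pairing[OF 4(1-5) 4(7)]
      using linear_mapsD(1)[OF 4(4)]
      by (intro restrict_ext) (simp only: restrict_apply' kder_add[OF 4(2,1,5,6,7)])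
  next
    case (5 X A B f g)
    note S = Schur_module[OF 5(1)]
    show ?case
      unfolding KL_Comp_Diff_pairing[OF 5(1-5) linear_maps_zero_map[OF 5(2) S]]
      using linear_mapsD(1)[OF 5(4)]
      by (intro restrict_ext) (simp only: restrict_apply' kder_zero[OF 5(2,1,5)])
  next
    case (6 A)
    show ?case
      unfolding KL_Diff
      by (rule linear_maps_restrict_eqI[OF Snd_linear[OF 6 6]]) (rule Schur_partial_unit[OF 6])
  next
    case (7 As j)
    note N = nprod_module[OF 7(1)]
    obtain q where q: "\<And>a. a \<in> carrier (As ! j) \<Longrightarrow> q a \<in> carrier (nprod K As)"
      "nproj K As j = (\<lambda>a\<in>carrier (As ! j). Schur_unit R P (nprod K As) (q a))"
      using nproj_obtain[OF 7] by blast
    have "Comp K (prd (nprod K As) (nprod K As)) (nprod K As) (As ! j) (nproj K As j)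
        (Snd K (nprod K As) (nprod K As)) =
        (\<lambda>a\<in>carrier (As ! j). Snd K (nprod K As) (nprod K As) (q a))"
      unfolding q(2) by (rule KL_Comp_unit[OF prod_module[OF pr N N] N Snd_linear[OF N N] q(1)])
    moreover have "Diff K (nprod K As) (As ! j) (nproj K As j) =
        (\<lambda>a\<in>carrier (As ! j). Snd K (nprod K As) (nprod K As) (q a))"
      unfolding q(2) KL_Diff using q(1) by (intro restrict_ext) (simp add: Schur_partial_unit[OF N])
    ultimately show ?case by simp
  next
    case (8 X fs)
    then show ?case by (rule Diff_ntuple)
  next
    case (9 X Y Z f g)
    note XX = prod_module[OF pr 9(1) 9(1)]
    note F = Fst_linear[OF 9(1) 9(1)]
    show ?case
      unfolding KL_Comp_Diff_pairing[OF XX 9(2,3,5) KL_Comp_linear(2)[OF XX 9(1,2) F 9(4)] KL_Diff_linear[OF 9(1,2,4)]]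
      unfolding KL_Diff KL_Comp_linear(1)[OF 9] KL_Comp_linear(1)[OF XX 9(1,2) F 9(4)]
      using linear_mapsD(1)[OF 9(5)]
      by (intro restrict_ext) (simp only: restrict_apply' partial_kext[OF 9(1,2,4)])
  next
    case (10 X A B f g h)
    note S = Schur_module[OF 10(1)]
    note z = linear_maps_zero_map[OF 10(2) S]
    show ?case
      unfolding KL_Comp_Diff_Diff_pairing[OF 10(1-5) z z 10(6)] KL_Comp_Diff_pairing[OF 10]
      using linear_mapsD(1)[OF 10(4)]
      by (intro restrict_ext) (simp only: second_derivative_linear[OF 10(2,1,5,6) refl])
  next
    case (11 X A B f g h k j)
    show ?case
      unfolding KL_Comp_Diff_Diff_pairing[OF 11] KL_Comp_Diff_Diff_pairing[OF 11(1-5) 11(7,6,8)]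
      using linear_mapsD(1)[OF 11(4)]
      by (intro restrict_ext) (simp only: second_derivative_swap[OF 11(2,1,5-8)])
  qed
qed

end

end

theorem proposition4p2p1:
  fixes R :: "('r, 'c) ring_scheme"
    and P :: "('r, 'p) operad"
    and pr :: "'u \<times> 'u \<Rightarrow> 'u"
  assumes "cring R" and "operad R P" and "inj pr"
  shows "cartesian_differential_category (KLop R P pr)"
  using operad.KL_differential[OF assms(2,3)] .

end
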